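(* For infinitely many positive real $\lambda$, there exist infinitely many connected $n$-vertex graphs with bounded degree and second eigenvalue exactly $\lambda$ of multiplicity $\Omega(\log\log n)$. (That is, there are constants $\Delta$ and $c>0$ depending only on $\lambda$ and infinitely many connected graphs $G$ of maximum degree at most $\Delta$ whose second eigenvalue is exactly $\lambda$ and has multiplicity at least $c\log\log n$, where $n=|V(G)|$.) In particular, this holds when (a) $\lambda$ is a sufficiently large integer, or (b) $\lambda=2\sqrt{u^2+1}-1$ for a sufficiently large integer $u$.
   Context: Graphs are finite and simple. The eigenvalues of a graph $G$ are those of its adjacency matrix $A_G$. Eigenvalues are ordered decreasingly and counted with multiplicity; the second eigenvalue is $\lambda_2(A_G)$, the second largest in this ordering. *)

theory Defs
  imports
    Complex_Main
    "HOL-Computational_Algebra.Polynomial"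
    "Jordan_Normal_Form.Char_Poly"
    "Graph_Theory.Pair_Digraph"
    "Graph_Theory.Digraph_Component"
begin

text \<open>
  Finite simple graphs are the locale predicate \<^const>\<open>pair_graph\<close>: finite vertex set, irreflexive
  symmetric arc relation, so each undirected edge is the two arcs \<open>(u, v)\<close> and \<open>(v, u)\<close>.
  An \<open>n\<close>-vertex graph is taken on the vertex set \<open>{0..<n}\<close>. This is no restriction up to isomorphism,
  and since only finitely many graphs exist for each \<open>n\<close>, an infinite set of such graphs
  contains infinitely many pairwise non-isomorphic ones (and graphs with \<open>n\<close> arbitrarily large).
\<close>

definition graph_on :: "nat \<Rightarrow> nat pair_pre_digraph \<Rightarrow> bool" where
  "graph_on n G \<longleftrightarrow> pair_graph G \<and> pverts G = {0..<n}"

definition adj_matrix :: "nat pair_pre_digraph \<Rightarrow> real mat" where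
  "adj_matrix G = mat (card (pverts G)) (card (pverts G))
     (\<lambda>(i, j). if (i, j) \<in> parcs G then 1 else 0)"

text \<open>
  The real eigenvalues listed in decreasing order, each repeated according to its multiplicity
  as a root of the characteristic polynomial. For a real symmetric \<open>n \<times> n\<close> matrix, algebraic and
  geometric multiplicities agree and all eigenvalues are real, so the list has length \<open>n\<close>.
\<close>

definition eigenvalues_desc :: "real mat \<Rightarrow> real list" where
  "eigenvalues_desc A = rev (sorted_list_of_multiset (proots (char_poly A)))"

text \<open>Positions are counted from 0; only meaningful for matrices with at least two eigenvalues.\<close>

definition second_eigenvalue :: "real mat \<Rightarrow> real" where
  "second_eigenvalue A = eigenvalues_desc A ! 1"

definition eigenvalue_multiplicity :: "real mat \<Rightarrow> real \<Rightarrow> nat" where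
  "eigenvalue_multiplicity A x = Polynomial.order x (char_poly A)"

text \<open>In a symmetric digraph the out-degree of a vertex is its degree as an undirected graph.\<close>

definition max_degree_le :: "nat pair_pre_digraph \<Rightarrow> nat \<Rightarrow> bool" where
  "max_degree_le G \<Delta> \<longleftrightarrow> (\<forall>v \<in> pverts G. out_degree (with_proj G) v \<le> \<Delta>)"

definition many_bounded_degree_graphs :: "real \<Rightarrow> bool" where
  "many_bounded_degree_graphs lam \<longleftrightarrow>
     (\<exists>(\<Delta> :: nat) (c :: real). c > 0 \<and>
        infinite {G :: nat pair_pre_digraph. \<exists>n \<ge> 2.
          graph_on n G \<and> Digraph_Component.connected (with_proj G) \<and> max_degree_le G \<Delta> \<and>
          second_eigenvalue (adj_matrix G) = lam \<and>
          real (eigenvalue_multiplicity (adj_matrix G) lam) \<ge> c * ln (ln (real n))})"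

end

theory Submission
  imports Defs "Jordan_Normal_Form.Schur_Decomposition" "HOL-Computational_Algebra.Fundamental_Theorem_Algebra"
    "HOL-Computational_Algebra.Primes" "HOL-Analysis.L2_Norm" "HOL-Library.FuncSet"
begin

text \<open>
  The graphs are built from one common ingredient and a small pattern that depends on \<open>lam\<close>.

  The ingredient is a family of \<^emph>\<open>signed kernels\<close> (locale \<open>signed_kernels\<close>). For a fixed \<open>\<theta>\<close> and
  every \<open>m\<close> there are three graphs \<open>W (-1)\<close>, \<open>W 0\<close>, \<open>W 1\<close> on one vertex set \<open>U\<close> with at most
  \<open>B * 128 ^ m\<close> elements. All three are regular of degree \<open>4 * \<theta>\<close>; they share \<open>m\<close> orthogonal eigenvectors
  \<open>h 0, h 1, ...\<close> with entries \<open>1\<close> and \<open>-1\<close>, whose eigenvalue in \<open>W s\<close> is exactly \<open>s * \<theta>\<close>; and on the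
  orthogonal complement of these vectors and the constants their norm is at most \<open>7/20 * \<theta>\<close>.

  A pattern is a graph \<open>H\<close> together with a symmetric sign matrix \<open>N\<close> on a fixed finite set \<open>I\<close>. Take the
  vertices \<open>U \<times> I\<close>, put a copy of \<open>H\<close> on every \<open>{u} \<times> I\<close>, and join \<open>(u, a)\<close> to \<open>(u', b)\<close> whenever
  \<open>W (N a b) u u'\<close>. The adjacency operator acts on the vectors \<open>h j \<otimes> y\<close> as the matrix \<open>H + \<theta> N\<close> acts on
  \<open>y\<close>. On vectors that are constant along \<open>U\<close> it acts as \<open>H + 4 \<theta> J\<close>, where \<open>J\<close> is the all-ones matrix, so on those with
  coordinate sum zero its form is that of \<open>H\<close>. On the remaining part it is bounded by the top of \<open>H\<close>
  plus \<open>7/20 * \<theta> * card I\<close>. Hence, as soon as this last number does not exceed the top eigenvalue \<open>lam\<close> of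
  \<open>H + \<theta> N\<close>, and \<open>lam\<close> is below the degrees, \<open>lam\<close> is the second eigenvalue and it occurs at least once for
  each of the \<open>m\<close> vectors \<open>h j\<close> (theorem \<open>many_graphs\<close>). The degrees are bounded in terms of the pattern
  and \<open>\<theta>\<close>, and \<open>m\<close> is at least a constant times \<open>ln n\<close>, which exceeds \<open>ln (ln n)\<close>. It remains to choose patterns.
  For an integer \<open>lam\<close>, take \<open>N = 1\<close> and \<open>H\<close> regular of the degree that makes all row sums of \<open>H + \<theta> N\<close> equal
  to \<open>lam\<close>. For \<open>2 * sqrt (u\<^sup>2 + 1) - 1\<close> take two classes with opposite signs, arranged so that
  \<open>H + \<theta> N\<close> acts on class-constant vectors as the matrix with rows \<open>(2u-1, 2)\<close> and \<open>(2, -2u-1)\<close>.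

  The kernels come from a lamplighter-like walk. A state consists of a position in the torus
  \<open>Z_N \<times> Z_N\<close> with \<open>N = 8 ^ m\<close> and of \<open>m\<close> lamps. A lamp move with parameters \<open>k\<close> and \<open>l\<close> flips lamp \<open>j\<close> if
  the \<open>j\<close>-th octal digit of the position, rotated by \<open>l\<close>, is below \<open>k\<close>. As \<open>l\<close> runs through the eight
  rotations, every single lamp is flipped exactly \<open>k\<close> times, whatever the position is, so the sign of one lamp is an exact
  eigenvector, with eigenvalue proportional to \<open>1 - k/4\<close>; the choices \<open>k = 3, 4, 5\<close> give the three signs. Averaged
  over the position, the flips of different lamps are independent, and a product of at least two lamp signs is damped by
  \<open>(1 - k/4)\<^sup>2 \<le> 1/16\<close>. A bounded-degree expander on the torus, applied before and after each lamp move, replaces this average over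
  positions without disturbing functions of the lamps alone. The resulting moves form a regular multigraph that may have loops and
  multiple edges. Replacing each state by the \<open>q\<^sup>3\<close> elements of a Heisenberg group over \<open>Z_q\<close>, and
  each move by its own pseudorandom relation between clones, makes it a simple graph and changes the spectrum by a factor and an
  error that is small for large \<open>q\<close>.

  On the spectral side, \<open>second_eigenvalue_by_form\<close> translates a bound of the quadratic form on mean-zero
  vectors and \<open>m\<close> orthogonal eigenvectors into statements on the roots of the characteristic polynomial.
  The same form bound gives connectedness, since a union of components would carry a mean-zero
  vector that is multiplied by degrees, and these exceed \<open>lam\<close>.
\<close>

section \<open>Reading the second eigenvalue off a quadratic form\<close>

lemma real_rooted_poly_splits:
  fixes p :: "real poly"
  assumes "lead_coeff p = 1" "\<And>z. poly (map_poly complex_of_real p) z = 0 \<Longrightarrow> z \<in> \<real>"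
  shows "\<exists>es. p = (\<Prod>e\<leftarrow>es. [:- e, 1:])"
  using assms
proof (induction "degree p" arbitrary: p)
  case 0
  then obtain c where "p = [:c:]" by (metis degree_eq_zeroE)
  then show ?case using 0 by (intro exI[of _ "[]"]) (auto simp: one_pCons)
next
  case (Suc d)
  have "degree (map_poly complex_of_real p) = degree p" by simp
  then have "\<not> constant (poly (map_poly complex_of_real p))"
    using Suc(2) by (simp add: constant_degree)
  then obtain z where z: "poly (map_poly complex_of_real p) z = 0"
    using fundamental_theorem_of_algebra by blast
  then obtain r where r: "z = complex_of_real r" using Suc(4) by (auto elim: Reals_cases)
  have "complex_of_real (poly p r) = 0" using z unfolding r by simp
  then have "poly p r = 0" by simp
  then obtain q where q: "p = [:- r, 1:] * q" by (auto simp: poly_eq_0_iff_dvd)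
  have q0: "q \<noteq> 0" using q Suc(3) by auto
  have "degree p = degree [:- r, 1:] + degree q" unfolding q using q0 by (intro degree_mult_eq) auto
  then have dq: "d = degree q" using Suc(2) by simp
  have lq: "lead_coeff q = 1" using q Suc(3) by (simp only: lead_coeff_mult) simp
  interpret h: map_poly_comm_ring_hom complex_of_real ..
  have "\<exists>es. q = (\<Prod>e\<leftarrow>es. [:- e, 1:])"
  proof (rule Suc(1)[OF dq lq])
    fix z assume "poly (map_poly complex_of_real q) z = 0"
    moreover have "map_poly complex_of_real p = map_poly complex_of_real [:- r, 1:] * map_poly complex_of_real q"
      unfolding q by (rule h.hom_mult)
    ultimately show "z \<in> \<real>" using Suc(4) by simp
  qed
  then obtain es where es: "q = (\<Prod>e\<leftarrow>es. [:- e, 1:])" by blast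
  then show ?case using q by (intro exI[of _ "r # es"]) simp
qed

lemma mat_vec_eq_sum:
  assumes "A \<in> carrier_mat n n" "v \<in> carrier_vec n" "i < n"
  shows "(A *\<^sub>v v) $ i = (\<Sum>j<n. A $$ (i,j) * v $ j)"
  using assms by (auto simp: scalar_prod_def lessThan_atLeast0)

text \<open>
  For a complex eigenvector \<open>v\<close> with eigenvalue \<open>z\<close>, the number \<open>v* A v\<close> equals \<open>z\<close> times the squared norm of \<open>v\<close>
  and is fixed by conjugation because \<open>A\<close> is real and symmetric.
\<close>
lemma symmetric_char_poly_splits:
  fixes A :: "real mat"
  assumes A: "A \<in> carrier_mat n n" and sym: "\<And>i j. i < n \<Longrightarrow> j < n \<Longrightarrow> A $$ (i,j) = A $$ (j,i)"
  shows "\<exists>es. char_poly A = (\<Prod>e\<leftarrow>es. [:- e, 1:])"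
proof -
  let ?C = "map_mat complex_of_real A"
  have C: "?C \<in> carrier_mat n n" using A by simp
  have monic: "lead_coeff (char_poly A) = 1"
    using degree_monic_char_poly[OF A] by auto
  have "z \<in> \<real>" if "poly (map_poly complex_of_real (char_poly A)) z = 0" for z
  proof -
    have "eigenvalue ?C z"
      using that unfolding of_real_hom.char_poly_hom[OF A, symmetric] eigenvalue_root_char_poly[OF C] .
    then obtain v where v: "v \<in> carrier_vec n" "v \<noteq> 0\<^sub>v n" "?C *\<^sub>v v = z \<cdot>\<^sub>v v"
      using C unfolding eigenvalue_def eigenvector_def by auto
    have ev: "(\<Sum>j<n. complex_of_real (A $$ (i,j)) * v $ j) = z * v $ i" if "i < n" for i
      using mat_vec_eq_sum[OF C v(1) that] v(1) v(3) that A by simp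
    define s where "s = (\<Sum>i<n. cnj (v $ i) * (\<Sum>j<n. complex_of_real (A $$ (i,j)) * v $ j))"
    have "s = (\<Sum>i<n. cnj (v $ i) * (z * v $ i))" unfolding s_def by (intro sum.cong) (auto simp: ev)
    also have "\<dots> = z * of_real (\<Sum>i<n. (cmod (v $ i))\<^sup>2)"
      by (simp add: sum_distrib_left complex_norm_square mult_ac del: of_real_power)
    finally have s1: "s = z * of_real (\<Sum>i<n. (cmod (v $ i))\<^sup>2)" .
    have "cnj s = (\<Sum>i<n. \<Sum>j<n. v $ i * (complex_of_real (A $$ (i,j)) * cnj (v $ j)))"
      unfolding s_def by (simp add: sum_distrib_left)
    also have "\<dots> = (\<Sum>j<n. \<Sum>i<n. v $ i * (complex_of_real (A $$ (i,j)) * cnj (v $ j)))"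
      by (rule sum.swap)
    also have "\<dots> = s" unfolding s_def sum_distrib_left
      by (intro sum.cong refl) (simp add: sym mult_ac)
    finally have "cnj s = s" .
    then have sr: "s \<in> \<real>" by (simp add: Reals_cnj_iff)
    have "\<exists>i<n. v $ i \<noteq> 0"
    proof (rule ccontr)
      assume "\<not> ?thesis"
      then have "v = 0\<^sub>v n" using v(1) by (intro eq_vecI) auto
      then show False using v(2) by simp
    qed
    then have "(\<Sum>i<n. (cmod (v $ i))\<^sup>2) \<noteq> 0"
      by (subst sum_nonneg_eq_0_iff) auto
    then have "z = s / of_real (\<Sum>i<n. (cmod (v $ i))\<^sup>2)"
      using s1 by (metis nonzero_mult_div_cancel_right of_real_eq_0_iff)
    then show "z \<in> \<real>" using sr by (simp add: Reals_divide)
  qed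
  from real_rooted_poly_splits[OF monic(1) this] show ?thesis .
qed

lemma homogeneous_system_nontrivial_solution:
  fixes M :: "nat \<Rightarrow> nat \<Rightarrow> real"
  assumes "k < m"
  shows "\<exists>c. (\<exists>j<m. c j \<noteq> 0) \<and> (\<forall>i<k. (\<Sum>j<m. M i j * c j) = 0)"
proof -
  define A where "A = mat m m (\<lambda>(i,j). if i < k then M i j else 0)"
  have A: "A \<in> carrier_mat m m" by (simp add: A_def)
  have "A = mat\<^sub>r m m (\<lambda>i. if i = k then 0\<^sub>v m else vec m (\<lambda>j. if i < k then M i j else 0))"
    unfolding A_def by (rule eq_matI) auto
  moreover have "det \<dots> = 0" by (rule det_row_0) (use assms in auto)
  ultimately have "det A = 0" by simp
  then obtain v where v: "v \<in> carrier_vec m" "v \<noteq> 0\<^sub>v m" "A *\<^sub>v v = 0\<^sub>v m"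
    using det_0_iff_vec_prod_zero_field[OF A] by auto
  have "\<exists>i<m. v $ i \<noteq> 0"
  proof (rule ccontr)
    assume "\<not> ?thesis"
    then have "v = 0\<^sub>v m" using v(1) by (intro eq_vecI) auto
    then show False using v(2) by simp
  qed
  moreover have "(\<Sum>j<m. M i j * v $ j) = 0" if "i < k" for i
  proof -
    have "(A *\<^sub>v v) $ i = (\<Sum>j<m. A $$ (i,j) * v $ j)"
      using that assms by (intro mat_vec_eq_sum[OF A v(1)]) simp
    moreover have "\<dots> = (\<Sum>j<m. M i j * v $ j)"
      by (rule sum.cong) (use that assms in \<open>auto simp: A_def\<close>)
    ultimately show ?thesis using v(3) that assms by simp
  qed
  ultimately show ?thesis by blast
qed

text \<open>
  The Schur decomposition \<open>A = P B Q\<close> with \<open>Q\<close> inverse to \<open>P\<close>, in coordinates. What matters below is that the roots may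
  be listed in any order: the given list becomes the diagonal of \<open>B\<close>, so the roots of interest can be put first.
\<close>
lemma triangular_form:
  fixes A :: "real mat"
  assumes A: "A \<in> carrier_mat n n" and es: "char_poly A = (\<Prod>e\<leftarrow>es. [:- e, 1:])"
  obtains p q b :: "nat \<Rightarrow> nat \<Rightarrow> real"
  where "\<And>i j. i < n \<Longrightarrow> j < n \<Longrightarrow> (\<Sum>k<n. A $$ (i,k) * p k j) = (\<Sum>k<n. p i k * b k j)"
    and "\<And>i j. i < n \<Longrightarrow> j < n \<Longrightarrow> (\<Sum>k<n. q i k * A $$ (k,j)) = (\<Sum>k<n. b i k * q k j)"
    and "\<And>i j. i < n \<Longrightarrow> j < n \<Longrightarrow> (\<Sum>k<n. p i k * q k j) = (if i = j then 1 else 0)"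
    and "\<And>i j. i < n \<Longrightarrow> j < n \<Longrightarrow> (\<Sum>k<n. q i k * p k j) = (if i = j then 1 else 0)"
    and "\<And>i j. i < n \<Longrightarrow> j < i \<Longrightarrow> b i j = 0"
    and "\<And>i. i < n \<Longrightarrow> b i i = es ! i" and "length es = n"
proof -
  obtain B P Q where sd: "schur_decomposition A es = (B,P,Q)" by (cases "schur_decomposition A es")
  from schur_decomposition[OF A es sd]
  have sim: "similar_mat_wit A B P Q" and ut: "upper_triangular B" and dm: "diag_mat B = es" by auto
  note D = similar_mat_witD2[OF A sim]
  have prod: "(X * Y) $$ (i,j) = (\<Sum>k<n. X $$ (i,k) * Y $$ (k,j))"
    if "X \<in> carrier_mat n n" "Y \<in> carrier_mat n n" "i < n" "j < n" for X Y :: "real mat" and i j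
    using that by (auto simp: scalar_prod_def lessThan_atLeast0)
  have AP: "A * P = P * B"
  proof -
    have "(P * B) * Q * P = (P * B) * (Q * P)"
      by (rule assoc_mult_mat[of _ n n _ n _ n]) (use D in auto)
    then show ?thesis using D by simp
  qed
  have QA: "Q * A = B * Q"
  proof -
    have "Q * (P * (B * Q)) = (Q * P) * (B * Q)"
      by (rule assoc_mult_mat[symmetric, of _ n n _ n _ n]) (use D in auto)
    then show ?thesis using D by (simp add: assoc_mult_mat[of _ n n _ n _ n])
  qed
  show ?thesis
  proof (rule that[of "\<lambda>i j. P $$ (i,j)" "\<lambda>i j. B $$ (i,j)" "\<lambda>i j. Q $$ (i,j)"])
    fix i j assume ij: "i < n" "j < n"
    show "(\<Sum>k<n. A $$ (i,k) * P $$ (k,j)) = (\<Sum>k<n. P $$ (i,k) * B $$ (k,j))"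
      using prod[OF D(4) D(6) ij] prod[OF D(6) D(5) ij] AP by simp
    show "(\<Sum>k<n. Q $$ (i,k) * A $$ (k,j)) = (\<Sum>k<n. B $$ (i,k) * Q $$ (k,j))"
      using prod[OF D(7) D(4) ij] prod[OF D(5) D(7) ij] QA by simp
    show "(\<Sum>k<n. P $$ (i,k) * Q $$ (k,j)) = (if i = j then 1 else 0)"
      using prod[OF D(6) D(7) ij] D(1) ij by simp
    show "(\<Sum>k<n. Q $$ (i,k) * P $$ (k,j)) = (if i = j then 1 else 0)"
      using prod[OF D(7) D(6) ij] D(2) ij by simp
  next
    fix i j assume "i < n" "j < i"
    then show "B $$ (i,j) = 0" using ut D(5) by (auto simp: upper_triangular_def)
  next
    fix i assume "i < n"
    then show "B $$ (i,i) = es ! i" using dm D(5) by (auto simp: diag_mat_def)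
  next
    show "length es = n" using dm D(5) by (auto simp: diag_mat_def)
  qed
qed

text \<open>
  With \<open>lam\<close> listed first on the diagonal of the triangular form, \<open>k\<close> is its multiplicity. If \<open>k < m\<close>, some non-trivial
  combination of the \<open>m\<close> eigenvectors has its first \<open>k\<close> triangular coordinates equal to zero; back substitution from the last
  coordinate upwards, where the diagonal differs from \<open>lam\<close>, then makes it vanish altogether.
\<close>
lemma eigenspace_dim_le_order:
  fixes A :: "real mat" and h :: "nat \<Rightarrow> nat \<Rightarrow> real"
  assumes A: "A \<in> carrier_mat n n" and es: "char_poly A = (\<Prod>e\<leftarrow>es. [:- e, 1:])"
    and ev: "\<And>j i. j < m \<Longrightarrow> i < n \<Longrightarrow> (\<Sum>k<n. A $$ (i,k) * h j k) = lam * h j i"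
    and orth: "\<And>j j'. j < m \<Longrightarrow> j' < m \<Longrightarrow> j \<noteq> j' \<Longrightarrow> (\<Sum>i<n. h j i * h j' i) = 0"
    and nz: "\<And>j. j < m \<Longrightarrow> (\<Sum>i<n. h j i * h j i) \<noteq> 0"
  shows "m \<le> count (mset es) lam"
proof (rule ccontr)
  assume neg: "\<not> ?thesis"
  \<comment> \<open>The \<open>k\<close> copies of \<open>lam\<close> come first on the diagonal.\<close>
  define fs where "fs = filter (\<lambda>e. e = lam) es @ filter (\<lambda>e. e \<noteq> lam) es"
  define k where "k = length (filter (\<lambda>e. e = lam) es)"
  have mfs: "mset fs = mset es" unfolding fs_def by (simp add: mset_filter)
  have "k = count (mset es) lam" unfolding k_def by (induction es) auto
  then have km: "k < m" using neg by simp
  have fs: "char_poly A = (\<Prod>e\<leftarrow>fs. [:- e, 1:])"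
    unfolding es using mfs by (metis mset_map prod_mset_prod_list)
  obtain p q b where AP: "\<And>i j. i < n \<Longrightarrow> j < n \<Longrightarrow> (\<Sum>k<n. A $$ (i,k) * p k j) = (\<Sum>k<n. p i k * b k j)"
    and QA: "\<And>i j. i < n \<Longrightarrow> j < n \<Longrightarrow> (\<Sum>k<n. q i k * A $$ (k,j)) = (\<Sum>k<n. b i k * q k j)"
    and PQ: "\<And>i j. i < n \<Longrightarrow> j < n \<Longrightarrow> (\<Sum>k<n. p i k * q k j) = (if i = j then 1 else 0)"
    and QP: "\<And>i j. i < n \<Longrightarrow> j < n \<Longrightarrow> (\<Sum>k<n. q i k * p k j) = (if i = j then 1 else 0)"
    and ut: "\<And>i j. i < n \<Longrightarrow> j < i \<Longrightarrow> b i j = 0"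
    and di: "\<And>i. i < n \<Longrightarrow> b i i = fs ! i" and len: "length fs = n"
    by (rule triangular_form[OF A fs]) blast
  have ne: "fs ! i \<noteq> lam" if "i < n" "k \<le> i" for i
  proof -
    have "fs ! i = filter (\<lambda>e. e \<noteq> lam) es ! (i - k)"
      using that unfolding fs_def k_def by (simp add: nth_append)
    moreover have "i - k < length (filter (\<lambda>e. e \<noteq> lam) es)"
      using that len unfolding fs_def k_def by simp
    ultimately show ?thesis using nth_mem by fastforce
  qed
  obtain c where c0: "\<exists>j<m. c j \<noteq> 0"
    and c: "\<And>i. i < k \<Longrightarrow> (\<Sum>j<m. (\<Sum>l<n. q i l * h j l) * c j) = 0"
    using homogeneous_system_nontrivial_solution[OF km, of "\<lambda>i j. \<Sum>l<n. q i l * h j l"] by blast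
  define z where "z l = (\<Sum>j<m. c j * h j l)" for l
  define y where "y i = (\<Sum>l<n. q i l * z l)" for i
  have Az: "(\<Sum>l<n. A $$ (i,l) * z l) = lam * z i" if "i < n" for i
  proof -
    have "(\<Sum>l<n. A $$ (i,l) * z l) = (\<Sum>l<n. \<Sum>j<m. c j * (A $$ (i,l) * h j l))"
      unfolding z_def by (simp add: sum_distrib_left mult_ac)
    also have "\<dots> = (\<Sum>j<m. c j * (\<Sum>l<n. A $$ (i,l) * h j l))"
      by (subst sum.swap) (simp add: sum_distrib_left)
    also have "\<dots> = (\<Sum>j<m. c j * (lam * h j i))"
      by (intro sum.cong refl) (simp add: ev that)
    also have "\<dots> = lam * z i" by (simp add: z_def sum_distrib_left mult_ac)
    finally show ?thesis .
  qed
  have yk: "y i = 0" if "i < k" for i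
  proof -
    have "y i = (\<Sum>l<n. \<Sum>j<m. q i l * h j l * c j)"
      unfolding y_def z_def by (simp add: sum_distrib_left mult_ac)
    also have "\<dots> = (\<Sum>j<m. (\<Sum>l<n. q i l * h j l) * c j)"
      by (subst sum.swap) (simp add: sum_distrib_right)
    finally show ?thesis using c[OF that] by simp
  qed
  have By: "(\<Sum>l<n. b i l * y l) = lam * y i" if i: "i < n" for i
  proof -
    have "(\<Sum>l<n. b i l * y l) = (\<Sum>j<n. (\<Sum>l<n. b i l * q l j) * z j)"
      unfolding y_def sum_distrib_left sum_distrib_right by (subst sum.swap) (simp add: mult_ac)
    also have "\<dots> = (\<Sum>j<n. (\<Sum>l<n. q i l * A $$ (l,j)) * z j)"
      using i by (simp add: QA)
    also have "\<dots> = (\<Sum>l<n. q i l * (\<Sum>j<n. A $$ (l,j) * z j))"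
      unfolding sum_distrib_left sum_distrib_right by (subst sum.swap) (simp add: mult_ac)
    also have "\<dots> = (\<Sum>l<n. q i l * (lam * z l))" by (intro sum.cong refl) (simp add: Az)
    also have "\<dots> = lam * y i" by (simp add: y_def sum_distrib_left mult_ac)
    finally show ?thesis .
  qed
  have y0: "y i = 0" if "i < n" for i
    using that
  proof (induction "n - i" arbitrary: i rule: less_induct)
    case less
    show ?case
    proof (cases "i < k")
      case False
      have "lam * y i = (\<Sum>l<n. b i l * y l)" using By less by simp
      also have "\<dots> = (\<Sum>l\<in>{i}. b i l * y l)"
      proof (rule sum.mono_neutral_right)
        show "\<forall>l\<in>{..<n} - {i}. b i l * y l = 0"
        proof
          fix l assume "l \<in> {..<n} - {i}"
          then have "l < n" "l < i \<or> i < l" by auto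
          then show "b i l * y l = 0" using ut[of i l] less(1)[of l] less(2) diff_less_mono2[of i l n] by auto
        qed
      qed (use less in auto)
      finally have "(fs ! i - lam) * y i = 0" using di[OF less(2)] by auto
      then show ?thesis using ne[of i] less False by simp
    qed (use yk in auto)
  qed
  have z0: "z i = 0" if i: "i < n" for i
  proof -
    have "z i = (\<Sum>j<n. if i = j then z j else 0)" using i by simp
    also have "\<dots> = (\<Sum>j<n. (\<Sum>l<n. p i l * q l j) * z j)"
      by (intro sum.cong refl) (simp add: PQ i)
    also have "\<dots> = (\<Sum>l<n. p i l * y l)"
      unfolding y_def sum_distrib_left sum_distrib_right by (subst sum.swap) (simp add: mult_ac)
    finally show ?thesis by (simp add: y0)
  qed
  obtain j0 where j0: "j0 < m" "c j0 \<noteq> 0" using c0 by blast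
  have "0 = (\<Sum>i<n. h j0 i * z i)" by (simp add: z0)
  also have "\<dots> = (\<Sum>j<m. c j * (\<Sum>i<n. h j0 i * h j i))"
    unfolding z_def sum_distrib_left by (subst sum.swap) (simp add: mult_ac)
  also have "\<dots> = (\<Sum>j\<in>{j0}. c j * (\<Sum>i<n. h j0 i * h j i))"
    by (rule sum.mono_neutral_right) (use j0 orth in auto)
  finally show False using j0 nz by simp
qed

text \<open>
  Two roots above \<open>lam\<close>, placed first on the diagonal, give two orthogonal eigenvectors by Gram-Schmidt on the first two
  columns: symmetry of \<open>A\<close> removes the off-diagonal term. Their span contains a non-zero vector with coordinate
  sum zero, on which the form exceeds \<open>lam\<close> times the squared norm.
\<close>
lemma few_eigenvalues_above:
  fixes A :: "real mat"
  assumes A: "A \<in> carrier_mat n n" and sym: "\<And>i j. i < n \<Longrightarrow> j < n \<Longrightarrow> A $$ (i,j) = A $$ (j,i)"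
    and es: "char_poly A = (\<Prod>e\<leftarrow>es. [:- e, 1:])"
    and form: "\<And>x. (\<Sum>i<n. x i) = 0 \<Longrightarrow> (\<Sum>i<n. \<Sum>j<n. A $$ (i,j) * x i * x j) \<le> lam * (\<Sum>i<n. (x i)\<^sup>2)"
  shows "size (filter_mset (\<lambda>e. e > lam) (mset es)) \<le> 1"
proof (rule ccontr)
  assume neg: "\<not> ?thesis"
  define fs where "fs = filter (\<lambda>e. e > lam) es @ filter (\<lambda>e. \<not> e > lam) es"
  define k where "k = length (filter (\<lambda>e. e > lam) es)"
  have mfs: "mset fs = mset es" unfolding fs_def by (simp add: mset_filter)
  have k2: "k \<ge> 2" using neg unfolding k_def by (simp flip: mset_filter)
  have fs: "char_poly A = (\<Prod>e\<leftarrow>fs. [:- e, 1:])"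
    unfolding es using mfs by (metis mset_map prod_mset_prod_list)
  obtain p q b where AP: "\<And>i j. i < n \<Longrightarrow> j < n \<Longrightarrow> (\<Sum>k<n. A $$ (i,k) * p k j) = (\<Sum>k<n. p i k * b k j)"
    and QP: "\<And>i j. i < n \<Longrightarrow> j < n \<Longrightarrow> (\<Sum>k<n. q i k * p k j) = (if i = j then 1 else 0)"
    and ut: "\<And>i j. i < n \<Longrightarrow> j < i \<Longrightarrow> b i j = 0"
    and di: "\<And>i. i < n \<Longrightarrow> b i i = fs ! i" and len: "length fs = n"
    by (rule triangular_form[OF A fs]) blast
  have big: "fs ! i > lam" if "i < k" for i
    using that nth_mem[of i "filter (\<lambda>e. e > lam) es"] unfolding fs_def k_def by (auto simp: nth_append)
  have n2: "k \<le> n" using len unfolding fs_def k_def by simp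
  define u where "u i = p i 0" for i
  define ip where "ip x y = (\<Sum>i<n. x i * y i)" for x y :: "nat \<Rightarrow> real"
  define op where "op x i = (\<Sum>j<n. A $$ (i,j) * x j)" for x i
  have uu: "ip u u > 0"
  proof -
    have "ip u u \<noteq> 0"
    proof
      assume "ip u u = 0"
      then have "\<And>i. i < n \<Longrightarrow> p i 0 = 0" unfolding ip_def u_def by (subst (asm) sum_nonneg_eq_0_iff) auto
      then show False using QP[of 0 0] n2 k2 by simp
    qed
    moreover have "ip u u \<ge> 0" unfolding ip_def by (simp add: sum_nonneg)
    ultimately show ?thesis by simp
  qed
  define c where "c = ip (\<lambda>i. p i 1) u / ip u u"
  define v where "v i = p i 1 - c * u i" for i
  have uv: "ip v u = 0"
  proof -
    have "ip v u = ip (\<lambda>i. p i 1) u - c * ip u u"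
      unfolding ip_def v_def by (simp add: algebra_simps sum_subtractf sum_distrib_left)
    then show ?thesis using uu unfolding c_def by simp
  qed
  have vv: "ip v v > 0"
  proof -
    have "ip v v \<noteq> 0"
    proof
      assume "ip v v = 0"
      then have v0: "\<And>i. i < n \<Longrightarrow> v i = 0" unfolding ip_def by (subst (asm) sum_nonneg_eq_0_iff) auto
      have "(\<Sum>l<n. q 1 l * p l 1) = (\<Sum>l<n. q 1 l * v l) + c * (\<Sum>l<n. q 1 l * p l 0)"
        unfolding v_def u_def by (simp add: algebra_simps sum_subtractf sum_distrib_left)
      then show False using QP[of 1 1] QP[of 1 0] n2 k2 v0 by simp
    qed
    moreover have "ip v v \<ge> 0" unfolding ip_def by (simp add: sum_nonneg)
    ultimately show ?thesis by simp
  qed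
  have Au: "op u i = fs ! 0 * u i" if "i < n" for i
  proof -
    have "op u i = (\<Sum>l<n. p i l * b l 0)" unfolding op_def u_def using AP that by simp
    also have "\<dots> = (\<Sum>l\<in>{0}. p i l * b l 0)"
      by (rule sum.mono_neutral_right) (use that ut in auto)
    finally show ?thesis using di[of 0] that unfolding u_def by simp
  qed
  have Ap1: "op (\<lambda>i. p i 1) i = b 0 1 * u i + fs ! 1 * p i 1" if "i < n" for i
  proof -
    have "op (\<lambda>i. p i 1) i = (\<Sum>l<n. p i l * b l 1)" unfolding op_def using AP that n2 k2 by simp
    also have "\<dots> = (\<Sum>l\<in>{0,1}. p i l * b l 1)"
      by (rule sum.mono_neutral_right) (use that ut n2 k2 in auto)
    finally show ?thesis using di[of 1] that n2 k2 unfolding u_def by simp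
  qed
  define d where "d = b 0 1 + c * (fs ! 1 - fs ! 0)"
  have Av: "op v i = fs ! 1 * v i + d * u i" if "i < n" for i
  proof -
    have "op v i = op (\<lambda>i. p i 1) i - c * op u i"
      unfolding op_def v_def by (simp add: algebra_simps sum_subtractf sum_distrib_left)
    then show ?thesis using Ap1[OF that] Au[OF that] unfolding v_def d_def by (simp add: algebra_simps)
  qed
  have selfadj: "ip (op x) y = ip x (op y)" for x y
  proof -
    have "ip (op x) y = (\<Sum>i<n. \<Sum>j<n. A $$ (i,j) * x j * y i)"
      unfolding ip_def op_def by (simp add: sum_distrib_right)
    also have "\<dots> = (\<Sum>j<n. \<Sum>i<n. A $$ (i,j) * x j * y i)" by (rule sum.swap)
    also have "\<dots> = ip x (op y)"
      unfolding ip_def op_def sum_distrib_left by (intro sum.cong refl) (simp add: sym mult_ac)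
    finally show ?thesis .
  qed
  \<comment> \<open>Self-adjointness: \<open>A v\<close> is orthogonal to \<open>u\<close> because \<open>A u\<close> is a multiple of \<open>u\<close>.\<close>
  have d0: "d = 0"
  proof -
    have "ip (op v) u = fs ! 1 * ip v u + d * ip u u"
      unfolding ip_def by (simp add: Av algebra_simps sum.distrib sum_distrib_left)
    moreover have "ip v (op u) = fs ! 0 * ip v u"
      unfolding ip_def by (simp add: Au algebra_simps sum_distrib_left)
    ultimately have "d * ip u u = 0" using selfadj[of v u] uv by simp
    then show ?thesis using uu by simp
  qed
  \<comment> \<open>Some non-zero combination of the two eigenvectors has coordinate sum zero.\<close>
  define su where "su = (\<Sum>i<n. u i)"
  define sv where "sv = (\<Sum>i<n. v i)"
  define s where "s = (if su = 0 then 1 else - sv)"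
  define t where "t = (if su = 0 then 0 else su)"
  define x where "x i = s * u i + t * v i" for i
  have st: "s \<noteq> 0 \<or> t \<noteq> 0" unfolding s_def t_def by auto
  have "(\<Sum>i<n. x i) = s * su + t * sv" unfolding x_def su_def sv_def by (simp add: sum.distrib sum_distrib_left)
  also have "\<dots> = 0" unfolding s_def t_def by auto
  finally have le: "(\<Sum>i<n. \<Sum>j<n. A $$ (i,j) * x i * x j) \<le> lam * (\<Sum>i<n. (x i)\<^sup>2)" by (rule form)
  have vu: "ip u v = 0" using uv unfolding ip_def by (simp add: mult.commute)
  have opx: "op x i = s * fs ! 0 * u i + t * fs ! 1 * v i" if "i < n" for i
  proof -
    have "op x i = s * op u i + t * op v i"
      unfolding op_def x_def by (simp add: algebra_simps sum.distrib sum_distrib_left)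
    then show ?thesis using Au[OF that] Av[OF that] d0 by simp
  qed
  have "(\<Sum>i<n. \<Sum>j<n. A $$ (i,j) * x i * x j) = ip x (op x)"
    unfolding ip_def op_def by (simp add: sum_distrib_left mult_ac)
  also have "\<dots> = (\<Sum>i<n. x i * (s * fs ! 0 * u i + t * fs ! 1 * v i))"
    unfolding ip_def by (simp add: opx)
  also have "\<dots> = s\<^sup>2 * fs ! 0 * ip u u + t\<^sup>2 * fs ! 1 * ip v v + s * t * (fs ! 0 + fs ! 1) * ip u v"
    unfolding ip_def x_def
    by (simp add: algebra_simps sum.distrib sum_distrib_left power2_eq_square)
  finally have 1: "(\<Sum>i<n. \<Sum>j<n. A $$ (i,j) * x i * x j) = s\<^sup>2 * fs ! 0 * ip u u + t\<^sup>2 * fs ! 1 * ip v v"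
    using vu by simp
  have "(\<Sum>i<n. (x i)\<^sup>2) = s\<^sup>2 * ip u u + t\<^sup>2 * ip v v + 2 * s * t * ip u v"
    unfolding ip_def x_def
    by (simp add: algebra_simps sum.distrib sum_distrib_left power2_eq_square)
  then have 2: "(\<Sum>i<n. (x i)\<^sup>2) = s\<^sup>2 * ip u u + t\<^sup>2 * ip v v" using vu by simp
  have e0: "fs ! 0 - lam > 0" and e1: "fs ! 1 - lam > 0" using big[of 0] big[of 1] k2 by auto
  have "s\<^sup>2 * ((fs ! 0 - lam) * ip u u) + t\<^sup>2 * ((fs ! 1 - lam) * ip v v) > 0"
  proof -
    have a: "(fs ! 0 - lam) * ip u u > 0" "(fs ! 1 - lam) * ip v v > 0" using e0 e1 uu vv by auto
    show ?thesis
    proof (cases "s = 0")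
      case True
      then show ?thesis using st a by (simp add: True)
    next
      case False
      then have "s\<^sup>2 * ((fs ! 0 - lam) * ip u u) > 0" using a by simp
      moreover have "t\<^sup>2 * ((fs ! 1 - lam) * ip v v) \<ge> 0" using a by simp
      ultimately show ?thesis by linarith
    qed
  qed
  then show False using le unfolding 1 2 by (simp add: algebra_simps)
qed

text \<open>
  At most one root lies above \<open>lam\<close> and at least two roots equal \<open>lam\<close>, so position 1 of the decreasing list is \<open>lam\<close>.
\<close>
theorem second_eigenvalue_by_form:
  fixes A :: "real mat" and h :: "nat \<Rightarrow> nat \<Rightarrow> real"
  assumes A: "A \<in> carrier_mat n n" and sym: "\<And>i j. i < n \<Longrightarrow> j < n \<Longrightarrow> A $$ (i,j) = A $$ (j,i)"
    and form: "\<And>x. (\<Sum>i<n. x i) = 0 \<Longrightarrow> (\<Sum>i<n. \<Sum>j<n. A $$ (i,j) * x i * x j) \<le> lam * (\<Sum>i<n. (x i)\<^sup>2)"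
    and ev: "\<And>j i. j < m \<Longrightarrow> i < n \<Longrightarrow> (\<Sum>k<n. A $$ (i,k) * h j k) = lam * h j i"
    and orth: "\<And>j j'. j < m \<Longrightarrow> j' < m \<Longrightarrow> j \<noteq> j' \<Longrightarrow> (\<Sum>i<n. h j i * h j' i) = 0"
    and nz: "\<And>j. j < m \<Longrightarrow> (\<Sum>i<n. h j i * h j i) \<noteq> 0"
    and m: "m \<ge> 2"
  shows "second_eigenvalue A = lam" and "eigenvalue_multiplicity A lam \<ge> m"
proof -
  obtain es where es: "char_poly A = (\<Prod>e\<leftarrow>es. [:- e, 1:])"
    using symmetric_char_poly_splits[OF A sym] by blast
  have roots: "proots (char_poly A) = mset es"
    unfolding es
  proof (induction es)
    case (Cons a es)
    have "(\<Prod>e\<leftarrow>es. [:- e, 1:]) \<noteq> 0" by (auto simp: prod_list_zero_iff)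
    then have "proots ([:- a, 1:] * (\<Prod>e\<leftarrow>es. [:- e, 1:])) = proots [:- a, 1:] + proots (\<Prod>e\<leftarrow>es. [:- e, 1:])"
      by (intro proots_mult) auto
    then show ?case using Cons by (simp del: mult_pCons_left)
  qed simp
  have cnt: "m \<le> count (mset es) lam" by (rule eigenspace_dim_le_order[OF A es ev orth nz])
  have "char_poly A \<noteq> 0" using degree_monic_char_poly[OF A] by auto
  then show "eigenvalue_multiplicity A lam \<ge> m"
    unfolding eigenvalue_multiplicity_def using cnt roots by (metis count_proots)
  have few: "size (filter_mset (\<lambda>e. e > lam) (mset es)) \<le> 1"
    by (rule few_eigenvalues_above[OF A sym es form])
  define ds where "ds = rev (sort es)"
  have ds: "eigenvalues_desc A = ds" unfolding eigenvalues_desc_def roots ds_def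
    by (simp add: sorted_list_of_multiset_mset)
  have mds: "mset ds = mset es" unfolding ds_def by simp
  have sorted: "sorted (rev ds)" unfolding ds_def by simp
  have mono: "ds ! j \<le> ds ! i" if "i \<le> j" "j < length ds" for i j
    using sorted that by (simp add: sorted_rev_nth_mono)
  have len: "length ds \<ge> 2"
  proof -
    have "2 \<le> count (mset ds) lam" using cnt m mds by simp
    also have "\<dots> \<le> length ds" by (metis count_le_size size_mset)
    finally show ?thesis .
  qed
  have fewds: "length (filter (\<lambda>e. e > lam) ds) \<le> 1"
    using few mds by (metis mset_filter size_mset)
  have cntds: "length (filter (\<lambda>e. e = lam) ds) \<ge> 2"
  proof -
    have "length (filter (\<lambda>e. e = lam) ds) = count (mset ds) lam" by (induction ds) auto
    then show ?thesis using cnt m mds by simp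
  qed
  obtain a b cs where abc: "ds = a # b # cs" using len by (cases ds; cases "tl ds") auto
  have "b \<le> lam"
  proof (rule ccontr)
    assume "\<not> b \<le> lam"
    moreover have "a \<ge> b" using mono[of 0 1] abc by simp
    ultimately show False using fewds abc by simp
  qed
  moreover have "b \<ge> lam"
  proof (rule ccontr)
    assume b: "\<not> b \<ge> lam"
    have "\<forall>e\<in>set cs. e \<le> b"
    proof
      fix e assume "e \<in> set cs"
      then obtain i where "i < length cs" "cs ! i = e" by (auto simp: in_set_conv_nth)
      then show "e \<le> b" using mono[of 1 "i + 2"] abc by simp
    qed
    then have "filter (\<lambda>e. e = lam) cs = []" using b by (auto simp: filter_empty_conv)
    then show False using cntds abc b by (auto split: if_splits)
  qed
  ultimately show "second_eigenvalue A = lam" unfolding second_eigenvalue_def ds abc by simp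
qed

section \<open>A family of expanders on the discrete torus\<close>

lemma square_perturbation_lower_bound:
  fixes x y :: real
  shows "7/8 * x\<^sup>2 - 8 * (y - x)\<^sup>2 \<le> y\<^sup>2"
proof -
  have "y\<^sup>2 - (7/8 * x\<^sup>2 - 8 * (y - x)\<^sup>2) = (x + 8 * (y - x))\<^sup>2 / 8 + (y - x)\<^sup>2"
    by (simp add: power2_eq_square field_simps)
  moreover have "\<dots> \<ge> 0" by simp
  ultimately show ?thesis by linarith
qed

lemma sum_Un_le:
  fixes f :: "'a \<Rightarrow> real"
  assumes "finite A" "finite B" "\<And>x. f x \<ge> 0"
  shows "sum f (A \<union> B) \<le> sum f A + sum f B"
  using sum.union_inter[OF assms(1,2), of f] sum_nonneg[of "A \<inter> B" f] assms(3) by auto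

definition centred_box :: "int \<Rightarrow> (int \<times> int) set" where
  "centred_box N = {- (N div 2)..<- (N div 2) + N} \<times> {- (N div 2)..<- (N div 2) + N}"

text \<open>
  The torus maps act on frequencies by shears. The two sets below are the domains of a ping-pong argument: both shears
  \<open>(p, q) \<mapsto> (p, q \<plusminus> 2 p)\<close> send \<open>near_cone N\<close> into \<open>wide_cone N\<close>, with disjoint images, and the bound \<open>8 * \<bar>p\<bar> < N\<close> keeps all
  points inside the box, so that no reduction modulo \<open>N\<close> occurs.
\<close>
definition near_cone :: "int \<Rightarrow> (int \<times> int) set" where
  "near_cone N = {(p, q). \<bar>q\<bar> \<le> \<bar>p\<bar> \<and> 8 * \<bar>p\<bar> < N} - {(0, 0)}"

definition wide_cone :: "int \<Rightarrow> (int \<times> int) set" where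
  "wide_cone N = {(p, q). \<bar>p\<bar> \<le> \<bar>q\<bar> \<and> 8 * \<bar>p\<bar> < N \<and> 8 * \<bar>q\<bar> < 3 * N} - {(0, 0)}"

lemma finite_centred_box: "finite (centred_box N)"
  by (simp add: centred_box_def)

lemma small_in_centred_box:
  "8 * \<bar>p\<bar> < 3 * N \<Longrightarrow> 8 * \<bar>q\<bar> < 3 * N \<Longrightarrow> (p, q) \<in> centred_box N"
  unfolding centred_box_def by auto

lemma wide_cone_subset: "wide_cone N \<subseteq> centred_box N"
  unfolding wide_cone_def by (auto intro!: small_in_centred_box)

lemma near_cone_subset: "near_cone N \<subseteq> centred_box N"
  unfolding near_cone_def by (auto intro!: small_in_centred_box)

text \<open>
  If \<open>G\<close> is almost invariant under the shear, then the mass of \<open>near_cone N\<close> appears almost twice in \<open>wide_cone N\<close>.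
  The factor is \<open>7/4\<close> instead of \<open>2\<close> in order to keep the coefficient of the defect \<open>D\<close> bounded.
\<close>
lemma shear_ping_pong:
  fixes G :: "int \<times> int \<Rightarrow> real"
  assumes D: "(\<Sum>z\<in>centred_box N. (G (fst z, snd z - 2 * fst z) - G z)\<^sup>2) \<le> D"
  shows "7/4 * (\<Sum>z\<in>near_cone N. (G z)\<^sup>2) - 16 * D \<le> (\<Sum>z\<in>wide_cone N. (G z)\<^sup>2)"
proof -
  let ?B = "near_cone N"
  let ?minus = "\<lambda>z::int \<times> int. (fst z, snd z - 2 * fst z)"
  let ?plus = "\<lambda>z::int \<times> int. (fst z, snd z + 2 * fst z)"
  have finB: "finite ?B" using near_cone_subset finite_centred_box finite_subset by blast
  have finW: "finite (wide_cone N)" using wide_cone_subset finite_centred_box finite_subset by blast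
  have inj: "inj_on ?minus ?B" "inj_on ?plus ?B" by (auto simp: inj_on_def prod_eq_iff)
  have sub: "?minus ` ?B \<subseteq> wide_cone N" "?plus ` ?B \<subseteq> wide_cone N"
    unfolding near_cone_def wide_cone_def by (force simp: abs_if split: if_splits)+
  have disj: "?minus ` ?B \<inter> ?plus ` ?B = {}"
    unfolding near_cone_def by auto
  have m: "7/8 * (\<Sum>z\<in>?B. (G z)\<^sup>2) - 8 * D \<le> (\<Sum>z\<in>?minus ` ?B. (G z)\<^sup>2)"
  proof -
    have "(\<Sum>z\<in>?B. (G (?minus z) - G z)\<^sup>2) \<le> (\<Sum>z\<in>centred_box N. (G (?minus z) - G z)\<^sup>2)"
      by (rule sum_mono2) (auto simp: finite_centred_box near_cone_subset[THEN subsetD])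
    moreover have "7/8 * (\<Sum>z\<in>?B. (G z)\<^sup>2) - 8 * (\<Sum>z\<in>?B. (G (?minus z) - G z)\<^sup>2) \<le> (\<Sum>z\<in>?B. (G (?minus z))\<^sup>2)"
      unfolding sum_distrib_left sum_subtractf[symmetric] by (intro sum_mono square_perturbation_lower_bound)
    ultimately show ?thesis using D
      by (simp add: sum.reindex[OF inj(1)])
  qed
  have p: "7/8 * (\<Sum>z\<in>?B. (G z)\<^sup>2) - 8 * D \<le> (\<Sum>z\<in>?plus ` ?B. (G z)\<^sup>2)"
  proof -
    have "(\<Sum>z\<in>?B. (G (?plus z) - G z)\<^sup>2) = (\<Sum>z\<in>?plus ` ?B. (G (?minus z) - G z)\<^sup>2)"
      by (simp add: sum.reindex[OF inj(2)] power2_commute)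
    also have "\<dots> \<le> (\<Sum>z\<in>centred_box N. (G (?minus z) - G z)\<^sup>2)"
      by (rule sum_mono2) (use sub(2) wide_cone_subset finite_centred_box in auto)
    finally have "(\<Sum>z\<in>?B. (G (?plus z) - G z)\<^sup>2) \<le> D" using D by linarith
    moreover have "7/8 * (\<Sum>z\<in>?B. (G z)\<^sup>2) - 8 * (\<Sum>z\<in>?B. (G (?plus z) - G z)\<^sup>2) \<le> (\<Sum>z\<in>?B. (G (?plus z))\<^sup>2)"
      unfolding sum_distrib_left sum_subtractf[symmetric] by (intro sum_mono square_perturbation_lower_bound)
    ultimately show ?thesis
      by (simp add: sum.reindex[OF inj(2)])
  qed
  have "(\<Sum>z\<in>?minus ` ?B. (G z)\<^sup>2) + (\<Sum>z\<in>?plus ` ?B. (G z)\<^sup>2) = (\<Sum>z\<in>?minus ` ?B \<union> ?plus ` ?B. (G z)\<^sup>2)"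
    using finB disj by (intro sum.union_disjoint[symmetric]) auto
  also have "\<dots> \<le> (\<Sum>z\<in>wide_cone N. (G z)\<^sup>2)"
    by (rule sum_mono2) (use sub finW in auto)
  finally show ?thesis using m p by linarith
qed

text \<open>
  Apart from points with a large coordinate, \<open>wide_cone N\<close> lies in the swapped \<open>near_cone N\<close>. So the masses \<open>a\<close>
  and \<open>b\<close> of the two near cones satisfy \<open>7/4 * b \<le> a + errors\<close> and \<open>7/4 * a \<le> b + errors\<close>, and both are bounded by the errors;
  together with the far points they cover all non-zero frequencies.
\<close>
lemma mass_bounded_by_defects:
  fixes G :: "int \<times> int \<Rightarrow> real"
  assumes G0: "G (0, 0) = 0"
    and D3: "(\<Sum>z\<in>centred_box N. (G (fst z, snd z - 2 * fst z) - G z)\<^sup>2) \<le> D3"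
    and D4: "(\<Sum>z\<in>centred_box N. (G (fst z - 2 * snd z, snd z) - G z)\<^sup>2) \<le> D4"
    and far: "(\<Sum>z\<in>{z\<in>centred_box N. N \<le> 8 * \<bar>fst z\<bar> \<or> N \<le> 8 * \<bar>snd z\<bar>}. (G z)\<^sup>2) \<le> Fa"
  shows "3/4 * (\<Sum>z\<in>centred_box N. (G z)\<^sup>2) \<le> 11/4 * Fa + 16 * (D3 + D4)"
proof -
  let ?far = "{z\<in>centred_box N. N \<le> 8 * \<bar>fst z\<bar> \<or> N \<le> 8 * \<bar>snd z\<bar>}"
  let ?B = "near_cone N" and ?A = "prod.swap ` near_cone N"
  let ?m = "\<lambda>S. \<Sum>z\<in>S. (G z)\<^sup>2"
  have fin: "finite (centred_box N)" by (rule finite_centred_box)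
  have finB: "finite ?B" "finite ?A"
    using finite_subset[OF near_cone_subset finite_centred_box] by auto
  have swap_box: "prod.swap ` centred_box N = centred_box N" unfolding centred_box_def by (simp add: product_swap)
  have b: "7/4 * ?m ?B - 16 * D3 \<le> ?m (wide_cone N)" by (rule shear_ping_pong[OF D3])
  have "(\<Sum>z\<in>centred_box N. ((G \<circ> prod.swap) (fst z, snd z - 2 * fst z) - (G \<circ> prod.swap) z)\<^sup>2)
      = (\<Sum>z\<in>prod.swap ` centred_box N. (G (fst z - 2 * snd z, snd z) - G z)\<^sup>2)"
    by (subst sum.reindex) auto
  then have "(\<Sum>z\<in>centred_box N. ((G \<circ> prod.swap) (fst z, snd z - 2 * fst z) - (G \<circ> prod.swap) z)\<^sup>2) \<le> D4"
    using D4 swap_box by simp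
  from shear_ping_pong[OF this]
  have a: "7/4 * ?m ?A - 16 * D4 \<le> ?m (prod.swap ` wide_cone N)"
    by (simp add: sum.reindex o_def)
  have far_swap: "prod.swap ` ?far = ?far"
  proof -
    have "prod.swap ` ?far \<subseteq> ?far" unfolding centred_box_def by auto
    then have "prod.swap ` prod.swap ` ?far \<subseteq> prod.swap ` ?far" by (rule image_mono)
    then show ?thesis using \<open>prod.swap ` ?far \<subseteq> ?far\<close> by (simp add: image_image)
  qed
  have W: "wide_cone N \<subseteq> ?A \<union> ?far"
  proof
    fix z assume z: "z \<in> wide_cone N"
    obtain p q where pq: "z = (p, q)" by (cases z)
    show "z \<in> ?A \<union> ?far"
    proof (cases "8 * \<bar>q\<bar> < N")
      case True
      then have "(q, p) \<in> near_cone N" using z unfolding pq wide_cone_def near_cone_def by auto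
      then have "prod.swap (q, p) \<in> ?A" by (rule imageI)
      then show ?thesis unfolding pq by simp
    next
      case False
      then show ?thesis using z wide_cone_subset unfolding pq by force
    qed
  qed
  have "?m (wide_cone N) \<le> ?m (?A \<union> ?far)" by (rule sum_mono2) (use W fin finB in auto)
  also have "\<dots> \<le> ?m ?A + ?m ?far" by (rule sum_Un_le) (use fin finB in auto)
  finally have b': "?m (wide_cone N) \<le> ?m ?A + Fa" using far by linarith
  have W': "prod.swap ` wide_cone N \<subseteq> ?B \<union> ?far"
  proof -
    have "prod.swap ` wide_cone N \<subseteq> prod.swap ` (?A \<union> ?far)" using W by (rule image_mono)
    also have "\<dots> = ?B \<union> ?far" unfolding image_Un far_swap by (simp add: image_image)
    finally show ?thesis .
  qed
  have "?m (prod.swap ` wide_cone N) \<le> ?m (?B \<union> ?far)" by (rule sum_mono2) (use W' fin finB in auto)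
  also have "\<dots> \<le> ?m ?B + ?m ?far" by (rule sum_Un_le) (use fin finB in auto)
  finally have a': "?m (prod.swap ` wide_cone N) \<le> ?m ?B + Fa" using far by linarith
  have cover: "centred_box N - {(0,0)} \<subseteq> (?A \<union> ?B) \<union> ?far"
  proof
    fix z assume z: "z \<in> centred_box N - {(0,0)}"
    obtain p q where pq: "z = (p, q)" by (cases z)
    show "z \<in> (?A \<union> ?B) \<union> ?far"
    proof (cases "N \<le> 8 * \<bar>p\<bar> \<or> N \<le> 8 * \<bar>q\<bar>")
      case True
      then show ?thesis using z pq by auto
    next
      case False
      then have "(p, q) \<in> near_cone N \<or> (q, p) \<in> near_cone N"
        using z unfolding pq near_cone_def by auto
      then have "(p, q) \<in> near_cone N \<or> prod.swap (q, p) \<in> ?A" by (blast intro: imageI)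
      then show ?thesis unfolding pq by auto
    qed
  qed
  have "?m (centred_box N) \<le> ?m (centred_box N - {(0,0)})"
    using G0 fin by (cases "(0,0) \<in> centred_box N") (simp_all add: sum.remove)
  also have "\<dots> \<le> ?m ((?A \<union> ?B) \<union> ?far)" by (rule sum_mono2) (use cover fin finB in auto)
  also have "\<dots> \<le> ?m (?A \<union> ?B) + ?m ?far" by (rule sum_Un_le) (use fin finB in auto)
  also have "?m (?A \<union> ?B) \<le> ?m ?A + ?m ?B" by (rule sum_Un_le) (use fin finB in auto)
  finally have "?m (centred_box N) \<le> ?m ?A + ?m ?B + Fa" using far by linarith
  then show ?thesis using a b a' b' by (simp add: algebra_simps)
qed


definition unit_char :: "int \<Rightarrow> int \<Rightarrow> complex" where
  "unit_char N k = cis (2 * pi * of_int k / of_int N)"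

lemma unit_char_add: "unit_char N (k + l) = unit_char N k * unit_char N l"
  by (simp add: unit_char_def cis_mult add_divide_distrib algebra_simps)

lemma unit_char_0 [simp]: "unit_char N 0 = 1"
  by (simp add: unit_char_def)

lemma cnj_unit_char: "cnj (unit_char N k) = unit_char N (- k)"
  by (simp add: unit_char_def cis_cnj)

lemma cmod_unit_char [simp]: "cmod (unit_char N k) = 1"
  by (simp add: unit_char_def)

lemma unit_char_eq_1_iff:
  assumes "N > 0"
  shows "unit_char N k = 1 \<longleftrightarrow> N dvd k"
proof
  assume "unit_char N k = 1"
  then have "cos (2 * pi * of_int k / of_int N) = 1" by (simp add: unit_char_def complex_eq_iff)
  then obtain n :: int where "2 * pi * of_int k / of_int N = of_int n * 2 * pi" by (auto simp: cos_one_2pi_int)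
  then have "real_of_int k = of_int (N * n)" using assms by (simp add: field_simps)
  then have "k = N * n" by (simp only: of_int_eq_iff)
  then show "N dvd k" by simp
next
  assume "N dvd k"
  then obtain n where "k = N * n" by blast
  then have "2 * pi * of_int k / of_int N = 2 * pi * of_int n" using assms by simp
  then show "unit_char N k = 1" unfolding unit_char_def by (simp add: cis_multiple_2pi)
qed

lemma unit_char_cong:
  assumes "N > 0" "k mod N = l mod N"
  shows "unit_char N k = unit_char N l"
proof -
  have "N dvd k - l" using assms(2) by (simp add: mod_eq_dvd_iff)
  then have "unit_char N (k - l) = 1" using assms(1) by (simp add: unit_char_eq_1_iff)
  then show ?thesis using unit_char_add[of N "k - l" l] by simp
qed

lemma unit_char_power: "unit_char N k ^ n = unit_char N (int n * k)"
  by (induction n) (simp_all add: unit_char_add algebra_simps flip: unit_char_add)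

lemma unit_char_sum:
  assumes "N > 0"
  shows "(\<Sum>p\<in>{a..<a + N}. unit_char N (p * j)) = (if N dvd j then of_int N else 0)"
proof -
  have "(\<Sum>p\<in>{a..<a + N}. unit_char N (p * j)) = (\<Sum>k<nat N. unit_char N ((a + int k) * j))"
    by (rule sum.reindex_bij_witness[of _ "\<lambda>k. a + int k" "\<lambda>p. nat (p - a)"]) auto
  also have "\<dots> = unit_char N (a * j) * (\<Sum>k<nat N. unit_char N j ^ k)"
    by (simp add: unit_char_power unit_char_add sum_distrib_left distrib_right)
  also have "(\<Sum>k<nat N. unit_char N j ^ k) = (if N dvd j then of_int N else 0)"
  proof (cases "N dvd j")
    case True
    then have "unit_char N j = 1" using assms by (simp add: unit_char_eq_1_iff)
    then show ?thesis using True assms by simp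
  next
    case False
    then have "unit_char N j \<noteq> 1" using assms by (simp add: unit_char_eq_1_iff)
    moreover have "unit_char N j ^ nat N = 1"
      using assms by (simp add: unit_char_power unit_char_eq_1_iff)
    ultimately show ?thesis using False by (simp add: sum_gp_strict)
  qed
  also have "unit_char N (a * j) * \<dots> = (if N dvd j then of_int N else 0)"
    using assms by (auto simp: unit_char_eq_1_iff[THEN iffD2])
  finally show ?thesis .
qed

definition torus :: "int \<Rightarrow> (int \<times> int) set" where
  "torus N = {0..<N} \<times> {0..<N}"

lemma finite_torus [simp]: "finite (torus N)"
  by (simp add: torus_def)

text \<open>
  The frequency \<open>z\<close> ranges over integer pairs; only its class modulo \<open>N\<close> matters, and \<open>centred_box N\<close> is a system of
  representatives.
\<close>
definition dft :: "int \<Rightarrow> (int \<times> int \<Rightarrow> real) \<Rightarrow> int \<times> int \<Rightarrow> complex" where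
  "dft N f z = (\<Sum>x\<in>torus N. of_real (f x) * unit_char N (- (fst z * fst x + snd z * snd x)))"

lemma sum_rotate:
  "(\<Sum>z\<in>A. \<Sum>x\<in>B. \<Sum>y\<in>C. g z x y) = (\<Sum>x\<in>B. \<Sum>y\<in>C. \<Sum>z\<in>A. g z x y)"
proof -
  have "(\<Sum>z\<in>A. \<Sum>x\<in>B. \<Sum>y\<in>C. g z x y) = (\<Sum>x\<in>B. \<Sum>z\<in>A. \<Sum>y\<in>C. g z x y)"
    by (rule sum.swap)
  also have "\<dots> = (\<Sum>x\<in>B. \<Sum>y\<in>C. \<Sum>z\<in>A. g z x y)"
    by (intro sum.cong refl sum.swap)
  finally show ?thesis .
qed

lemma dft_parseval:
  assumes N: "N > 0"
  shows "(\<Sum>z\<in>centred_box N. (cmod (dft N f z))\<^sup>2) = (of_int N)\<^sup>2 * (\<Sum>x\<in>torus N. (f x)\<^sup>2)"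
proof -
  let ?I = "{- (N div 2)..<- (N div 2) + N}"
  let ?e = "unit_char N"
  have inner: "(\<Sum>z\<in>centred_box N. ?e (fst z * (fst y - fst x)) * ?e (snd z * (snd y - snd x)))
       = (if x = y then (of_int N)\<^sup>2 else 0)" if "x \<in> torus N" "y \<in> torus N" for x y
  proof -
    have "(\<Sum>z\<in>centred_box N. ?e (fst z * (fst y - fst x)) * ?e (snd z * (snd y - snd x)))
       = (\<Sum>p\<in>?I. ?e (p * (fst y - fst x))) * (\<Sum>q\<in>?I. ?e (q * (snd y - snd x)))"
      unfolding centred_box_def sum_product sum.cartesian_product by (simp add: case_prod_beta)
    also have "\<dots> = (if N dvd fst y - fst x then of_int N else 0) * (if N dvd snd y - snd x then of_int N else 0)"
      by (simp only: unit_char_sum[OF N])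
    also have "N dvd fst y - fst x \<longleftrightarrow> fst x = fst y"
      using that unfolding torus_def by (auto simp: mod_eq_dvd_iff[symmetric])
    also have "N dvd snd y - snd x \<longleftrightarrow> snd x = snd y"
      using that unfolding torus_def by (auto simp: mod_eq_dvd_iff[symmetric])
    finally show ?thesis by (auto simp: power2_eq_square prod_eq_iff)
  qed
  have "of_real (\<Sum>z\<in>centred_box N. (cmod (dft N f z))\<^sup>2) = (\<Sum>z\<in>centred_box N. dft N f z * cnj (dft N f z))"
    by (simp only: of_real_sum complex_norm_square)
  also have "\<dots> = (\<Sum>z\<in>centred_box N. \<Sum>x\<in>torus N. \<Sum>y\<in>torus N. of_real (f x) * of_real (f y) *
      (?e (fst z * (fst y - fst x)) * ?e (snd z * (snd y - snd x))))"
  proof (intro sum.cong refl)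
    fix z assume "z \<in> centred_box N"
    have "dft N f z * cnj (dft N f z) = (\<Sum>x\<in>torus N. \<Sum>y\<in>torus N.
       (of_real (f x) * ?e (- (fst z * fst x + snd z * snd x))) * (of_real (f y) * ?e (fst z * fst y + snd z * snd y)))"
      unfolding dft_def cnj_sum sum_product
      by (simp only: complex_cnj_mult complex_cnj_complex_of_real cnj_unit_char minus_minus)
    also have "\<dots> = (\<Sum>x\<in>torus N. \<Sum>y\<in>torus N. of_real (f x) * of_real (f y) *
      (?e (fst z * (fst y - fst x)) * ?e (snd z * (snd y - snd x))))"
    proof (intro sum.cong refl)
      fix x y
      have "?e (- (fst z * fst x + snd z * snd x)) * ?e (fst z * fst y + snd z * snd y)
         = ?e (fst z * (fst y - fst x)) * ?e (snd z * (snd y - snd x))"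
        unfolding unit_char_add[symmetric] by (simp add: algebra_simps)
      then show "(of_real (f x) * ?e (- (fst z * fst x + snd z * snd x))) * (of_real (f y) * ?e (fst z * fst y + snd z * snd y))
        = of_real (f x) * of_real (f y) * (?e (fst z * (fst y - fst x)) * ?e (snd z * (snd y - snd x)))"
        by (metis (no_types, lifting) mult.assoc mult.left_commute)
    qed
    finally show "dft N f z * cnj (dft N f z) = \<dots>" .
  qed
  also have "\<dots> = (\<Sum>x\<in>torus N. \<Sum>y\<in>torus N. of_real (f x) * of_real (f y) *
      (\<Sum>z\<in>centred_box N. ?e (fst z * (fst y - fst x)) * ?e (snd z * (snd y - snd x))))"
    unfolding sum_distrib_left by (rule sum_rotate)
  also have "\<dots> = (\<Sum>x\<in>torus N. \<Sum>y\<in>torus N. if x = y then of_real (f x) * of_real (f y) * (of_int N)\<^sup>2 else 0)"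
    by (intro sum.cong refl) (simp only: inner split: if_split, simp)
  also have "\<dots> = (\<Sum>x\<in>torus N. of_real (f x) * of_real (f x) * (of_int N)\<^sup>2)"
    by (intro sum.cong refl) simp
  also have "\<dots> = of_real ((of_int N)\<^sup>2 * (\<Sum>x\<in>torus N. (f x)\<^sup>2))"
    by (simp add: sum_distrib_left power2_eq_square mult_ac)
  finally show ?thesis by (simp only: of_real_eq_iff)
qed

definition shear1 :: "int \<Rightarrow> int \<times> int \<Rightarrow> int \<times> int" where
  "shear1 N x = ((fst x + 2 * snd x) mod N, snd x)"
definition shear2 :: "int \<Rightarrow> int \<times> int \<Rightarrow> int \<times> int" where
  "shear2 N x = (fst x, (snd x + 2 * fst x) mod N)"
definition shift1 :: "int \<Rightarrow> int \<times> int \<Rightarrow> int \<times> int" where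
  "shift1 N x = ((fst x + 1) mod N, snd x)"
definition shift2 :: "int \<Rightarrow> int \<times> int \<Rightarrow> int \<times> int" where
  "shift2 N x = (fst x, (snd x + 1) mod N)"

lemma bij_torus_maps:
  assumes N: "N > 0"
  shows "bij_betw (shear1 N) (torus N) (torus N)" "bij_betw (shear2 N) (torus N) (torus N)"
    "bij_betw (shift1 N) (torus N) (torus N)" "bij_betw (shift2 N) (torus N) (torus N)"
proof -
  show "bij_betw (shear1 N) (torus N) (torus N)"
    by (rule bij_betw_byWitness[where f' = "\<lambda>x. ((fst x - 2 * snd x) mod N, snd x)"])
      (use N in \<open>auto simp: mod_simps torus_def shear1_def\<close>)
  show "bij_betw (shear2 N) (torus N) (torus N)"
    by (rule bij_betw_byWitness[where f' = "\<lambda>x. (fst x, (snd x - 2 * fst x) mod N)"])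
      (use N in \<open>auto simp: mod_simps torus_def shear2_def\<close>)
  show "bij_betw (shift1 N) (torus N) (torus N)"
    by (rule bij_betw_byWitness[where f' = "\<lambda>x. ((fst x - 1) mod N, snd x)"])
      (use N in \<open>auto simp: mod_simps torus_def shift1_def\<close>)
  show "bij_betw (shift2 N) (torus N) (torus N)"
    by (rule bij_betw_byWitness[where f' = "\<lambda>x. (fst x, (snd x - 1) mod N)"])
      (use N in \<open>auto simp: mod_simps torus_def shift2_def\<close>)
qed

lemma mod_absorb_product:
  fixes N :: int
  shows "s = p * k + r - c \<Longrightarrow> s mod N = (p * (k mod N) + r - c) mod N"
    and "s = r + p * k - c \<Longrightarrow> s mod N = (r + p * (k mod N) - c) mod N"
proof -
  have "(p * (k mod N) + r - c) mod N = (p * k + r - c) mod N" "(r + p * (k mod N) - c) mod N = (r + p * k - c) mod N"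
    by (metis (no_types) mod_add_eq mod_diff_left_eq mod_mult_right_eq)+
  then show "s = p * k + r - c \<Longrightarrow> s mod N = (p * (k mod N) + r - c) mod N"
    and "s = r + p * k - c \<Longrightarrow> s mod N = (r + p * (k mod N) - c) mod N" by simp_all
qed

text \<open>
  An affine bijection of the torus permutes frequencies up to a phase. The hypothesis states the phase identity modulo \<open>N\<close>
  so that it covers shears (\<open>c = 0\<close>) as well as translations (\<open>z' = z\<close>).
\<close>
lemma dft_precompose:
  assumes N: "N > 0" and g: "bij_betw g (torus N) (torus N)"
    and phase: "\<And>x. x \<in> torus N \<Longrightarrow>
      (fst z * fst x + snd z * snd x) mod N = (fst z' * fst (g x) + snd z' * snd (g x) - c) mod N"
  shows "dft N (\<lambda>x. f (g x)) z = unit_char N c * dft N f z'"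
proof -
  have "dft N (\<lambda>x. f (g x)) z
    = (\<Sum>x\<in>torus N. of_real (f (g x)) * unit_char N (c + - (fst z' * fst (g x) + snd z' * snd (g x))))"
    unfolding dft_def
  proof (intro sum.cong refl arg_cong2[where f = "(*)"] unit_char_cong[OF N])
    fix x assume "x \<in> torus N"
    from phase[OF this] have "(- (fst z * fst x + snd z * snd x)) mod N = (- (fst z' * fst (g x) + snd z' * snd (g x) - c)) mod N"
      by (rule mod_minus_cong)
    then show "(- (fst z * fst x + snd z * snd x)) mod N = (c + - (fst z' * fst (g x) + snd z' * snd (g x))) mod N"
      by (simp add: algebra_simps)
  qed
  also have "\<dots> = (\<Sum>x\<in>torus N. unit_char N c * (of_real (f (g x)) * unit_char N (- (fst z' * fst (g x) + snd z' * snd (g x)))))"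
    by (simp only: unit_char_add mult_ac)
  also have "\<dots> = (\<Sum>y\<in>torus N. unit_char N c * (of_real (f y) * unit_char N (- (fst z' * fst y + snd z' * snd y))))"
    by (rule sum.reindex_bij_betw[OF g])
  finally show ?thesis unfolding dft_def sum_distrib_left .
qed

lemma dft_diff: "dft N (\<lambda>x. f x - g x) z = dft N f z - dft N g z"
  by (simp add: dft_def algebra_simps sum_subtractf)

text \<open>
  Frequencies with a coordinate of size at least \<open>N/8\<close> are moved by a translation through an angle of at least \<open>pi/4\<close>.
\<close>
lemma unit_char_far_from_1:
  assumes "N > 0" "N \<le> 8 * \<bar>k\<bar>" "2 * \<bar>k\<bar> \<le> N"
  shows "1/2 \<le> (cmod (unit_char N k - 1))\<^sup>2"
proof -
  define t where "t = 2 * pi * \<bar>real_of_int k\<bar> / of_int N"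
  have c: "cos (2 * pi * of_int k / of_int N) = cos t"
  proof -
    have "t = \<bar>2 * pi * of_int k / of_int N\<bar>"
      unfolding t_def using assms(1) by (simp add: abs_mult abs_divide)
    then show ?thesis by (simp only: cos_abs_real)
  qed
  have "real_of_int N \<le> 8 * \<bar>real_of_int k\<bar>" using assms(2) by linarith
  then have t1: "pi / 4 \<le> t" using assms(1) unfolding t_def by (simp add: field_simps)
  have "2 * \<bar>real_of_int k\<bar> \<le> real_of_int N" using assms(3) by linarith
  then have t2: "t \<le> pi" using assms(1) unfolding t_def by (simp add: field_simps)
  have "cos t \<le> cos (pi / 4)" using t1 t2 by (intro cos_monotone_0_pi_le) auto
  also have "\<dots> = sqrt 2 / 2" by (rule cos_45)
  also have "\<dots> \<le> 3/4"
  proof -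
    have "sqrt 2 \<le> 3/2" by (rule real_le_lsqrt) (auto simp: power2_eq_square)
    then show ?thesis by simp
  qed
  finally have "cos t \<le> 3/4" .
  moreover have "(cmod (unit_char N k - 1))\<^sup>2 = 2 - 2 * cos (2 * pi * of_int k / of_int N)"
    unfolding unit_char_def cmod_power2
    using sin_cos_squared_add[of "2 * pi * of_int k / of_int N"] by (simp add: power2_eq_square algebra_simps)
  ultimately show ?thesis using c by simp
qed

lemma gap_arith:
  fixes K S a b c d :: real
  assumes K: "K > 0" and h: "3/4 * (K * S) \<le> 11/4 * (2 * (K * a + K * b)) + 16 * (K * c + K * d)"
    and nn: "0 \<le> a" "0 \<le> b" "0 \<le> c" "0 \<le> d"
  shows "S \<le> 22 * (c + d + a + b)"
proof -
  define X Y where "X = a + b" and "Y = c + d"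
  have "X \<ge> 0" "Y \<ge> 0" using nn unfolding X_def Y_def by auto
  then have u: "22/3 * X \<le> 22 * X" "64/3 * Y \<le> 22 * Y" by (auto intro: mult_right_mono)
  have "K * S \<le> K * (22/3 * X + 64/3 * Y)" using h unfolding X_def Y_def by (simp add: field_simps)
  then have "S \<le> 22/3 * X + 64/3 * Y" using K by simp
  then have "S \<le> 22 * X + 22 * Y" using u by (metis add_mono order_trans)
  then show ?thesis unfolding X_def Y_def by (simp add: algebra_simps)
qed

text \<open>
  Parseval turns the defects of \<open>f\<close> under the four maps into defects of \<open>G = \<bar>dft f\<bar>\<close>. The shears act on \<open>G\<close> by shears of
  the frequencies, the translations control the far frequencies, and \<open>G\<close> vanishes at zero since \<open>f\<close> has mean zero.
\<close>
theorem torus_spectral_gap: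
  fixes f :: "int \<times> int \<Rightarrow> real"
  assumes N: "N > 0" and f: "(\<Sum>x\<in>torus N. f x) = 0"
  shows "(\<Sum>x\<in>torus N. (f x)\<^sup>2) \<le> 22 * ((\<Sum>x\<in>torus N. (f (shear1 N x) - f x)\<^sup>2)
    + (\<Sum>x\<in>torus N. (f (shear2 N x) - f x)\<^sup>2) + (\<Sum>x\<in>torus N. (f (shift1 N x) - f x)\<^sup>2)
    + (\<Sum>x\<in>torus N. (f (shift2 N x) - f x)\<^sup>2))"
proof -
  define G where "G z = cmod (dft N f z)" for z
  define D where "D g = (\<Sum>x\<in>torus N. (f (g x) - f x)\<^sup>2)" for g
  let ?N2 = "(real_of_int N)\<^sup>2"
  have "dft N f (0,0) = of_real (\<Sum>x\<in>torus N. f x)" unfolding dft_def by simp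
  then have G0: "G (0,0) = 0" using f unfolding G_def by simp
  have parD: "(\<Sum>z\<in>centred_box N. (cmod (dft N (\<lambda>x. f (g x)) z - dft N f z))\<^sup>2) = ?N2 * D g" for g
    unfolding D_def dft_parseval[OF N, symmetric] by (simp add: dft_diff)
  have sh1: "dft N (\<lambda>x. f (shear1 N x)) z = dft N f (fst z, snd z - 2 * fst z)" for z
  proof -
    have "dft N (\<lambda>x. f (shear1 N x)) z = unit_char N 0 * dft N f (fst z, snd z - 2 * fst z)"
      by (rule dft_precompose[OF N bij_torus_maps(1)[OF N]], unfold shear1_def fst_conv snd_conv,
          rule mod_absorb_product(1)) (simp add: algebra_simps)
    then show ?thesis by simp
  qed
  have sh2: "dft N (\<lambda>x. f (shear2 N x)) z = dft N f (fst z - 2 * snd z, snd z)" for z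
  proof -
    have "dft N (\<lambda>x. f (shear2 N x)) z = unit_char N 0 * dft N f (fst z - 2 * snd z, snd z)"
      by (rule dft_precompose[OF N bij_torus_maps(2)[OF N]], unfold shear2_def fst_conv snd_conv,
          rule mod_absorb_product(2)) (simp add: algebra_simps)
    then show ?thesis by simp
  qed
  have tr1: "dft N (\<lambda>x. f (shift1 N x)) z = unit_char N (fst z) * dft N f z" for z
    by (rule dft_precompose[OF N bij_torus_maps(3)[OF N]], unfold shift1_def fst_conv snd_conv,
          rule mod_absorb_product(1)) (simp add: algebra_simps)
  have tr2: "dft N (\<lambda>x. f (shift2 N x)) z = unit_char N (snd z) * dft N f z" for z
    by (rule dft_precompose[OF N bij_torus_maps(4)[OF N]], unfold shift2_def fst_conv snd_conv,
          rule mod_absorb_product(2)) (simp add: algebra_simps)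
  have abs_diff: "(cmod a - cmod b)\<^sup>2 \<le> (cmod (a - b))\<^sup>2" for a b :: complex
    using norm_triangle_ineq3[of a b] by (simp add: abs_le_square_iff[symmetric])
  have D3: "(\<Sum>z\<in>centred_box N. (G (fst z, snd z - 2 * fst z) - G z)\<^sup>2) \<le> ?N2 * D (shear1 N)"
    unfolding parD[symmetric] G_def sh1 by (intro sum_mono abs_diff)
  have D4: "(\<Sum>z\<in>centred_box N. (G (fst z - 2 * snd z, snd z) - G z)\<^sup>2) \<le> ?N2 * D (shear2 N)"
    unfolding parD[symmetric] G_def sh2 by (intro sum_mono abs_diff)
  let ?far = "{z\<in>centred_box N. N \<le> 8 * \<bar>fst z\<bar> \<or> N \<le> 8 * \<bar>snd z\<bar>}"
  have far: "(\<Sum>z\<in>?far. (G z)\<^sup>2) \<le> 2 * (?N2 * D (shift1 N) + ?N2 * D (shift2 N))"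
  proof -
    have tr: "(cmod (unit_char N k * dft N f z - dft N f z))\<^sup>2 = (cmod (unit_char N k - 1))\<^sup>2 * (G z)\<^sup>2" for k z
      unfolding G_def power_mult_distrib[symmetric] norm_mult[symmetric] by (simp add: algebra_simps)
    have "(\<Sum>z\<in>?far. (G z)\<^sup>2) \<le> (\<Sum>z\<in>?far. 2 * ((cmod (unit_char N (fst z) - 1))\<^sup>2 * (G z)\<^sup>2
        + (cmod (unit_char N (snd z) - 1))\<^sup>2 * (G z)\<^sup>2))"
    proof (rule sum_mono)
      fix z assume z: "z \<in> ?far"
      then have b: "2 * \<bar>fst z\<bar> \<le> N" "2 * \<bar>snd z\<bar> \<le> N" unfolding centred_box_def by auto
      have "1/2 \<le> (cmod (unit_char N (fst z) - 1))\<^sup>2 \<or> 1/2 \<le> (cmod (unit_char N (snd z) - 1))\<^sup>2"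
        using z b unit_char_far_from_1[OF N] by blast
      then have "1/2 \<le> (cmod (unit_char N (fst z) - 1))\<^sup>2 + (cmod (unit_char N (snd z) - 1))\<^sup>2"
        using zero_le_power2[of "cmod (unit_char N (fst z) - 1)"] zero_le_power2[of "cmod (unit_char N (snd z) - 1)"] by linarith
      then have "1/2 * (G z)\<^sup>2 \<le> ((cmod (unit_char N (fst z) - 1))\<^sup>2 + (cmod (unit_char N (snd z) - 1))\<^sup>2) * (G z)\<^sup>2"
        by (rule mult_right_mono) simp
      then show "(G z)\<^sup>2 \<le> 2 * ((cmod (unit_char N (fst z) - 1))\<^sup>2 * (G z)\<^sup>2 + (cmod (unit_char N (snd z) - 1))\<^sup>2 * (G z)\<^sup>2)"
        by (simp add: algebra_simps)
    qed
    also have "\<dots> \<le> (\<Sum>z\<in>centred_box N. 2 * ((cmod (unit_char N (fst z) - 1))\<^sup>2 * (G z)\<^sup>2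
        + (cmod (unit_char N (snd z) - 1))\<^sup>2 * (G z)\<^sup>2))"
      by (rule sum_mono2) (auto simp: finite_centred_box)
    also have "\<dots> = 2 * (?N2 * D (shift1 N) + ?N2 * D (shift2 N))"
      unfolding parD[symmetric] tr1 tr2 tr by (simp add: sum.distrib sum_distrib_left)
    finally show ?thesis .
  qed
  from mass_bounded_by_defects[OF G0 D3 D4 far]
  have m: "3/4 * (?N2 * (\<Sum>x\<in>torus N. (f x)\<^sup>2))
     \<le> 11/4 * (2 * (?N2 * D (shift1 N) + ?N2 * D (shift2 N))) + 16 * (?N2 * D (shear1 N) + ?N2 * D (shear2 N))"
    unfolding G_def dft_parseval[OF N] .
  have nn: "D g \<ge> 0" for g unfolding D_def by (simp add: sum_nonneg)
  have N2: "?N2 > 0" using N by simp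
  show ?thesis using gap_arith[OF N2 m nn nn nn nn] unfolding D_def .
qed

text \<open>
  The four identity entries pair up with the four maps: through the parallelogram law, a lower bound on the defects \<open>f \<circ> g - f\<close>
  becomes an upper bound on the norms of the sums \<open>f + f \<circ> g\<close>.
\<close>
definition torus_step :: "int \<Rightarrow> nat \<Rightarrow> int \<times> int \<Rightarrow> int \<times> int" where
  "torus_step N i = [id, id, id, id, shear1 N, shear2 N, shift1 N, shift2 N] ! i"

lemma bij_torus_step: "N > 0 \<Longrightarrow> i < 8 \<Longrightarrow> bij_betw (torus_step N i) (torus N) (torus N)"
proof -
  assume N: "N > 0" and "i < 8"
  then have "i = 0 \<or> i = 1 \<or> i = 2 \<or> i = 3 \<or> i = 4 \<or> i = 5 \<or> i = 6 \<or> i = 7" by linarith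
  then show ?thesis using bij_torus_maps[OF N] by (elim disjE) (simp_all add: torus_step_def bij_betw_id)
qed

lemma sum_less_8: "(\<Sum>i<8. h i) = h 0 + h 1 + h 2 + h 3 + h 4 + h 5 + h 6 + (h 7 :: real)" for h :: "nat \<Rightarrow> real"
  by (simp add: numeral_eq_Suc)

lemma four_squares: "(a + b + c + d)\<^sup>2 \<le> 4 * (a\<^sup>2 + b\<^sup>2 + c\<^sup>2 + (d::real)\<^sup>2)"
proof -
  have "4 * (a\<^sup>2 + b\<^sup>2 + c\<^sup>2 + d\<^sup>2) - (a + b + c + d)\<^sup>2
     = (a - b)\<^sup>2 + (a - c)\<^sup>2 + (a - d)\<^sup>2 + (b - c)\<^sup>2 + (b - d)\<^sup>2 + (c - d)\<^sup>2"
    by (simp add: power2_eq_square algebra_simps)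
  moreover have "\<dots> \<ge> 0" by simp
  ultimately show ?thesis by linarith
qed

text \<open>
  The four defects, which are lost in the parallelogram law, add up by the spectral gap to at least \<open>1/22\<close> of the squared norm, and \<open>4 / 22 = 64 / 352\<close>.
\<close>
lemma torus_step_contracts:
  fixes f :: "int \<times> int \<Rightarrow> real"
  assumes N: "N > 0" and f: "(\<Sum>x\<in>torus N. f x) = 0"
  shows "(\<Sum>x\<in>torus N. (\<Sum>i<8. f (torus_step N i x))\<^sup>2) \<le> 64 * (351/352) * (\<Sum>x\<in>torus N. (f x)\<^sup>2)"
proof -
  let ?S = "\<Sum>x\<in>torus N. (f x)\<^sup>2"
  let ?D = "\<lambda>g. \<Sum>x\<in>torus N. (f (g x) - f x)\<^sup>2"
  have parallelogram: "(\<Sum>x\<in>torus N. (f x + f (g x))\<^sup>2) = 4 * ?S - ?D g" if "bij_betw g (torus N) (torus N)" for g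
  proof -
    have "(\<Sum>x\<in>torus N. (f x + f (g x))\<^sup>2) + ?D g = (\<Sum>x\<in>torus N. 2 * (f x)\<^sup>2 + 2 * (f (g x))\<^sup>2)"
      unfolding sum.distrib[symmetric] by (intro sum.cong refl) (simp add: power2_eq_square algebra_simps)
    also have "\<dots> = 2 * ?S + 2 * (\<Sum>x\<in>torus N. (f (g x))\<^sup>2)" by (simp add: sum.distrib sum_distrib_left)
    also have "(\<Sum>x\<in>torus N. (f (g x))\<^sup>2) = ?S" by (rule sum.reindex_bij_betw[OF that])
    finally show ?thesis by simp
  qed
  have "(\<Sum>x\<in>torus N. (\<Sum>i<8. f (torus_step N i x))\<^sup>2) \<le> (\<Sum>x\<in>torus N. 4 * ((f x + f (shear1 N x))\<^sup>2
     + (f x + f (shear2 N x))\<^sup>2 + (f x + f (shift1 N x))\<^sup>2 + (f x + f (shift2 N x))\<^sup>2))"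
  proof (rule sum_mono)
    fix x
    have "(\<Sum>i<8. f (torus_step N i x)) = (f x + f (shear1 N x)) + (f x + f (shear2 N x)) + (f x + f (shift1 N x)) + (f x + f (shift2 N x))"
      unfolding sum_less_8 by (simp add: torus_step_def eval_nat_numeral)
    then show "(\<Sum>i<8. f (torus_step N i x))\<^sup>2 \<le> 4 * ((f x + f (shear1 N x))\<^sup>2
     + (f x + f (shear2 N x))\<^sup>2 + (f x + f (shift1 N x))\<^sup>2 + (f x + f (shift2 N x))\<^sup>2)"
      by (simp only: four_squares)
  qed
  also have "\<dots> = 4 * (4 * (4 * ?S) - (?D (shear1 N) + ?D (shear2 N) + ?D (shift1 N) + ?D (shift2 N)))"
    by (simp add: sum_distrib_left[symmetric] sum.distrib parallelogram bij_torus_maps[OF N])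
  also have "\<dots> \<le> 64 * (351/352) * ?S"
    using torus_spectral_gap[OF N f] by simp
  finally show ?thesis .
qed

lemma sum_div_mod:
  fixes h :: "nat \<Rightarrow> nat \<Rightarrow> 'a::comm_monoid_add"
  assumes "b > 0"
  shows "(\<Sum>i<a * b. h (i div b) (i mod b)) = (\<Sum>q<a. \<Sum>r<b. h q r)"
proof -
  have "(\<Sum>i<a * b. h (i div b) (i mod b)) = (\<Sum>(q,r)\<in>{..<a} \<times> {..<b}. h q r)"
  proof (rule sum.reindex_bij_witness[of _ "\<lambda>(q,r). q * b + r" "\<lambda>i. (i div b, i mod b)"])
    fix x assume "x \<in> {..<a} \<times> {..<b}"
    then obtain q r where x: "x = (q, r)" "q < a" "r < b" by auto
    have "q * b + r < q * b + b" using x by simp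
    also have "\<dots> = Suc q * b" by simp
    also have "\<dots> \<le> a * b" using x by (intro mult_le_mono1) simp
    finally show "(case x of (q, r) \<Rightarrow> q * b + r) \<in> {..<a * b}" using x by simp
  qed (use assms in \<open>auto simp: less_mult_imp_div_less\<close>)
  then show ?thesis by (simp add: sum.cartesian_product)
qed

text \<open>
  Words of length \<open>k\<close> in the eight steps, numbered by the base 8 digits of their index.
\<close>
lemma torus_word_contracts:
  assumes N: "N > 0"
  shows "\<exists>g. (\<forall>i<(8::nat) ^ k. bij_betw (g i) (torus N) (torus N)) \<and>
    (\<forall>f::int \<times> int \<Rightarrow> real. (\<Sum>x\<in>torus N. f x) = 0 \<longrightarrow>
      (\<Sum>x\<in>torus N. (\<Sum>i<(8::nat) ^ k. f (g i x))\<^sup>2) \<le> (64 * (351/352)) ^ k * (\<Sum>x\<in>torus N. (f x)\<^sup>2))"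
proof (induction k)
  case 0
  show ?case by (intro exI[of _ "\<lambda>i. id"]) (auto simp: bij_betw_def)
next
  case (Suc k)
  then obtain g where g: "\<And>i. i < (8::nat) ^ k \<Longrightarrow> bij_betw (g i) (torus N) (torus N)"
    and c: "\<And>f::int \<times> int \<Rightarrow> real. (\<Sum>x\<in>torus N. f x) = 0 \<Longrightarrow>
      (\<Sum>x\<in>torus N. (\<Sum>i<(8::nat) ^ k. f (g i x))\<^sup>2) \<le> (64 * (351/352)) ^ k * (\<Sum>x\<in>torus N. (f x)\<^sup>2)"
    by blast
  define g' where "g' i = torus_step N (i mod 8) \<circ> g (i div 8)" for i
  show ?case
  proof (intro exI[of _ g'] conjI allI impI)
    fix i :: nat assume "i < (8::nat) ^ Suc k"
    then have "i div 8 < (8::nat) ^ k" by (simp add: less_mult_imp_div_less mult.commute)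
    then show "bij_betw (g' i) (torus N) (torus N)"
      unfolding g'_def by (intro bij_betw_trans[OF g bij_torus_step[OF N]]) auto
  next
    fix f :: "int \<times> int \<Rightarrow> real" assume f: "(\<Sum>x\<in>torus N. f x) = 0"
    define f' where "f' x = (\<Sum>r<8. f (torus_step N r x))" for x
    have "(\<Sum>x\<in>torus N. f' x) = (\<Sum>r<8. \<Sum>x\<in>torus N. f (torus_step N r x))"
      unfolding f'_def by (rule sum.swap)
    also have "\<dots> = (\<Sum>r<(8::nat). \<Sum>x\<in>torus N. f x)"
      by (intro sum.cong refl sum.reindex_bij_betw bij_torus_step N) simp
    finally have f': "(\<Sum>x\<in>torus N. f' x) = 0" using f by simp
    have "(\<Sum>i<(8::nat) ^ Suc k. f (g' i x)) = (\<Sum>i<(8::nat) ^ k. f' (g i x))" for x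
      using sum_div_mod[of 8 "\<lambda>q r. f (torus_step N r (g q x))" "(8::nat) ^ k"]
      unfolding g'_def f'_def by (simp add: mult.commute)
    then have "(\<Sum>x\<in>torus N. (\<Sum>i<(8::nat) ^ Suc k. f (g' i x))\<^sup>2) = (\<Sum>x\<in>torus N. (\<Sum>i<(8::nat) ^ k. f' (g i x))\<^sup>2)" by simp
    also have "\<dots> \<le> (64 * (351/352)) ^ k * (\<Sum>x\<in>torus N. (f' x)\<^sup>2)" by (rule c[OF f'])
    also have "\<dots> \<le> (64 * (351/352)) ^ k * (64 * (351/352) * (\<Sum>x\<in>torus N. (f x)\<^sup>2))"
      unfolding f'_def by (intro mult_left_mono torus_step_contracts N f) simp
    finally show "(\<Sum>x\<in>torus N. (\<Sum>i<(8::nat) ^ Suc k. f (g' i x))\<^sup>2) \<le> (64 * (351/352)) ^ Suc k * (\<Sum>x\<in>torus N. (f x)\<^sup>2)"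
      by (simp add: mult_ac)
  qed
qed

text \<open>
  Taking powers of a fixed expander makes the relative norm on mean-zero functions as small as desired, with a degree \<open>e\<close>
  that is the same for all torus sizes.
\<close>
theorem torus_expander_family:
  fixes \<eta> :: real
  assumes "\<eta> > 0"
  shows "\<exists>e>0. \<forall>N>0. \<exists>g. (\<forall>i<e. bij_betw (g i) (torus N) (torus N)) \<and>
    (\<forall>f::int \<times> int \<Rightarrow> real. (\<Sum>x\<in>torus N. f x) = 0 \<longrightarrow>
      (\<Sum>x\<in>torus N. (\<Sum>i<e. f (g i x))\<^sup>2) \<le> (\<eta> * real e)\<^sup>2 * (\<Sum>x\<in>torus N. (f x)\<^sup>2))"
proof -
  have "\<exists>k. (351/352::real) ^ k < \<eta>\<^sup>2" using assms by (intro real_arch_pow_inv) auto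
  then obtain k where k: "(351/352::real) ^ k < \<eta>\<^sup>2" by blast
  have "(64 * (351/352::real)) ^ k = (real ((8::nat) ^ k))\<^sup>2 * (351/352) ^ k"
    by (simp add: power_mult_distrib power2_eq_square flip: power_mult_distrib)
  also have "\<dots> \<le> (real ((8::nat) ^ k))\<^sup>2 * \<eta>\<^sup>2" using k by (intro mult_left_mono) auto
  finally have le: "(64 * (351/352::real)) ^ k \<le> (\<eta> * real ((8::nat) ^ k))\<^sup>2" by (simp add: power_mult_distrib mult.commute)
  show ?thesis
  proof (intro exI[of _ "(8::nat) ^ k"] conjI allI impI)
    fix N :: int assume "N > 0"
    from torus_word_contracts[OF this, of k] obtain g where g: "\<forall>i<(8::nat) ^ k. bij_betw (g i) (torus N) (torus N)"
      and c: "\<forall>f::int \<times> int \<Rightarrow> real. (\<Sum>x\<in>torus N. f x) = 0 \<longrightarrow>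
      (\<Sum>x\<in>torus N. (\<Sum>i<(8::nat) ^ k. f (g i x))\<^sup>2) \<le> (64 * (351/352)) ^ k * (\<Sum>x\<in>torus N. (f x)\<^sup>2)" by blast
    have "(\<Sum>x\<in>torus N. (\<Sum>i<(8::nat) ^ k. f (g i x))\<^sup>2) \<le> (\<eta> * real ((8::nat) ^ k))\<^sup>2 * (\<Sum>x\<in>torus N. (f x)\<^sup>2)"
      if "(\<Sum>x\<in>torus N. f x) = 0" for f :: "int \<times> int \<Rightarrow> real"
      using c[rule_format, OF that] mult_right_mono[OF le, of "\<Sum>x\<in>torus N. (f x)\<^sup>2"] by (simp add: sum_nonneg)
    then show "\<exists>g. (\<forall>i<(8::nat) ^ k. bij_betw (g i) (torus N) (torus N)) \<and>
    (\<forall>f::int \<times> int \<Rightarrow> real. (\<Sum>x\<in>torus N. f x) = 0 \<longrightarrow>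
      (\<Sum>x\<in>torus N. (\<Sum>i<(8::nat) ^ k. f (g i x))\<^sup>2) \<le> (\<eta> * real ((8::nat) ^ k))\<^sup>2 * (\<Sum>x\<in>torus N. (f x)\<^sup>2))"
      using g by blast
  qed simp
qed

section \<open>Lamps switched by the digits of a position\<close>

definition sym_diff :: "'a set \<Rightarrow> 'a set \<Rightarrow> 'a set" where
  "sym_diff x y = (x - y) \<union> (y - x)"

lemma sym_diff_cancel [simp]: "sym_diff (sym_diff x y) y = x"
  by (auto simp: sym_diff_def)

lemma sym_diff_eq_empty_iff [simp]: "sym_diff x y = {} \<longleftrightarrow> x = y"
  by (auto simp: sym_diff_def)

definition cube :: "nat \<Rightarrow> nat set set" where
  "cube m = Pow {..<m}"

lemma finite_cube [simp]: "finite (cube m)"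
  by (simp add: cube_def)

lemma card_cube: "card (cube m) = 2 ^ m"
  by (simp add: cube_def card_Pow)

lemma sym_diff_in_cube: "x \<in> cube m \<Longrightarrow> y \<in> cube m \<Longrightarrow> sym_diff x y \<in> cube m"
  by (auto simp: cube_def sym_diff_def)

text \<open>
  The character of \<open>(Z/2)\<^sup>m\<close> indexed by \<open>S\<close>: the sign \<open>(-1)\<close> to the power \<open>card (S \<inter> x)\<close>, for subsets of \<open>{..<m}\<close>.
\<close>
definition walsh :: "nat \<Rightarrow> nat set \<Rightarrow> nat set \<Rightarrow> real" where
  "walsh m S x = (\<Prod>j<m. if j \<in> S \<and> j \<in> x then - 1 else 1)"

lemma walsh_commute: "walsh m S x = walsh m x S"
  unfolding walsh_def by (intro prod.cong) auto

lemma walsh_sym_diff: "walsh m S (sym_diff x y) = walsh m S x * walsh m S y"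
  unfolding walsh_def prod.distrib[symmetric] by (intro prod.cong) (auto simp: sym_diff_def)

lemma walsh_mult: "walsh m S x * walsh m T x = walsh m (sym_diff S T) x"
  using walsh_sym_diff[of m x S T] by (simp add: walsh_commute)

lemma walsh_empty [simp]: "walsh m {} x = 1"
  by (simp add: walsh_def)

lemma walsh_square [simp]: "walsh m S x * walsh m S x = 1"
  unfolding walsh_mult by (simp add: sym_diff_def)

lemma sum_walsh:
  assumes "S \<in> cube m"
  shows "(\<Sum>x\<in>cube m. walsh m S x) = (if S = {} then 2 ^ m else 0)"
proof -
  let ?f = "\<lambda>j. if j \<in> S then - 1 else (1::real)"
  have "(\<Sum>x\<in>cube m. walsh m S x) = (\<Sum>x\<in>Pow {..<m}. prod ?f x * prod (\<lambda>_. 1) ({..<m} - x))"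
    unfolding cube_def
  proof (intro sum.cong refl)
    fix x assume "x \<in> Pow {..<m}"
    then have "prod ?f x = (\<Prod>j<m. if j \<in> x then ?f j else 1)"
      by (subst prod.inter_restrict[symmetric]) (auto simp: Int_absorb1)
    also have "\<dots> = walsh m S x" unfolding walsh_def by (intro prod.cong) auto
    finally show "walsh m S x = prod ?f x * prod (\<lambda>_. 1) ({..<m} - x)" by simp
  qed
  also have "\<dots> = (\<Prod>j<m. ?f j + 1)" by (rule prod_add[symmetric]) simp
  also have "\<dots> = (if S = {} then 2 ^ m else 0)"
  proof (cases "S = {}")
    case False
    then obtain j where "j \<in> S" "j < m" using assms by (auto simp: cube_def)
    then show ?thesis using False by (auto intro!: bexI[of _ j])
  qed simp
  finally show ?thesis .
qed

lemma walsh_orthogonal: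
  assumes "S \<in> cube m" "T \<in> cube m"
  shows "(\<Sum>x\<in>cube m. walsh m S x * walsh m T x) = (if S = T then 2 ^ m else 0)"
  by (simp add: walsh_mult sum_walsh sym_diff_in_cube[OF assms])

lemma walsh_parseval:
  "(\<Sum>S\<in>cube m. (\<Sum>x\<in>cube m. f x * walsh m S x) * (\<Sum>y\<in>cube m. g y * walsh m S y))
    = 2 ^ m * (\<Sum>x\<in>cube m. f x * g x)"
proof -
  have "(\<Sum>S\<in>cube m. (\<Sum>x\<in>cube m. f x * walsh m S x) * (\<Sum>y\<in>cube m. g y * walsh m S y))
    = (\<Sum>S\<in>cube m. \<Sum>x\<in>cube m. \<Sum>y\<in>cube m. f x * g y * (walsh m x S * walsh m y S))"
    unfolding sum_product by (simp add: walsh_commute[of m x S for x S] mult_ac)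
  also have "\<dots> = (\<Sum>x\<in>cube m. \<Sum>y\<in>cube m. \<Sum>S\<in>cube m. f x * g y * (walsh m x S * walsh m y S))"
    by (rule sum_rotate)
  also have "\<dots> = (\<Sum>x\<in>cube m. \<Sum>y\<in>cube m. f x * g y * (if x = y then 2 ^ m else 0))"
    by (intro sum.cong refl) (simp add: sum_distrib_left[symmetric] walsh_orthogonal)
  also have "\<dots> = (\<Sum>x\<in>cube m. \<Sum>y\<in>cube m. if x = y then f x * g y * 2 ^ m else 0)"
    by (intro sum.cong refl) simp
  also have "\<dots> = 2 ^ m * (\<Sum>x\<in>cube m. f x * g x)"
    by (simp add: sum_distrib_left mult_ac)
  finally show ?thesis .
qed

lemma walsh_inversion:
  assumes "x \<in> cube m"
  shows "2 ^ m * g x = (\<Sum>S\<in>cube m. (\<Sum>y\<in>cube m. g y * walsh m S y) * walsh m S x)"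
proof -
  have "(\<Sum>S\<in>cube m. (\<Sum>y\<in>cube m. g y * walsh m S y) * (\<Sum>y\<in>cube m. (if y = x then 1 else 0) * walsh m S y))
    = 2 ^ m * (\<Sum>y\<in>cube m. g y * (if y = x then 1 else 0))" by (rule walsh_parseval)
  moreover have "(\<Sum>y\<in>cube m. (if y = x then 1 else 0) * walsh m S y) = walsh m S x" for S
  proof -
    have "(\<Sum>y\<in>cube m. (if y = x then 1 else 0) * walsh m S y) = (\<Sum>y\<in>cube m. if y = x then walsh m S y else 0)"
      by (intro sum.cong) auto
    then show ?thesis using assms by simp
  qed
  moreover have "(\<Sum>y\<in>cube m. g y * (if y = x then 1 else 0)) = g x"
  proof -
    have "(\<Sum>y\<in>cube m. g y * (if y = x then 1 else 0)) = (\<Sum>y\<in>cube m. if y = x then g y else 0)"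
      by (intro sum.cong) auto
    then show ?thesis using assms by simp
  qed
  ultimately show ?thesis by simp
qed

definition flips :: "nat \<Rightarrow> nat \<Rightarrow> nat \<Rightarrow> (nat \<Rightarrow> nat) \<Rightarrow> nat set" where
  "flips m k l d = {j. j < m \<and> (l + d j) mod 8 < k}"

lemma flips_in_cube: "flips m k l d \<in> cube m"
  by (auto simp: flips_def cube_def)

lemma walsh_flips:
  "walsh m S (flips m k l d) = (\<Prod>j<m. if j \<in> S then (if (l + d j) mod 8 < k then - 1 else 1) else 1)"
  unfolding walsh_def flips_def by (intro prod.cong) auto

text \<open>
  For a fixed digit the eight rotations run through all residues, so the sum does not depend on the digit. This is
  what makes single lamp signs exact eigenvectors.
\<close>
lemma rotated_sign_sum:
  assumes "k \<le> 8"
  shows "(\<Sum>l<8. if (l + d) mod 8 < k then - 1 else (1::real)) = 8 - 2 * real k"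
proof -
  have "(\<Sum>l<8. if (l + d) mod 8 < k then - 1 else (1::real)) = (\<Sum>l<8. if l < k then - 1 else 1)"
  proof (rule sum.reindex_bij_witness[of _ "\<lambda>l. (l + (8 - d mod 8)) mod 8" "\<lambda>l. (l + d) mod 8"])
    fix l :: nat assume l: "l \<in> {..<8}"
    define r where "r = 8 - d mod 8"
    have d: "d + r = 8 * (d div 8 + 1)" unfolding r_def by presburger
    have "((l + d) mod 8 + r) mod 8 = (l + (d + r)) mod 8"
      by (simp add: mod_add_left_eq add.assoc)
    then show "((l + d) mod 8 + (8 - d mod 8)) mod 8 = l" unfolding r_def[symmetric] d mod_mult_self2 using l by simp
    have "((l + r) mod 8 + d) mod 8 = (l + (d + r)) mod 8"
      by (simp add: mod_add_left_eq add.assoc add.commute[of d])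
    then show "((l + (8 - d mod 8)) mod 8 + d) mod 8 = l" unfolding r_def[symmetric] d mod_mult_self2 using l by simp
  qed auto
  also have "\<dots> = (\<Sum>l<(8::nat). 1) - (\<Sum>l<8. if l < k then 2 else 0)"
    unfolding sum_subtractf[symmetric] by (intro sum.cong) auto
  also have "(\<Sum>l<8. if l < k then 2 else (0::real)) = (\<Sum>l\<in>{..<8} \<inter> {..<k}. 2)"
    by (subst sum.inter_restrict) auto
  also have "{..<8} \<inter> {..<k} = {..<k}" using assms by auto
  finally show ?thesis by simp
qed

text \<open>
  \<open>Om\<close> is the set of positions, \<open>dig\<close> reads \<open>m\<close> octal digits off a position, and every digit string is read equally
  often, \<open>dens\<close> being the common number of positions. The maps \<open>g i\<close> form an expander on \<open>Om\<close>.
\<close>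
locale mixing_base =
  fixes Om :: "'a set" and m :: nat and dig :: "'a \<Rightarrow> nat \<Rightarrow> nat" and dens :: real
    and e :: nat and g :: "nat \<Rightarrow> 'a \<Rightarrow> 'a" and \<eta> :: real
  assumes fin [simp]: "finite Om" and nonempty: "Om \<noteq> {}"
    and uniform: "\<And>h :: (nat \<Rightarrow> nat) \<Rightarrow> real. (\<Sum>\<omega>\<in>Om. h (dig \<omega>)) = dens * (\<Sum>d\<in>{..<m} \<rightarrow>\<^sub>E {..<8}. h d)"
    and bij: "\<And>i. i < e \<Longrightarrow> bij_betw (g i) Om Om"
    and contracts: "\<And>f. (\<Sum>\<omega>\<in>Om. f \<omega>) = 0 \<Longrightarrow>
      (\<Sum>\<omega>\<in>Om. (\<Sum>i<e. f (g i \<omega>))\<^sup>2) \<le> (\<eta> * real e)\<^sup>2 * (\<Sum>\<omega>\<in>Om. (f \<omega>)\<^sup>2)"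
    and eta: "0 \<le> \<eta>"
begin

abbreviation states :: "('a \<times> nat set) set" where "states \<equiv> Om \<times> cube m"

lemma finite_states [simp]: "finite states" by simp

definition lamps :: "nat \<Rightarrow> nat \<Rightarrow> 'a \<times> nat set \<Rightarrow> 'a \<times> nat set" where
  "lamps k l v = (fst v, sym_diff (snd v) (flips m k l (dig (fst v))))"

lemma bij_lamps: "bij_betw (lamps k l) states states"
  by (rule bij_betw_byWitness[where f' = "lamps k l"])
    (auto simp: lamps_def sym_diff_in_cube flips_in_cube)

lemma lamps_involution [simp]: "lamps k l (lamps k l v) = v"
  by (simp add: lamps_def)

definition lamp_form :: "nat \<Rightarrow> ('a \<times> nat set \<Rightarrow> real) \<Rightarrow> ('a \<times> nat set \<Rightarrow> real) \<Rightarrow> real" where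
  "lamp_form k F G = (\<Sum>l<8. \<Sum>v\<in>states. F v * G (lamps k l v))"

text \<open>
  The expander operator, acting on positions and leaving the lamps alone.
\<close>
definition spread :: "('a \<times> nat set \<Rightarrow> real) \<Rightarrow> 'a \<times> nat set \<Rightarrow> real" where
  "spread F v = (\<Sum>i<e. F (g i (fst v), snd v))"

lemma lamp_form_commute: "lamp_form k F G = lamp_form k G F"
proof -
  have "(\<Sum>v\<in>states. F v * G (lamps k l v)) = (\<Sum>v\<in>states. F (lamps k l v) * G (lamps k l (lamps k l v)))" for l
    by (rule sum.reindex_bij_betw[OF bij_lamps, symmetric])
  then show ?thesis unfolding lamp_form_def by (simp add: mult.commute)
qed

lemma lamp_form_bound: "\<bar>lamp_form k F G\<bar> \<le> 8 * (L2_set F states * L2_set G states)"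
proof -
  have "\<bar>\<Sum>v\<in>states. F v * G (lamps k l v)\<bar> \<le> L2_set F states * L2_set G states" for l
  proof -
    have "\<bar>\<Sum>v\<in>states. F v * G (lamps k l v)\<bar> \<le> (\<Sum>v\<in>states. \<bar>F v\<bar> * \<bar>G (lamps k l v)\<bar>)"
      by (rule order_trans[OF sum_abs]) (simp add: abs_mult)
    also have "\<dots> \<le> L2_set F states * L2_set (\<lambda>v. G (lamps k l v)) states"
      by (rule L2_set_mult_ineq)
    also have "L2_set (\<lambda>v. G (lamps k l v)) states = L2_set G states"
      unfolding L2_set_def using sum.reindex_bij_betw[OF bij_lamps, of "\<lambda>v. (G v)\<^sup>2"] by simp
    finally show ?thesis .
  qed
  then have "(\<Sum>l<(8::nat). \<bar>\<Sum>v\<in>states. F v * G (lamps k l v)\<bar>) \<le> (\<Sum>l<(8::nat). L2_set F states * L2_set G states)"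
    by (intro sum_mono)
  then show ?thesis unfolding lamp_form_def by (intro order_trans[OF sum_abs]) simp
qed

lemma lamp_form_add_right: "lamp_form k F (\<lambda>v. a * G v + H v) = a * lamp_form k F G + lamp_form k F H"
  unfolding lamp_form_def by (simp add: algebra_simps sum.distrib sum_distrib_left)

lemma lamp_form_add_left: "lamp_form k (\<lambda>v. a * G v + H v) F = a * lamp_form k G F + lamp_form k H F"
  unfolding lamp_form_commute[of k _ F] by (rule lamp_form_add_right)

lemma lamp_form_walsh:
  assumes "\<And>\<omega>. \<omega> \<in> Om \<Longrightarrow> (\<Sum>l<8. walsh m S (flips m k l (dig \<omega>))) = a"
  shows "lamp_form k H (\<lambda>v. walsh m S (snd v)) = a * (\<Sum>v\<in>states. H v * walsh m S (snd v))"
proof -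
  have "lamp_form k H (\<lambda>v. walsh m S (snd v))
     = (\<Sum>v\<in>states. H v * walsh m S (snd v) * (\<Sum>l<8. walsh m S (flips m k l (dig (fst v)))))"
    unfolding lamp_form_def sum_distrib_left
    by (subst sum.swap) (simp add: lamps_def walsh_sym_diff mult.assoc)
  also have "\<dots> = (\<Sum>v\<in>states. H v * walsh m S (snd v) * a)"
    by (intro sum.cong refl) (use assms in auto)
  finally show ?thesis by (simp add: sum_distrib_left mult_ac)
qed

lemma singleton_flip_sum:
  assumes "j < m" "k \<le> 8"
  shows "(\<Sum>l<8. walsh m {j} (flips m k l d)) = 8 - 2 * real k"
proof -
  have "walsh m {j} (flips m k l d) = (if (l + d j) mod 8 < k then - 1 else 1)" for l
    unfolding walsh_flips using assms(1) by simp
  then show ?thesis using rotated_sign_sum[OF assms(2), of "d j"] by simp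
qed

lemma card_Om: "real (card Om) = dens * 8 ^ m"
  using uniform[of "\<lambda>_. 1"] by (simp add: card_PiE)

text \<open>
  Uniformly distributed digits are independent, so the average factorises over the lamps in \<open>S\<close>.
\<close>
lemma mean_walsh_flips:
  assumes "k \<le> 8" "S \<in> cube m"
  shows "(\<Sum>\<omega>\<in>Om. walsh m S (flips m k l (dig \<omega>))) = real (card Om) * (1 - real k / 4) ^ card S"
proof -
  have "(\<Sum>\<omega>\<in>Om. walsh m S (flips m k l (dig \<omega>)))
    = dens * (\<Sum>d\<in>{..<m} \<rightarrow>\<^sub>E {..<8}. \<Prod>j<m. if j \<in> S then (if (l + d j) mod 8 < k then - 1 else 1) else 1)"
    unfolding walsh_flips by (rule uniform)
  also have "\<dots> = dens * (\<Prod>j<m. \<Sum>a<8. if j \<in> S then (if (l + a) mod 8 < k then - 1 else 1) else 1)"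
    by (subst prod_sum_PiE) auto
  also have "(\<Prod>j<m. \<Sum>a<8. if j \<in> S then (if (l + a) mod 8 < k then - 1 else 1) else (1::real))
     = (\<Prod>j<m. 8 * (if j \<in> S then 1 - real k / 4 else 1))"
  proof (intro prod.cong refl)
    fix j
    show "(\<Sum>a<8. if j \<in> S then (if (l + a) mod 8 < k then - 1 else 1) else (1::real)) = 8 * (if j \<in> S then 1 - real k / 4 else 1)"
      using rotated_sign_sum[OF assms(1), of l] by (simp add: add.commute[of _ l])
  qed
  also have "\<dots> = 8 ^ m * (\<Prod>j<m. if j \<in> S then 1 - real k / 4 else 1)"
    by (simp add: prod.distrib)
  also have "(\<Prod>j<m. if j \<in> S then 1 - real k / 4 else 1) = (\<Prod>j\<in>{..<m} \<inter> S. 1 - real k / 4)"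
    by (subst prod.inter_restrict) auto
  also have "{..<m} \<inter> S = S" using assms(2) by (auto simp: cube_def)
  finally show ?thesis using card_Om by simp
qed

text \<open>
  For functions of the lamps only, the lamp move averages over positions to a convolution on the cube, diagonal in
  the Walsh basis with eigenvalues \<open>8 * (1 - k/4) ^ card S\<close>. The hypotheses on \<open>p\<close> remove \<open>card S \<le> 1\<close>, which leaves at most
  \<open>8/16\<close>.
\<close>
lemma lamp_form_on_cube:
  fixes p q :: "nat set \<Rightarrow> real"
  assumes k: "k \<le> 8" and rho: "\<bar>1 - real k / 4\<bar> \<le> 1/4"
    and p0: "(\<Sum>x\<in>cube m. p x) = 0" and p1: "\<And>j. j < m \<Longrightarrow> (\<Sum>x\<in>cube m. p x * walsh m {j} x) = 0"
  shows "\<bar>lamp_form k (\<lambda>v. p (snd v)) (\<lambda>v. q (snd v))\<bar> \<le> 1/2 * (real (card Om) * (L2_set p (cube m) * L2_set q (cube m)))"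
proof -
  let ?r = "1 - real k / 4"
  define P where "P S = (\<Sum>x\<in>cube m. p x * walsh m S x)" for S
  define Q where "Q S = (\<Sum>x\<in>cube m. q x * walsh m S x)" for S
  have shift: "2 ^ m * q (sym_diff x y) = (\<Sum>S\<in>cube m. Q S * walsh m S x * walsh m S y)"
    if "x \<in> cube m" "y \<in> cube m" for x y
    unfolding walsh_inversion[OF sym_diff_in_cube[OF that], of q] Q_def[symmetric] by (simp add: walsh_sym_diff mult.assoc)
  have key: "2 ^ m * (\<Sum>v\<in>states. p (snd v) * q (snd (lamps k l v))) = real (card Om) * (\<Sum>S\<in>cube m. P S * Q S * ?r ^ card S)" for l
  proof -
    have "2 ^ m * (\<Sum>v\<in>states. p (snd v) * q (snd (lamps k l v)))
      = (\<Sum>\<omega>\<in>Om. \<Sum>x\<in>cube m. p x * (2 ^ m * q (sym_diff x (flips m k l (dig \<omega>)))))"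
      unfolding sum.cartesian_product by (simp add: lamps_def case_prod_beta sum_distrib_left mult_ac)
    also have "\<dots> = (\<Sum>\<omega>\<in>Om. \<Sum>x\<in>cube m. \<Sum>S\<in>cube m. p x * walsh m S x * Q S * walsh m S (flips m k l (dig \<omega>)))"
      by (intro sum.cong refl) (simp add: shift flips_in_cube sum_distrib_left mult_ac)
    also have "\<dots> = (\<Sum>\<omega>\<in>Om. \<Sum>S\<in>cube m. P S * Q S * walsh m S (flips m k l (dig \<omega>)))"
      unfolding P_def sum_distrib_right by (intro sum.cong refl sum.swap)
    also have "\<dots> = (\<Sum>S\<in>cube m. P S * Q S * (\<Sum>\<omega>\<in>Om. walsh m S (flips m k l (dig \<omega>))))"
      by (subst sum.swap) (simp add: sum_distrib_left)
    also have "\<dots> = (\<Sum>S\<in>cube m. P S * Q S * (real (card Om) * ?r ^ card S))"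
      by (intro sum.cong refl) (simp add: mean_walsh_flips[OF k])
    finally show ?thesis by (simp add: sum_distrib_left mult_ac)
  qed
  have "2 ^ m * lamp_form k (\<lambda>v. p (snd v)) (\<lambda>v. q (snd v))
     = (\<Sum>l<(8::nat). 2 ^ m * (\<Sum>v\<in>states. p (snd v) * q (snd (lamps k l v))))"
    unfolding lamp_form_def by (rule sum_distrib_left)
  also have "\<dots> = (\<Sum>l<(8::nat). real (card Om) * (\<Sum>S\<in>cube m. P S * Q S * ?r ^ card S))"
    by (intro sum.cong refl key)
  finally have eq: "2 ^ m * lamp_form k (\<lambda>v. p (snd v)) (\<lambda>v. q (snd v)) = 8 * (real (card Om) * (\<Sum>S\<in>cube m. P S * Q S * ?r ^ card S))"
    by simp
  \<comment> \<open>Sets with at most one element do not contribute; all others are damped by \<open>(1/4)\<^sup>2\<close>.\<close>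
  have small: "\<bar>P S * Q S * ?r ^ card S\<bar> \<le> 1/16 * (\<bar>P S\<bar> * \<bar>Q S\<bar>)" if "S \<in> cube m" for S
  proof (cases "card S \<le> 1")
    case True
    have "finite S" using that by (auto simp: cube_def intro: finite_subset)
    then consider "S = {}" | j where "S = {j}" using True
      by (metis One_nat_def card_0_eq card_1_singletonE le_Suc_eq le_zero_eq)
    then have "P S = 0"
    proof cases
      case 1
      then show ?thesis using p0 by (simp add: P_def)
    next
      case (2 j)
      then show ?thesis using p1[of j] that by (simp add: P_def cube_def)
    qed
    then show ?thesis by simp
  next
    case False
    have "\<bar>?r\<bar> ^ card S \<le> (1/4) ^ card S" by (rule power_mono[OF rho]) simp
    also have "\<dots> \<le> (1/4) ^ 2" by (rule power_decreasing) (use False in auto)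
    finally have "\<bar>?r ^ card S\<bar> \<le> 1/16" by (simp add: power_abs power2_eq_square)
    then have "\<bar>P S * Q S\<bar> * \<bar>?r ^ card S\<bar> \<le> \<bar>P S * Q S\<bar> * (1/16)" by (intro mult_left_mono) auto
    then show ?thesis by (simp add: abs_mult mult_ac)
  qed
  have par: "L2_set P (cube m) = sqrt (2 ^ m) * L2_set p (cube m)" "L2_set Q (cube m) = sqrt (2 ^ m) * L2_set q (cube m)"
    unfolding L2_set_def real_sqrt_mult[symmetric] P_def Q_def
    using walsh_parseval[of p m p] walsh_parseval[of q m q] by (simp_all add: power2_eq_square)
  have "\<bar>\<Sum>S\<in>cube m. P S * Q S * ?r ^ card S\<bar> \<le> (\<Sum>S\<in>cube m. 1/16 * (\<bar>P S\<bar> * \<bar>Q S\<bar>))"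
    by (rule order_trans[OF sum_abs sum_mono]) (rule small)
  also have "\<dots> \<le> 1/16 * (L2_set P (cube m) * L2_set Q (cube m))"
    unfolding sum_distrib_left[symmetric] by (intro mult_left_mono L2_set_mult_ineq) simp
  also have "\<dots> = 1/16 * (2 ^ m * (L2_set p (cube m) * L2_set q (cube m)))"
    unfolding par by (simp add: mult_ac)
  finally have b: "\<bar>\<Sum>S\<in>cube m. P S * Q S * ?r ^ card S\<bar> \<le> 1/16 * (2 ^ m * (L2_set p (cube m) * L2_set q (cube m)))" .
  have "2 ^ m * \<bar>lamp_form k (\<lambda>v. p (snd v)) (\<lambda>v. q (snd v))\<bar>
     = 8 * (real (card Om) * \<bar>\<Sum>S\<in>cube m. P S * Q S * ?r ^ card S\<bar>)"
    using arg_cong[OF eq, of abs] by (simp add: abs_mult)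
  also have "\<dots> \<le> 8 * (real (card Om) * (1/16 * (2 ^ m * (L2_set p (cube m) * L2_set q (cube m)))))"
    by (intro mult_left_mono b) auto
  also have "\<dots> = 2 ^ m * (1/2 * (real (card Om) * (L2_set p (cube m) * L2_set q (cube m))))" by simp
  finally show ?thesis by (rule mult_left_le_imp_le) simp
qed


text \<open>
  A function of states is split into its mean over the position, a function of the lamps, and the rest, which has mean zero
  on every fibre and on which the expander contracts.
\<close>
definition fibre_mean :: "('a \<times> nat set \<Rightarrow> real) \<Rightarrow> nat set \<Rightarrow> real" where
  "fibre_mean F x = (\<Sum>\<omega>\<in>Om. F (\<omega>, x)) / real (card Om)"

definition fibre_part :: "('a \<times> nat set \<Rightarrow> real) \<Rightarrow> 'a \<times> nat set \<Rightarrow> real" where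
  "fibre_part F v = F v - fibre_mean F (snd v)"

lemma card_Om_pos: "real (card Om) > 0"
  using nonempty by (simp add: card_gt_0_iff)

lemma sum_states: "(\<Sum>v\<in>states. h v) = (\<Sum>x\<in>cube m. \<Sum>\<omega>\<in>Om. h (\<omega>, x))"
  by (subst sum.swap) (simp add: sum.cartesian_product)

lemma sum_fibre_part: "(\<Sum>\<omega>\<in>Om. fibre_part F (\<omega>, x)) = 0"
  using card_Om_pos by (simp add: fibre_part_def fibre_mean_def sum_subtractf)

lemma fibre_pythagoras:
  "(\<Sum>v\<in>states. (F v)\<^sup>2) = (\<Sum>v\<in>states. (fibre_mean F (snd v))\<^sup>2) + (\<Sum>v\<in>states. (fibre_part F v)\<^sup>2)"
proof -
  have "(\<Sum>v\<in>states. fibre_mean F (snd v) * fibre_part F v) = 0"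
    unfolding sum_states by (simp add: sum_distrib_left[symmetric] sum_fibre_part)
  moreover have "(\<Sum>v\<in>states. (F v)\<^sup>2) = (\<Sum>v\<in>states. (fibre_mean F (snd v))\<^sup>2 + (fibre_part F v)\<^sup>2
      + 2 * (fibre_mean F (snd v) * fibre_part F v))"
    by (intro sum.cong refl) (simp add: fibre_part_def power2_eq_square algebra_simps)
  ultimately show ?thesis by (simp add: sum.distrib sum_distrib_left[symmetric])
qed

lemma fibre_mean_L2: "L2_set (\<lambda>v. fibre_mean F (snd v)) states \<le> L2_set F states"
  unfolding L2_set_def
  by (rule real_sqrt_le_mono) (subst fibre_pythagoras[of F], simp add: sum_nonneg)

lemma fibre_part_L2: "L2_set (fibre_part F) states \<le> L2_set F states"
  unfolding L2_set_def
  by (rule real_sqrt_le_mono) (subst fibre_pythagoras[of F], simp add: sum_nonneg)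

lemma L2_cube_lift: "L2_set (\<lambda>v. p (snd v)) states = sqrt (real (card Om)) * L2_set p (cube m)"
  unfolding L2_set_def sum_states real_sqrt_mult[symmetric] by (simp add: sum_distrib_left)

lemma spread_decompose: "spread F v = real e * fibre_mean F (snd v) + spread (fibre_part F) v"
  by (simp add: spread_def fibre_part_def sum_subtractf)

lemma spread_L2:
  assumes "\<And>x. (\<Sum>\<omega>\<in>Om. F (\<omega>, x)) = 0"
  shows "L2_set (spread F) states \<le> \<eta> * real e * L2_set F states"
proof -
  have "(\<Sum>v\<in>states. (spread F v)\<^sup>2) = (\<Sum>x\<in>cube m. \<Sum>\<omega>\<in>Om. (\<Sum>i<e. F (g i \<omega>, x))\<^sup>2)"
    unfolding sum_states by (simp add: spread_def)
  also have "\<dots> \<le> (\<Sum>x\<in>cube m. (\<eta> * real e)\<^sup>2 * (\<Sum>\<omega>\<in>Om. (F (\<omega>, x))\<^sup>2))"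
    by (intro sum_mono contracts assms)
  also have "\<dots> = (\<eta> * real e)\<^sup>2 * (\<Sum>v\<in>states. (F v)\<^sup>2)"
    unfolding sum_states by (simp add: sum_distrib_left)
  finally have "L2_set (spread F) states \<le> sqrt ((\<eta> * real e)\<^sup>2 * (\<Sum>v\<in>states. (F v)\<^sup>2))"
    unfolding L2_set_def by (rule real_sqrt_le_mono)
  also have "\<dots> = \<eta> * real e * L2_set F states"
    using eta by (simp add: L2_set_def real_sqrt_mult)
  finally show ?thesis .
qed

text \<open>
  The part depending on lamps only contributes the convolution bound \<open>1/2\<close>; each remaining term contains a function contracted by
  the expander and hence a factor \<open>\<eta>\<close>. The trivial bound \<open>8\<close> of the lamp form occurs once with a factor 1 and once with a
  factor 2, whence \<open>24\<close>.
\<close>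
lemma lamp_mixing:
  assumes k: "k \<le> 8" and rho: "\<bar>1 - real k / 4\<bar> \<le> 1/4" and eta1: "\<eta> \<le> 1"
    and F0: "(\<Sum>v\<in>states. F v) = 0" and F1: "\<And>j. j < m \<Longrightarrow> (\<Sum>v\<in>states. F v * walsh m {j} (snd v)) = 0"
  shows "\<bar>lamp_form k (spread F) (spread G)\<bar> \<le> (real e)\<^sup>2 * (1/2 + 24 * \<eta>) * (L2_set F states * L2_set G states)"
proof -
  let ?p = "\<lambda>v::'a \<times> nat set. fibre_mean F (snd v)" and ?q = "\<lambda>v::'a \<times> nat set. fibre_mean G (snd v)"
  let ?F = "spread (fibre_part F)" and ?G = "spread (fibre_part G)"
  let ?n = "\<lambda>H. L2_set H states"
  let ?e = "real e" and ?nF = "?n F" and ?nG = "?n G"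
  have nn: "0 \<le> ?nF" "0 \<le> ?nG" "0 \<le> ?e" by auto
  have nF: "?n ?F \<le> \<eta> * ?e * ?nF"
  proof -
    have "?n ?F \<le> \<eta> * ?e * ?n (fibre_part F)" by (rule spread_L2) (rule sum_fibre_part)
    also have "\<dots> \<le> \<eta> * ?e * ?nF" by (intro mult_left_mono fibre_part_L2) (use eta in auto)
    finally show ?thesis .
  qed
  have nG: "?n ?G \<le> \<eta> * ?e * ?nG"
  proof -
    have "?n ?G \<le> \<eta> * ?e * ?n (fibre_part G)" by (rule spread_L2) (rule sum_fibre_part)
    also have "\<dots> \<le> \<eta> * ?e * ?nG" by (intro mult_left_mono fibre_part_L2) (use eta in auto)
    finally show ?thesis .
  qed
  have nsG: "?n (spread G) \<le> 2 * ?e * ?nG"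
  proof -
    have "?n (spread G) = ?n (\<lambda>v. ?e * ?q v + ?G v)" by (simp add: spread_decompose[symmetric])
    also have "\<dots> \<le> ?n (\<lambda>v. ?e * ?q v) + ?n ?G" by (rule L2_set_triangle_ineq)
    also have "?n (\<lambda>v. ?e * ?q v) = ?e * ?n ?q" by (simp add: L2_set_right_distrib)
    also have "?e * ?n ?q + ?n ?G \<le> ?e * ?nG + \<eta> * ?e * ?nG"
      by (intro add_mono nG mult_left_mono fibre_mean_L2) auto
    also have "\<eta> * ?e * ?nG \<le> 1 * ?e * ?nG" by (intro mult_right_mono eta1) auto
    finally show ?thesis by simp
  qed
  have split: "lamp_form k (spread F) (spread G)
     = ?e * (?e * lamp_form k ?p ?q + lamp_form k ?p ?G) + lamp_form k ?F (spread G)"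
  proof -
    have "lamp_form k (spread F) (spread G) = lamp_form k (\<lambda>v. ?e * ?p v + ?F v) (spread G)"
      by (simp add: spread_decompose[symmetric])
    also have "\<dots> = ?e * lamp_form k ?p (spread G) + lamp_form k ?F (spread G)" by (rule lamp_form_add_left)
    also have "lamp_form k ?p (spread G) = lamp_form k ?p (\<lambda>v. ?e * ?q v + ?G v)"
      by (simp add: spread_decompose[symmetric])
    also have "\<dots> = ?e * lamp_form k ?p ?q + lamp_form k ?p ?G" by (rule lamp_form_add_right)
    finally show ?thesis .
  qed
  have m0: "(\<Sum>x\<in>cube m. fibre_mean F x) = 0"
    using F0 unfolding sum_states by (simp add: fibre_mean_def sum_divide_distrib[symmetric])
  have m1: "(\<Sum>x\<in>cube m. fibre_mean F x * walsh m {j} x) = 0" if "j < m" for j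
    using F1[OF that] card_Om_pos unfolding sum_states
    by (simp add: fibre_mean_def sum_divide_distrib[symmetric] sum_distrib_right[symmetric])
  have a1: "\<bar>lamp_form k ?p ?q\<bar> \<le> 1/2 * (?nF * ?nG)"
  proof -
    have "\<bar>lamp_form k ?p ?q\<bar> \<le> 1/2 * (real (card Om) * (L2_set (fibre_mean F) (cube m) * L2_set (fibre_mean G) (cube m)))"
      by (rule lamp_form_on_cube[OF k rho m0 m1])
    also have "real (card Om) * (L2_set (fibre_mean F) (cube m) * L2_set (fibre_mean G) (cube m)) = ?n ?p * ?n ?q"
      unfolding L2_cube_lift by simp
    also have "1/2 * (?n ?p * ?n ?q) \<le> 1/2 * (?nF * ?nG)"
      by (intro mult_left_mono mult_mono fibre_mean_L2) auto
    finally show ?thesis .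
  qed
  have a2: "\<bar>lamp_form k ?p ?G\<bar> \<le> 8 * (?nF * (\<eta> * ?e * ?nG))"
    by (rule order_trans[OF lamp_form_bound]) (intro mult_left_mono mult_mono fibre_mean_L2 nG, auto)
  have a3: "\<bar>lamp_form k ?F (spread G)\<bar> \<le> 8 * ((\<eta> * ?e * ?nF) * (2 * ?e * ?nG))"
    by (rule order_trans[OF lamp_form_bound]) (intro mult_left_mono mult_mono nF nsG, use eta in auto)
  have "\<bar>lamp_form k (spread F) (spread G)\<bar>
     \<le> ?e * (?e * \<bar>lamp_form k ?p ?q\<bar> + \<bar>lamp_form k ?p ?G\<bar>) + \<bar>lamp_form k ?F (spread G)\<bar>"
  proof -
    have "\<bar>?e * lamp_form k ?p ?q + lamp_form k ?p ?G\<bar> \<le> ?e * \<bar>lamp_form k ?p ?q\<bar> + \<bar>lamp_form k ?p ?G\<bar>"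
      by (rule order_trans[OF abs_triangle_ineq]) (simp add: abs_mult)
    then have h: "?e * \<bar>?e * lamp_form k ?p ?q + lamp_form k ?p ?G\<bar> \<le> ?e * (?e * \<bar>lamp_form k ?p ?q\<bar> + \<bar>lamp_form k ?p ?G\<bar>)"
      by (intro mult_left_mono) auto
    show ?thesis unfolding split
      by (rule order_trans[OF abs_triangle_ineq]) (use h in \<open>simp add: abs_mult\<close>)
  qed
  also have "\<dots> \<le> ?e * (?e * (1/2 * (?nF * ?nG)) + 8 * (?nF * (\<eta> * ?e * ?nG))) + 8 * ((\<eta> * ?e * ?nF) * (2 * ?e * ?nG))"
    by (intro add_mono mult_left_mono a1 a2 a3) auto
  also have "\<dots> = ?e\<^sup>2 * (1/2 + 24 * \<eta>) * (?nF * ?nG)"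
    by (simp add: power2_eq_square algebra_simps)
  finally show ?thesis .
qed

lemma lamp_form_spread_walsh:
  assumes "\<And>\<omega>. \<omega> \<in> Om \<Longrightarrow> (\<Sum>l<8. walsh m S (flips m k l (dig \<omega>))) = a"
  shows "lamp_form k (spread H) (spread (\<lambda>v. walsh m S (snd v))) = (real e)\<^sup>2 * a * (\<Sum>v\<in>states. H v * walsh m S (snd v))"
proof -
  have "spread (\<lambda>v. walsh m S (snd v)) = (\<lambda>v. real e * walsh m S (snd v) + 0)"
    by (rule ext) (simp add: spread_def)
  then have "lamp_form k (spread H) (spread (\<lambda>v. walsh m S (snd v)))
      = lamp_form k (spread H) (\<lambda>v. real e * walsh m S (snd v) + 0)"
    by (simp only:)
  also have "\<dots> = real e * (a * (\<Sum>v\<in>states. spread H v * walsh m S (snd v)))"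
    unfolding lamp_form_add_right by (simp add: lamp_form_walsh[OF assms]) (simp add: lamp_form_def)
  also have "(\<Sum>v\<in>states. spread H v * walsh m S (snd v)) = (\<Sum>i<e. \<Sum>v\<in>states. H (g i (fst v), snd v) * walsh m S (snd v))"
    unfolding spread_def sum_distrib_right by (rule sum.swap)
  also have "\<dots> = (\<Sum>i<e. \<Sum>v\<in>states. H v * walsh m S (snd v))"
  proof (rule sum.cong[OF refl])
    fix i assume "i \<in> {..<e}"
    then have "bij_betw (g i) Om Om" by (simp add: bij)
    then have "(\<Sum>\<omega>\<in>Om. H (g i \<omega>, x)) = (\<Sum>\<omega>\<in>Om. H (\<omega>, x))" for x
      by (rule sum.reindex_bij_betw[where g = "\<lambda>\<omega>. H (\<omega>, x)"])
    then show "(\<Sum>v\<in>states. H (g i (fst v), snd v) * walsh m S (snd v)) = (\<Sum>v\<in>states. H v * walsh m S (snd v))"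
      unfolding sum_states by (simp add: sum_distrib_right[symmetric])
  qed
  finally show ?thesis by (simp add: power2_eq_square)
qed

end

section \<open>Making a multigraph simple with Heisenberg clones\<close>

text \<open>
  The clones of a state are the elements of the Heisenberg group over \<open>Z_q\<close>, as triples. Two clones are incident with
  label \<open>c\<close> if \<open>b\<^sub>3 - a\<^sub>3 = a\<^sub>1 b\<^sub>2 - a\<^sub>2 b\<^sub>1 + c\<close> modulo \<open>q\<close>; the alternating form \<open>wedge\<close> makes
  reversal of the pair the same as negation of the label.
\<close>
definition wedge :: "int \<times> int \<times> int \<Rightarrow> int \<times> int \<times> int \<Rightarrow> int" where
  "wedge a b = fst a * fst (snd b) - fst (snd a) * fst b"

definition clones :: "int \<Rightarrow> (int \<times> int \<times> int) set" where
  "clones q = {0..<q} \<times> {0..<q} \<times> {0..<q}"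

definition incident :: "int \<Rightarrow> int \<Rightarrow> int \<times> int \<times> int \<Rightarrow> int \<times> int \<times> int \<Rightarrow> bool" where
  "incident q c a b \<longleftrightarrow> snd (snd a) = (snd (snd b) - wedge a b - c) mod q"

lemma finite_clones [simp]: "finite (clones q)"
  by (simp add: clones_def)

lemma card_clones: "q \<ge> 0 \<Longrightarrow> real (card (clones q)) = (of_int q) ^ 3"
  by (simp add: clones_def power3_eq_cube)

lemma sum_clones: "(\<Sum>a\<in>clones q. h a) = (\<Sum>x\<in>{0..<q}. \<Sum>y\<in>{0..<q}. \<Sum>z\<in>{0..<q}. h (x, y, z))"
proof -
  let ?Z = "{0..<q}"
  have "(\<Sum>a\<in>clones q. h a) = (\<Sum>x\<in>?Z. \<Sum>p\<in>?Z \<times> ?Z. h (x, p))"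
    unfolding clones_def sum.cartesian_product by (simp add: case_prod_beta)
  moreover have "(\<Sum>p\<in>?Z \<times> ?Z. h (x, p)) = (\<Sum>y\<in>?Z. \<Sum>z\<in>?Z. h (x, y, z))" for x
    unfolding sum.cartesian_product by (simp add: case_prod_beta)
  ultimately show ?thesis by (simp only:)
qed

lemma wedge_swap: "wedge b a = - wedge a b"
  by (simp add: wedge_def)

lemma incident_flip:
  assumes "a \<in> clones q" "b \<in> clones q"
  shows "incident q c a b \<longleftrightarrow> incident q (- c) b a"
proof -
  have a: "snd (snd a) mod q = snd (snd a)" and b: "snd (snd b) mod q = snd (snd b)"
    using assms unfolding clones_def by auto
  have "incident q c a b \<longleftrightarrow> snd (snd a) mod q = (snd (snd b) - wedge a b - c) mod q"
    unfolding incident_def a ..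
  also have "\<dots> \<longleftrightarrow> q dvd snd (snd a) - (snd (snd b) - wedge a b - c)" by (rule mod_eq_dvd_iff)
  also have "snd (snd a) - (snd (snd b) - wedge a b - c) = - (snd (snd b) - (snd (snd a) - wedge b a - - c))"
    by (simp add: wedge_swap[of b a])
  also have "q dvd \<dots> \<longleftrightarrow> snd (snd b) mod q = (snd (snd a) - wedge b a - - c) mod q"
    unfolding mod_eq_dvd_iff by (rule dvd_minus_iff)
  finally show ?thesis unfolding incident_def b .
qed

lemma incident_label_unique:
  assumes "incident q c a b" "incident q c' a b"
  shows "q dvd c - c'"
proof -
  have "(snd (snd b) - wedge a b - c') mod q = (snd (snd b) - wedge a b - c) mod q"
    using assms unfolding incident_def by simp
  then have "q dvd (snd (snd b) - wedge a b - c') - (snd (snd b) - wedge a b - c)" by (simp only: mod_eq_dvd_iff)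
  then show ?thesis by simp
qed

lemma incident_refl_label:
  assumes "a \<in> clones q" "incident q c a a"
  shows "q dvd c"
proof -
  have "snd (snd a) mod q = (snd (snd a) - c) mod q"
    using assms unfolding incident_def clones_def by (auto simp: wedge_def)
  then have "q dvd snd (snd a) - (snd (snd a) - c)" by (simp only: mod_eq_dvd_iff)
  then show ?thesis by simp
qed

lemma incident_sum_left:
  assumes "q > 0"
  shows "(\<Sum>a\<in>clones q. of_bool (incident q c a b) :: real) = (of_int q)\<^sup>2"
proof -
  have "(\<Sum>z\<in>{0..<q}. of_bool (incident q c (x, y, z) b) :: real) = 1" for x y
  proof -
    define u where "u = (snd (snd b) - (x * fst (snd b) - y * fst b) - c) mod q"
    have "u \<in> {0..<q}" using assms unfolding u_def by simp
    moreover have "incident q c (x, y, z) b \<longleftrightarrow> z = u" for z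
      unfolding incident_def wedge_def u_def by simp
    ultimately show ?thesis by simp
  qed
  then show ?thesis using assms by (simp add: sum_clones power2_eq_square)
qed

lemma incident_sum_right:
  assumes "q > 0" "a \<in> clones q"
  shows "(\<Sum>b\<in>clones q. of_bool (incident q c a b) :: real) = (of_int q)\<^sup>2"
proof -
  have "(\<Sum>b\<in>clones q. of_bool (incident q c a b) :: real) = (\<Sum>b\<in>clones q. of_bool (incident q (- c) b a))"
    by (intro sum.cong refl) (simp add: incident_flip[OF assms(2)])
  then show ?thesis using incident_sum_left[OF assms(1)] by simp
qed

lemma linear_congruence_count:
  fixes q d r :: int
  assumes q: "prime q" and d: "\<not> q dvd d"
  shows "(\<Sum>x\<in>{0..<q}. of_bool (q dvd x * d - r) :: real) = 1"
proof -
  have q0: "q > 0" using q by (simp add: prime_gt_0_int)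
  have inj: "inj_on (\<lambda>x. (x * d) mod q) {0..<q}"
  proof (rule inj_onI)
    fix x y assume xy: "x \<in> {0..<q}" "y \<in> {0..<q}" "(x * d) mod q = (y * d) mod q"
    then have "q dvd (x - y) * d" by (simp add: mod_eq_dvd_iff left_diff_distrib)
    then have "q dvd x - y" using q d by (simp add: prime_dvd_mult_iff)
    then have "x mod q = y mod q" by (simp add: mod_eq_dvd_iff)
    then show "x = y" using xy by simp
  qed
  moreover have "(\<lambda>x. (x * d) mod q) ` {0..<q} \<subseteq> {0..<q}" using q0 by auto
  ultimately have bij: "bij_betw (\<lambda>x. (x * d) mod q) {0..<q} {0..<q}"
    unfolding bij_betw_def by (meson endo_inj_surj finite_atLeastLessThan_int)
  have "(\<Sum>x\<in>{0..<q}. of_bool (q dvd x * d - r) :: real) = (\<Sum>x\<in>{0..<q}. of_bool ((x * d) mod q = r mod q))"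
    by (simp add: mod_eq_dvd_iff)
  also have "\<dots> = (\<Sum>x\<in>{0..<q}. of_bool (x = r mod q))"
    by (rule sum.reindex_bij_betw[OF bij, of "\<lambda>x. of_bool (x = r mod q)"])
  also have "\<dots> = 1" using q0 by simp
  finally show ?thesis .
qed

text \<open>
  Subtracting the two incidence equations leaves one linear equation in the first two coordinates of \<open>a\<close>. It has \<open>q\<close> solutions
  unless its coefficients vanish; then it has \<open>q\<^sup>2\<close> or none, according to whether \<open>b = b'\<close>.
\<close>
lemma incident_common_count:
  assumes q: "prime q" and b: "b \<in> clones q" "b' \<in> clones q"
  shows "(\<Sum>a\<in>clones q. of_bool (incident q c a b) * of_bool (incident q c a b') :: real)
    = (of_int q)\<^sup>2 * of_bool (b = b') + of_int q
      - of_int q * of_bool (fst b = fst b' \<and> fst (snd b) = fst (snd b'))"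
proof -
  obtain b1 b2 b3 where bb: "b = (b1, b2, b3)" by (cases b)
  obtain c1 c2 c3 where cc: "b' = (c1, c2, c3)" by (cases b')
  have q0: "q > 0" using q by (simp add: prime_gt_0_int)
  have small: "q dvd s - t \<longleftrightarrow> s = t" if "s \<in> {0..<q}" "t \<in> {0..<q}" for s t
    using that by (auto simp: mod_eq_dvd_iff[symmetric])
  have inner: "(\<Sum>z\<in>{0..<q}. of_bool (incident q c (x, y, z) b) * of_bool (incident q c (x, y, z) b') :: real)
    = of_bool (q dvd (b3 - c3) - (x * (b2 - c2) - y * (b1 - c1)))" for x y
  proof -
    define u where "u = (b3 - (x * b2 - y * b1) - c) mod q"
    define u' where "u' = (c3 - (x * c2 - y * c1) - c) mod q"
    have u: "u \<in> {0..<q}" using q0 unfolding u_def by simp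
    have "(\<Sum>z\<in>{0..<q}. of_bool (incident q c (x, y, z) b) * of_bool (incident q c (x, y, z) b') :: real)
      = (\<Sum>z\<in>{0..<q}. if z = u then of_bool (u = u') else 0)"
      by (intro sum.cong refl) (simp add: incident_def wedge_def bb cc u_def u'_def)
    also have "\<dots> = of_bool (u = u')" using u by simp
    also have "u = u' \<longleftrightarrow> q dvd (b3 - c3) - (x * (b2 - c2) - y * (b1 - c1))"
      unfolding u_def u'_def mod_eq_dvd_iff by (simp add: algebra_simps)
    finally show ?thesis .
  qed
  have total: "(\<Sum>a\<in>clones q. of_bool (incident q c a b) * of_bool (incident q c a b') :: real)
     = (\<Sum>x\<in>{0..<q}. \<Sum>y\<in>{0..<q}. of_bool (q dvd (b3 - c3) - (x * (b2 - c2) - y * (b1 - c1))))"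
    unfolding sum_clones inner ..
  have r: "b1 \<in> {0..<q}" "b2 \<in> {0..<q}" "b3 \<in> {0..<q}" "c1 \<in> {0..<q}" "c2 \<in> {0..<q}" "c3 \<in> {0..<q}"
    using b unfolding clones_def bb cc by auto
  consider "b1 \<noteq> c1" | "b1 = c1" "b2 \<noteq> c2" | "b1 = c1" "b2 = c2" by blast
  then show ?thesis
  proof cases
    case 1
    then have nd: "\<not> q dvd b1 - c1" using small r by simp
    have "(\<Sum>y\<in>{0..<q}. of_bool (q dvd (b3 - c3) - (x * (b2 - c2) - y * (b1 - c1)))) = (1::real)" for x
    proof -
      have "(b3 - c3) - (x * (b2 - c2) - y * (b1 - c1)) = y * (b1 - c1) - (x * (b2 - c2) - (b3 - c3))" for y
        by simp
      then show ?thesis by (simp only: linear_congruence_count[OF q nd])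
    qed
    then have "(\<Sum>x\<in>{0..<q}. \<Sum>y\<in>{0..<q}. of_bool (q dvd (b3 - c3) - (x * (b2 - c2) - y * (b1 - c1)))) = (\<Sum>x\<in>{0..<q}. 1::real)"
      by (simp only:)
    then show ?thesis unfolding total using 1 q0 by (simp add: bb cc)
  next
    case 2
    then have nd: "\<not> q dvd b2 - c2" using small r by simp
    have "(\<Sum>x\<in>{0..<q}. of_bool (q dvd (b3 - c3) - (x * (b2 - c2) - y * (b1 - c1)))) = (1::real)" for y
    proof -
      have "q dvd (b3 - c3) - (x * (b2 - c2) - y * (b1 - c1)) \<longleftrightarrow> q dvd x * (b2 - c2) - (y * (b1 - c1) + (b3 - c3))" for x
        using dvd_minus_iff[of q "x * (b2 - c2) - (y * (b1 - c1) + (b3 - c3))"] by (simp add: algebra_simps)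
      then show ?thesis by (simp only: linear_congruence_count[OF q nd])
    qed
    then have "(\<Sum>y\<in>{0..<q}. \<Sum>x\<in>{0..<q}. of_bool (q dvd (b3 - c3) - (x * (b2 - c2) - y * (b1 - c1)))) = (\<Sum>y\<in>{0..<q}. 1::real)"
      by (simp only:)
    then show ?thesis unfolding total using 2 q0 by (subst sum.swap) (simp add: bb cc)
  next
    case 3
    then show ?thesis unfolding total using small[OF r(3) r(6)] q0
      by (simp add: bb cc power2_eq_square)
  qed
qed

text \<open>
  By the count of common neighbours, \<open>M\<^sup>T M = q\<^sup>2 I + q J - q F\<close> for the incidence matrix \<open>M\<close>, with \<open>J\<close> the all-ones matrix
  and \<open>F\<close> positive semidefinite. Removing the mean from \<open>M \<psi>\<close> cancels \<open>q J\<close>, and the rest has norm at most \<open>q\<close>.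
\<close>
lemma incident_pseudorandom:
  fixes \<phi> \<psi> :: "int \<times> int \<times> int \<Rightarrow> real"
  assumes q: "prime q"
  shows "\<bar>(\<Sum>a\<in>clones q. \<Sum>b\<in>clones q. of_bool (incident q c a b) * \<phi> a * \<psi> b)
      - (\<Sum>a\<in>clones q. \<phi> a) * (\<Sum>b\<in>clones q. \<psi> b) / of_int q\<bar>
    \<le> of_int q * (L2_set \<phi> (clones q) * L2_set \<psi> (clones q))"
proof -
  let ?C = "clones q" and ?q = "real_of_int q"
  have q0: "q > 0" using q by (simp add: prime_gt_0_int)
  define s where "s = (\<Sum>b\<in>?C. \<psi> b)"
  define R where "R a = (\<Sum>b\<in>?C. of_bool (incident q c a b) * \<psi> b)" for a
  define T where "T a = R a - s / ?q" for a
  have "(\<Sum>a\<in>?C. (R a)\<^sup>2) = (\<Sum>b\<in>?C. \<Sum>b'\<in>?C. \<psi> b * \<psi> b' * (\<Sum>a\<in>?C. of_bool (incident q c a b) * of_bool (incident q c a b')))"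
  proof -
    have "(\<Sum>a\<in>?C. (R a)\<^sup>2) = (\<Sum>a\<in>?C. \<Sum>b\<in>?C. \<Sum>b'\<in>?C. \<psi> b * \<psi> b' * (of_bool (incident q c a b) * of_bool (incident q c a b')))"
      unfolding R_def power2_eq_square sum_product by (simp add: mult_ac)
    also have "\<dots> = (\<Sum>b\<in>?C. \<Sum>b'\<in>?C. \<Sum>a\<in>?C. \<psi> b * \<psi> b' * (of_bool (incident q c a b) * of_bool (incident q c a b')))"
      by (rule sum_rotate)
    finally show ?thesis unfolding sum_distrib_left .
  qed
  also have "\<dots> = (\<Sum>b\<in>?C. \<Sum>b'\<in>?C. (if b = b' then ?q\<^sup>2 * (\<psi> b * \<psi> b') else 0) + ?q * (\<psi> b * \<psi> b')
      - ?q * (of_bool (fst b = fst b' \<and> fst (snd b) = fst (snd b')) * (\<psi> b * \<psi> b')))"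
  proof (intro sum.cong refl)
    fix b b' assume b: "b \<in> ?C" "b' \<in> ?C"
    show "\<psi> b * \<psi> b' * (\<Sum>a\<in>?C. of_bool (incident q c a b) * of_bool (incident q c a b'))
      = (if b = b' then ?q\<^sup>2 * (\<psi> b * \<psi> b') else 0) + ?q * (\<psi> b * \<psi> b')
      - ?q * (of_bool (fst b = fst b' \<and> fst (snd b) = fst (snd b')) * (\<psi> b * \<psi> b'))"
      unfolding incident_common_count[OF q b] by (simp add: algebra_simps)
  qed
  also have "\<dots> = ?q\<^sup>2 * (\<Sum>b\<in>?C. (\<psi> b)\<^sup>2) + ?q * s\<^sup>2
      - ?q * (\<Sum>b\<in>?C. \<Sum>b'\<in>?C. of_bool (fst b = fst b' \<and> fst (snd b) = fst (snd b')) * (\<psi> b * \<psi> b'))"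
  proof -
    have 1: "(\<Sum>b\<in>?C. \<Sum>b'\<in>?C. if b = b' then ?q\<^sup>2 * (\<psi> b * \<psi> b') else 0) = ?q\<^sup>2 * (\<Sum>b\<in>?C. (\<psi> b)\<^sup>2)"
      by (simp add: sum_distrib_left power2_eq_square)
    have 2: "(\<Sum>b\<in>?C. \<Sum>b'\<in>?C. ?q * (\<psi> b * \<psi> b')) = ?q * s\<^sup>2"
    proof -
      have "s\<^sup>2 = (\<Sum>b\<in>?C. \<Sum>b'\<in>?C. \<psi> b * \<psi> b')" unfolding s_def power2_eq_square sum_product ..
      then show ?thesis by (simp only: sum_distrib_left)
    qed
    show ?thesis unfolding sum.distrib sum_subtractf 1 2 unfolding sum_distrib_left ..
  qed
  also have "(\<Sum>b\<in>?C. \<Sum>b'\<in>?C. of_bool (fst b = fst b' \<and> fst (snd b) = fst (snd b')) * (\<psi> b * \<psi> b'))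
     = (\<Sum>x\<in>{0..<q}. \<Sum>y\<in>{0..<q}. (\<Sum>z\<in>{0..<q}. \<psi> (x, y, z))\<^sup>2)"
  proof -
    have "(\<Sum>b'\<in>?C. of_bool (x = fst b' \<and> y = fst (snd b')) * \<psi> b') = (\<Sum>z\<in>{0..<q}. \<psi> (x, y, z))"
      if "x \<in> {0..<q}" "y \<in> {0..<q}" for x y
    proof -
      have "(\<Sum>b'\<in>?C. of_bool (x = fst b' \<and> y = fst (snd b')) * \<psi> b')
        = (\<Sum>x'\<in>{0..<q}. \<Sum>y'\<in>{0..<q}. if x' = x then (if y' = y then (\<Sum>z\<in>{0..<q}. \<psi> (x, y, z)) else 0) else 0)"
        unfolding sum_clones by (intro sum.cong refl) auto
      also have "\<dots> = (\<Sum>x'\<in>{0..<q}. if x' = x then (\<Sum>z\<in>{0..<q}. \<psi> (x, y, z)) else 0)"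
        by (intro sum.cong refl) (use that in auto)
      also have "\<dots> = (\<Sum>z\<in>{0..<q}. \<psi> (x, y, z))" using that by simp
      finally show ?thesis .
    qed
    then have "(\<Sum>b'\<in>?C. of_bool (x = fst b' \<and> y = fst (snd b')) * (\<psi> (x, y, z) * \<psi> b')) = \<psi> (x, y, z) * (\<Sum>z\<in>{0..<q}. \<psi> (x, y, z))"
      if "x \<in> {0..<q}" "y \<in> {0..<q}" for x y z
      using that by (simp add: sum_distrib_left[symmetric] mult.left_commute)
    then show ?thesis
      by (subst sum_clones) (simp add: power2_eq_square sum_distrib_right)
  qed
  finally have RR: "(\<Sum>a\<in>?C. (R a)\<^sup>2) \<le> ?q\<^sup>2 * (\<Sum>b\<in>?C. (\<psi> b)\<^sup>2) + ?q * s\<^sup>2"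
    using q0 by (simp add: sum_nonneg)
  have Rs: "(\<Sum>a\<in>?C. R a) = ?q\<^sup>2 * s"
    unfolding R_def s_def by (subst sum.swap) (simp add: sum_distrib_right[symmetric] incident_sum_left[OF q0] sum_distrib_left)
  have "(\<Sum>a\<in>?C. (T a)\<^sup>2) = (\<Sum>a\<in>?C. (R a)\<^sup>2 - 2 * (s / ?q) * R a + (s / ?q)\<^sup>2)"
    by (intro sum.cong refl) (simp add: T_def power2_eq_square algebra_simps)
  also have "\<dots> = (\<Sum>a\<in>?C. (R a)\<^sup>2) - 2 * (s / ?q) * (?q\<^sup>2 * s) + ?q ^ 3 * (s / ?q)\<^sup>2"
    unfolding sum.distrib sum_subtractf sum_distrib_left[symmetric] Rs using q0 by (simp add: card_clones)
  also have "\<dots> = (\<Sum>a\<in>?C. (R a)\<^sup>2) - ?q * s\<^sup>2"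
    using q0 by (simp add: power2_eq_square power3_eq_cube)
  finally have "(\<Sum>a\<in>?C. (T a)\<^sup>2) \<le> ?q\<^sup>2 * (\<Sum>b\<in>?C. (\<psi> b)\<^sup>2)" using RR by linarith
  then have "L2_set T ?C \<le> sqrt (?q\<^sup>2 * (\<Sum>b\<in>?C. (\<psi> b)\<^sup>2))" unfolding L2_set_def by (rule real_sqrt_le_mono)
  then have nT: "L2_set T ?C \<le> ?q * L2_set \<psi> ?C" using q0 by (simp add: L2_set_def real_sqrt_mult)
  have "(\<Sum>a\<in>?C. \<Sum>b\<in>?C. of_bool (incident q c a b) * \<phi> a * \<psi> b) - (\<Sum>a\<in>?C. \<phi> a) * (\<Sum>b\<in>?C. \<psi> b) / ?q
    = (\<Sum>a\<in>?C. \<phi> a * T a)"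
    unfolding T_def R_def s_def[symmetric]
    by (simp add: right_diff_distrib sum_subtractf sum_distrib_left sum_distrib_right sum_divide_distrib mult_ac
        del: sum_mult_of_bool_eq sum_of_bool_mult_eq)
  also have "\<bar>\<dots>\<bar> \<le> (\<Sum>a\<in>?C. \<bar>\<phi> a\<bar> * \<bar>T a\<bar>)"
    by (rule order_trans[OF sum_abs]) (simp add: abs_mult)
  also have "\<dots> \<le> L2_set \<phi> ?C * L2_set T ?C" by (rule L2_set_mult_ineq)
  also have "\<dots> \<le> L2_set \<phi> ?C * (?q * L2_set \<psi> ?C)" by (intro mult_left_mono nT) simp
  finally show ?thesis by (simp add: mult_ac)
qed


text \<open>
  A regular multigraph given by \<open>M\<close> permutations of \<open>V\<close> becomes a simple graph on \<open>V \<times> clones q\<close>: move \<open>c\<close> is realised by the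
  incidence with label \<open>c + 1\<close>, and its inverse by the label \<open>-(c + 1)\<close>. Since \<open>2 * M < q\<close>, the labels
  \<open>1, ..., M\<close> and their negatives are distinct and non-zero modulo \<open>q\<close>. Therefore no pair is joined twice and no
  vertex is joined to itself.
\<close>
locale clone_blowup =
  fixes V :: "'v set" and P :: "nat \<Rightarrow> 'v \<Rightarrow> 'v" and M :: nat and q :: int
  assumes finV [simp]: "finite V" and bijP: "\<And>c. c < M \<Longrightarrow> bij_betw (P c) V V"
    and prime_q: "prime q" and large_q: "2 * int M < q"
begin

abbreviation vertices :: "('v \<times> int \<times> int \<times> int) set" where
  "vertices \<equiv> V \<times> clones q"

definition link :: "'v \<times> int \<times> int \<times> int \<Rightarrow> 'v \<times> int \<times> int \<times> int \<Rightarrow> bool" where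
  "link u u' \<longleftrightarrow> (\<exists>c<M. (fst u' = P c (fst u) \<and> incident q (int c + 1) (snd u) (snd u'))
    \<or> (fst u = P c (fst u') \<and> incident q (int c + 1) (snd u') (snd u)))"

lemma q_pos: "q > 0"
  using prime_q by (simp add: prime_gt_0_int)

lemma link_sym: "link u u' \<longleftrightarrow> link u' u"
  unfolding link_def by blast

lemma small_not_dvd: "0 < k \<Longrightarrow> k < q \<Longrightarrow> \<not> q dvd k" for k :: int
  by (simp add: zdvd_not_zless)

lemma link_irrefl:
  assumes "u \<in> vertices"
  shows "\<not> link u u"
proof
  assume "link u u"
  then obtain c where c: "c < M" "incident q (int c + 1) (snd u) (snd u)" unfolding link_def by blast
  then have "q dvd int c + 1" using assms by (intro incident_refl_label[of "snd u"]) auto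
  then show False using small_not_dvd[of "int c + 1"] c large_q by simp
qed

lemma label_cases:
  assumes c: "c < M" "c' < M" and ab: "a \<in> clones q" "b \<in> clones q"
  shows "incident q (int c + 1) a b \<Longrightarrow> incident q (int c' + 1) a b \<Longrightarrow> c = c'"
    and "incident q (int c + 1) a b \<Longrightarrow> \<not> incident q (int c' + 1) b a"
proof -
  assume i: "incident q (int c + 1) a b"
  { assume "incident q (int c' + 1) a b"
    then have d: "q dvd (int c + 1) - (int c' + 1)" "q dvd (int c' + 1) - (int c + 1)"
      using i incident_label_unique by blast+
    show "c = c'"
    proof (rule ccontr)
      assume "c \<noteq> c'"
      then consider "int c > int c'" | "int c' > int c" by linarith
      then show False
        by cases (use d small_not_dvd[of "(int c + 1) - (int c' + 1)"] small_not_dvd[of "(int c' + 1) - (int c + 1)"] c large_q in auto)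
    qed }
  { show "\<not> incident q (int c' + 1) b a"
    proof
      assume "incident q (int c' + 1) b a"
      then have "incident q (- (int c' + 1)) a b" using incident_flip[OF ab(2,1)] by simp
      then have "q dvd (int c + 1) - (- (int c' + 1))" using i incident_label_unique by blast
      then show False using small_not_dvd[of "(int c + 1) - (- (int c' + 1))"] c large_q by auto
    qed }
qed

lemma of_bool_link:
  assumes u: "u \<in> vertices" and u': "u' \<in> vertices"
  shows "(of_bool (link u u') :: real) = (\<Sum>c<M. of_bool (fst u' = P c (fst u)) * of_bool (incident q (int c + 1) (snd u) (snd u'))
    + of_bool (fst u = P c (fst u')) * of_bool (incident q (int c + 1) (snd u') (snd u)))"
    (is "_ = (\<Sum>c<M. ?t c)")
proof (cases "link u u'")
  case False
  then have "?t c = 0" if "c < M" for c using that unfolding link_def by auto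
  then show ?thesis using False by simp
next
  case True
  then obtain c where c: "c < M" and alt: "(fst u' = P c (fst u) \<and> incident q (int c + 1) (snd u) (snd u'))
    \<or> (fst u = P c (fst u') \<and> incident q (int c + 1) (snd u') (snd u))" unfolding link_def by blast
  have cl: "snd u \<in> clones q" "snd u' \<in> clones q" using u u' by auto
  have "?t c' = (if c' = c then 1 else 0)" if "c' < M" for c'
    using alt
  proof
    assume a: "fst u' = P c (fst u) \<and> incident q (int c + 1) (snd u) (snd u')"
    have n: "\<not> incident q (int c' + 1) (snd u') (snd u)"
      using label_cases(2)[OF c that cl] a by blast
    have e: "incident q (int c' + 1) (snd u) (snd u') \<longleftrightarrow> c' = c"
      using label_cases(1)[OF c that cl] a by blast
    show ?thesis unfolding of_bool_def using n e a by simp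
  next
    assume a: "fst u = P c (fst u') \<and> incident q (int c + 1) (snd u') (snd u)"
    have n: "\<not> incident q (int c' + 1) (snd u) (snd u')"
      using label_cases(2)[OF c that cl(2,1)] a by blast
    have e: "incident q (int c' + 1) (snd u') (snd u) \<longleftrightarrow> c' = c"
      using label_cases(1)[OF c that cl(2,1)] a by blast
    show ?thesis unfolding of_bool_def using n e a by simp
  qed
  then have "(\<Sum>c'<M. ?t c') = (\<Sum>c'<M. if c' = c then 1 else 0)" by (intro sum.cong refl) auto
  then show ?thesis using True c by simp
qed

definition link_form :: "('v \<times> int \<times> int \<times> int \<Rightarrow> real) \<Rightarrow> ('v \<times> int \<times> int \<times> int \<Rightarrow> real) \<Rightarrow> real" where
  "link_form f g = (\<Sum>u\<in>vertices. \<Sum>u'\<in>vertices. of_bool (link u u') * f u * g u')"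

definition clone_sum :: "('v \<times> int \<times> int \<times> int \<Rightarrow> real) \<Rightarrow> 'v \<Rightarrow> real" where
  "clone_sum f v = (\<Sum>a\<in>clones q. f (v, a))"

definition move_form :: "nat \<Rightarrow> ('v \<times> int \<times> int \<times> int \<Rightarrow> real) \<Rightarrow> ('v \<times> int \<times> int \<times> int \<Rightarrow> real) \<Rightarrow> real" where
  "move_form c f g = (\<Sum>v\<in>V. \<Sum>a\<in>clones q. \<Sum>b\<in>clones q. of_bool (incident q (int c + 1) a b) * f (v, a) * g (P c v, b))"

lemma sum_vertices: "(\<Sum>u\<in>vertices. h u) = (\<Sum>v\<in>V. \<Sum>a\<in>clones q. h (v, a))"
  unfolding sum.cartesian_product by (simp add: case_prod_beta)

lemma sum_move_target:
  assumes "c < M" "v \<in> V"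
  shows "(\<Sum>w\<in>V. \<Sum>b\<in>clones q. of_bool (w = P c v) * h w b) = (\<Sum>b\<in>clones q. h (P c v) b :: real)"
proof -
  have "P c v \<in> V" using bijP[OF assms(1)] assms(2) by (meson bij_betwE)
  have "(\<Sum>w\<in>V. \<Sum>b\<in>clones q. of_bool (w = P c v) * h w b) = (\<Sum>w\<in>V. if w = P c v then (\<Sum>b\<in>clones q. h w b) else 0)"
    by (intro sum.cong refl) auto
  then show ?thesis using \<open>P c v \<in> V\<close> by simp
qed

text \<open>
  Because the labels separate the moves, the adjacency form is the plain sum of the forms of the single moves and of their transposes.
\<close>
lemma link_form_moves: "link_form f g = (\<Sum>c<M. move_form c f g + move_form c g f)"
proof -
  let ?i = "\<lambda>c a b. of_bool (incident q (int c + 1) a b) :: real"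
  have "link_form f g = (\<Sum>u\<in>vertices. \<Sum>u'\<in>vertices. \<Sum>c<M.
      of_bool (fst u' = P c (fst u)) * (?i c (snd u) (snd u') * f u * g u')
      + of_bool (fst u = P c (fst u')) * (?i c (snd u') (snd u) * g u' * f u))"
    unfolding link_form_def
  proof (intro sum.cong refl)
    fix u u' assume u: "u \<in> vertices" "u' \<in> vertices"
    show "of_bool (link u u') * f u * g u' = (\<Sum>c<M.
      of_bool (fst u' = P c (fst u)) * (?i c (snd u) (snd u') * f u * g u')
      + of_bool (fst u = P c (fst u')) * (?i c (snd u') (snd u) * g u' * f u))"
      unfolding of_bool_link[OF u] sum_distrib_right by (intro sum.cong refl) (simp only: distrib_left distrib_right mult_ac)
  qed
  also have "\<dots> = (\<Sum>c<M. \<Sum>u\<in>vertices. \<Sum>u'\<in>vertices.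
      of_bool (fst u' = P c (fst u)) * (?i c (snd u) (snd u') * f u * g u')
      + of_bool (fst u = P c (fst u')) * (?i c (snd u') (snd u) * g u' * f u))"
    by (rule sum_rotate[symmetric])
  also have "\<dots> = (\<Sum>c<M. move_form c f g + move_form c g f)"
  proof (rule sum.cong[OF refl])
    fix c assume "c \<in> {..<M}"
    then have c: "c < M" by simp
    have 1: "(\<Sum>u\<in>vertices. \<Sum>u'\<in>vertices. of_bool (fst u' = P c (fst u)) * (?i c (snd u) (snd u') * f' u * g' u')) = move_form c f' g'" for f' g'
    proof -
      have "(\<Sum>u\<in>vertices. \<Sum>u'\<in>vertices. of_bool (fst u' = P c (fst u)) * (?i c (snd u) (snd u') * f' u * g' u'))
        = (\<Sum>v\<in>V. \<Sum>a\<in>clones q. \<Sum>w\<in>V. \<Sum>b\<in>clones q. of_bool (w = P c v) * (?i c a b * f' (v, a) * g' (w, b)))"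
        unfolding sum_vertices fst_conv snd_conv ..
      also have "\<dots> = move_form c f' g'"
        unfolding move_form_def by (intro sum.cong refl) (rule sum_move_target[OF c])
      finally show ?thesis .
    qed
    have 2: "(\<Sum>u\<in>vertices. \<Sum>u'\<in>vertices. of_bool (fst u = P c (fst u')) * (?i c (snd u') (snd u) * g u' * f u)) = move_form c g f"
      by (subst sum.swap) (rule 1)
    show "(\<Sum>u\<in>vertices. \<Sum>u'\<in>vertices.
      of_bool (fst u' = P c (fst u)) * (?i c (snd u) (snd u') * f u * g u')
      + of_bool (fst u = P c (fst u')) * (?i c (snd u') (snd u) * g u' * f u)) = move_form c f g + move_form c g f"
      unfolding sum.distrib 1 2 ..
  qed
  finally show ?thesis .
qed

lemma L2_vertices: "(\<Sum>v\<in>V. (L2_set (\<lambda>a. f (v, a)) (clones q))\<^sup>2) = (L2_set f vertices)\<^sup>2"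
  unfolding L2_set_def sum_vertices by (simp add: sum_nonneg)

lemma L2_slices: "L2_set (\<lambda>v. L2_set (\<lambda>a. f (v, a)) (clones q)) V = L2_set f vertices"
  unfolding L2_set_def[of "\<lambda>v. L2_set (\<lambda>a. f (v, a)) (clones q)"] L2_vertices by simp

text \<open>
  Each incidence relation is close to the complete relation of density \<open>1/q\<close>, so a move sees only the sums over clones,
  up to an error of relative size \<open>1/q\<close> compared with the degree \<open>q\<^sup>2\<close>.
\<close>
lemma move_form_approx:
  assumes c: "c < M"
  shows "\<bar>move_form c f g - (\<Sum>v\<in>V. clone_sum f v * clone_sum g (P c v)) / of_int q\<bar>
    \<le> of_int q * (L2_set f vertices * L2_set g vertices)"
proof -
  let ?nf = "\<lambda>v. L2_set (\<lambda>a. f (v, a)) (clones q)" and ?ng = "\<lambda>v. L2_set (\<lambda>a. g (v, a)) (clones q)"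
  have "move_form c f g - (\<Sum>v\<in>V. clone_sum f v * clone_sum g (P c v)) / of_int q
    = (\<Sum>v\<in>V. (\<Sum>a\<in>clones q. \<Sum>b\<in>clones q. of_bool (incident q (int c + 1) a b) * f (v, a) * g (P c v, b))
        - clone_sum f v * clone_sum g (P c v) / of_int q)"
    unfolding move_form_def sum_subtractf sum_divide_distrib ..
  also have "\<bar>\<dots>\<bar> \<le> (\<Sum>v\<in>V. of_int q * (?nf v * ?ng (P c v)))"
    unfolding clone_sum_def by (intro order_trans[OF sum_abs] sum_mono incident_pseudorandom prime_q)
  also have "\<dots> = of_int q * (\<Sum>v\<in>V. \<bar>?nf v\<bar> * \<bar>?ng (P c v)\<bar>)"
    by (simp add: sum_distrib_left)
  also have "\<dots> \<le> of_int q * (L2_set ?nf V * L2_set (\<lambda>v. ?ng (P c v)) V)"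
    using q_pos by (intro mult_left_mono L2_set_mult_ineq) auto
  also have "L2_set (\<lambda>v. ?ng (P c v)) V = L2_set ?ng V"
    unfolding L2_set_def[of _ V] using sum.reindex_bij_betw[OF bijP[OF c], of "\<lambda>v. (?ng v)\<^sup>2"] by simp
  finally show ?thesis unfolding L2_slices .
qed

lemma move_form_const_left:
  "move_form c (\<lambda>u. p (fst u)) g = (of_int q)\<^sup>2 * (\<Sum>v\<in>V. p v * clone_sum g (P c v))"
proof -
  have "(\<Sum>a\<in>clones q. \<Sum>b\<in>clones q. of_bool (incident q (int c + 1) a b) * p v * g (P c v, b))
     = (of_int q)\<^sup>2 * (p v * clone_sum g (P c v))" for v
  proof -
    have "(\<Sum>a\<in>clones q. \<Sum>b\<in>clones q. of_bool (incident q (int c + 1) a b) * p v * g (P c v, b))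
      = (\<Sum>b\<in>clones q. (\<Sum>a\<in>clones q. of_bool (incident q (int c + 1) a b)) * (p v * g (P c v, b)))"
      by (subst sum.swap) (simp only: sum_distrib_right mult.assoc)
    also have "\<dots> = (\<Sum>b\<in>clones q. (of_int q)\<^sup>2 * (p v * g (P c v, b)))"
      by (simp only: incident_sum_left[OF q_pos])
    finally show ?thesis by (simp add: clone_sum_def sum_distrib_left)
  qed
  then show ?thesis unfolding move_form_def by (simp add: sum_distrib_left)
qed

lemma move_form_const_right:
  "move_form c f (\<lambda>u. p (fst u)) = (of_int q)\<^sup>2 * (\<Sum>v\<in>V. clone_sum f v * p (P c v))"
proof -
  have "(\<Sum>a\<in>clones q. \<Sum>b\<in>clones q. of_bool (incident q (int c + 1) a b) * f (v, a) * p (P c v))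
     = (of_int q)\<^sup>2 * (clone_sum f v * p (P c v))" for v
  proof -
    have "(\<Sum>a\<in>clones q. \<Sum>b\<in>clones q. of_bool (incident q (int c + 1) a b) * f (v, a) * p (P c v))
      = (\<Sum>a\<in>clones q. (\<Sum>b\<in>clones q. of_bool (incident q (int c + 1) a b)) * (f (v, a) * p (P c v)))"
      by (simp only: sum_distrib_right mult.assoc)
    also have "\<dots> = (\<Sum>a\<in>clones q. (of_int q)\<^sup>2 * (f (v, a) * p (P c v)))"
      by (intro sum.cong refl) (simp only: incident_sum_right[OF q_pos])
    finally show ?thesis by (simp add: clone_sum_def sum_distrib_left sum_distrib_right mult_ac)
  qed
  then show ?thesis unfolding move_form_def by (simp add: sum_distrib_left)
qed

lemma clone_sum_L2: "L2_set (clone_sum f) V * L2_set (clone_sum g) V \<le> of_int q ^ 3 * (L2_set f vertices * L2_set g vertices)"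
proof -
  have one: "L2_set (clone_sum f) V \<le> sqrt (of_int q ^ 3) * L2_set f vertices" for f
  proof -
    have "\<bar>clone_sum f v\<bar> \<le> sqrt (of_int q ^ 3) * L2_set (\<lambda>a. f (v, a)) (clones q)" for v
    proof -
      have "\<bar>clone_sum f v\<bar> \<le> (\<Sum>a\<in>clones q. \<bar>1\<bar> * \<bar>f (v, a)\<bar>)"
        unfolding clone_sum_def by (rule order_trans[OF sum_abs]) simp
      also have "\<dots> \<le> L2_set (\<lambda>_. 1) (clones q) * L2_set (\<lambda>a. f (v, a)) (clones q)" by (rule L2_set_mult_ineq)
      also have "L2_set (\<lambda>_. 1) (clones q) = sqrt (of_int q ^ 3)"
        using q_pos by (simp add: L2_set_constant card_clones)
      finally show ?thesis .
    qed
    then have "L2_set (\<lambda>v. \<bar>clone_sum f v\<bar>) V \<le> L2_set (\<lambda>v. sqrt (of_int q ^ 3) * L2_set (\<lambda>a. f (v, a)) (clones q)) V"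
      by (intro L2_set_mono) auto
    also have "\<dots> = sqrt (of_int q ^ 3) * L2_set f vertices"
      using q_pos by (simp add: L2_set_right_distrib[symmetric] L2_slices)
    finally show ?thesis by (simp add: L2_set_def)
  qed
  have "L2_set (clone_sum f) V * L2_set (clone_sum g) V
     \<le> (sqrt (of_int q ^ 3) * L2_set f vertices) * (sqrt (of_int q ^ 3) * L2_set g vertices)"
    using q_pos by (intro mult_mono one) auto
  also have "\<dots> = (sqrt (of_int q ^ 3) * sqrt (of_int q ^ 3)) * (L2_set f vertices * L2_set g vertices)"
    by (simp only: mult_ac)
  also have "sqrt (of_int q ^ 3) * sqrt (of_int q ^ 3) = (of_int q ^ 3 :: real)"
    using q_pos by (intro real_sqrt_mult_self[THEN trans]) auto
  finally show ?thesis .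
qed

end

section \<open>Graphs with prescribed signs on many characters\<close>

text \<open>
  The spectral hypotheses are stated as identities and bounds of bilinear forms with an arbitrary second argument \<open>g\<close>,
  so that no matrix indexed by \<open>U\<close> is needed. The index \<open>s\<close> is the sign with which the vectors \<open>h j\<close> are multiplied.
\<close>
locale signed_kernels =
  fixes U :: "'u set" and W :: "int \<Rightarrow> 'u \<Rightarrow> 'u \<Rightarrow> bool" and h :: "nat \<Rightarrow> 'u \<Rightarrow> real"
    and m :: nat and \<theta> :: real
  assumes finU [simp]: "finite U" and U_nonempty: "U \<noteq> {}"
    and W_irrefl: "\<And>s u. u \<in> U \<Longrightarrow> \<not> W s u u"
    and W_sym: "\<And>s u u'. W s u u' \<longleftrightarrow> W s u' u"
    and W_const: "\<And>s g. s \<in> {-1, 0, 1} \<Longrightarrow>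
      (\<Sum>u\<in>U. \<Sum>u'\<in>U. of_bool (W s u u') * g u') = 4 * \<theta> * (\<Sum>u\<in>U. g u)"
    and W_eigen: "\<And>s j g. s \<in> {-1, 0, 1} \<Longrightarrow> j < m \<Longrightarrow>
      (\<Sum>u\<in>U. \<Sum>u'\<in>U. of_bool (W s u u') * h j u * g u') = of_int s * \<theta> * (\<Sum>u\<in>U. h j u * g u)"
    and W_bound: "\<And>s f g. s \<in> {-1, 0, 1} \<Longrightarrow> (\<Sum>u\<in>U. f u) = 0 \<Longrightarrow>
      (\<And>j. j < m \<Longrightarrow> (\<Sum>u\<in>U. f u * h j u) = 0) \<Longrightarrow>
      \<bar>\<Sum>u\<in>U. \<Sum>u'\<in>U. of_bool (W s u u') * f u * g u'\<bar> \<le> 7/20 * \<theta> * (L2_set f U * L2_set g U)"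
    and h_sum: "\<And>j. j < m \<Longrightarrow> (\<Sum>u\<in>U. h j u) = 0"
    and h_orth: "\<And>i j. i < m \<Longrightarrow> j < m \<Longrightarrow> i \<noteq> j \<Longrightarrow> (\<Sum>u\<in>U. h i u * h j u) = 0"
    and h_square: "\<And>j u. h j u * h j u = 1"
    and theta_pos: "\<theta> > 0"

text \<open>
  There are \<open>8 * e\<^sup>2\<close> moves, hence the lower bound on the prime \<open>q\<close>.
\<close>
locale mixing_clones = mixing_base +
  fixes q :: int
  assumes e_pos: "e > 0" and prime_q: "prime q" and large_q: "16 * int (e * e) < q" and q100: "100 \<le> q"
    and eta_small: "\<eta> \<le> 1/200"
begin

definition carry :: "nat \<Rightarrow> 'a \<times> nat set \<Rightarrow> 'a \<times> nat set" where
  "carry i v = (g i (fst v), snd v)"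

lemma bij_carry:
  assumes "i < e"
  shows "bij_betw (carry i) states states"
proof -
  have "carry i = map_prod (g i) id" by (auto simp: carry_def)
  then show ?thesis using bij_betw_map_prod[OF bij[OF assms] bij_betw_id] by simp
qed

text \<open>
  The index \<open>c\<close> encodes two expander maps and a rotation: undo the map \<open>c div 8 div e\<close>, switch lamps with
  rotation \<open>c mod 8\<close>, apply the map \<open>c div 8 mod e\<close>. Summed over \<open>c\<close> this is the expander, the lamp form and the expander again.
\<close>
definition move :: "nat \<Rightarrow> nat \<Rightarrow> 'a \<times> nat set \<Rightarrow> 'a \<times> nat set" where
  "move k c = carry (c div 8 mod e) \<circ> lamps k (c mod 8) \<circ> inv_into states (carry (c div 8 div e))"

lemma move_indices:
  assumes "c < e * e * 8"
  shows "c div 8 mod e < e" "c div 8 div e < e"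
proof -
  show "c div 8 mod e < e" using e_pos by simp
  have "c div 8 < e * e" using assms by (simp add: less_mult_imp_div_less)
  then show "c div 8 div e < e" by (simp add: less_mult_imp_div_less)
qed

lemma bij_move:
  assumes "c < e * e * 8"
  shows "bij_betw (move k c) states states"
  unfolding move_def
  by (rule bij_betw_trans[OF bij_betw_inv_into[OF bij_carry[OF move_indices(2)[OF assms]]]
      bij_betw_trans[OF bij_lamps bij_carry[OF move_indices(1)[OF assms]]]])

lemma sum_move:
  assumes "c < e * e * 8"
  shows "(\<Sum>v\<in>states. p v * r (move k c v))
    = (\<Sum>v\<in>states. p (carry (c div 8 div e) v) * r (carry (c div 8 mod e) (lamps k (c mod 8) v)))"
proof -
  note b = bij_carry[OF move_indices(2)[OF assms]]
  have "(\<Sum>v\<in>states. p v * r (move k c v))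
    = (\<Sum>v\<in>states. p (carry (c div 8 div e) v) * r (move k c (carry (c div 8 div e) v)))"
    by (rule sum.reindex_bij_betw[OF b, symmetric])
  also have "\<dots> = (\<Sum>v\<in>states. p (carry (c div 8 div e) v) * r (carry (c div 8 mod e) (lamps k (c mod 8) v)))"
    using b by (intro sum.cong refl) (simp add: move_def bij_betw_inv_into_left)
  finally show ?thesis .
qed

lemma sum_all_moves:
  "(\<Sum>c<e * e * 8. \<Sum>v\<in>states. p v * r (move k c v)) = lamp_form k (spread p) (spread r)"
proof -
  have "(\<Sum>c<e * e * 8. \<Sum>v\<in>states. p v * r (move k c v))
    = (\<Sum>c<e * e * 8. \<Sum>v\<in>states. p (carry (c div 8 div e) v) * r (carry (c div 8 mod e) (lamps k (c mod 8) v)))"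
    by (rule sum.cong[OF refl]) (simp only: lessThan_iff sum_move)
  also have "\<dots> = (\<Sum>t<e * e. \<Sum>l<8. \<Sum>v\<in>states. p (carry (t div e) v) * r (carry (t mod e) (lamps k l v)))"
    by (rule sum_div_mod) simp
  also have "\<dots> = (\<Sum>l<8. \<Sum>t<e * e. \<Sum>v\<in>states. p (carry (t div e) v) * r (carry (t mod e) (lamps k l v)))"
    by (rule sum.swap)
  also have "\<dots> = (\<Sum>l<8. \<Sum>i<e. \<Sum>i'<e. \<Sum>v\<in>states. p (carry i v) * r (carry i' (lamps k l v)))"
    by (intro sum.cong refl sum_div_mod e_pos)
  also have "\<dots> = (\<Sum>l<8. \<Sum>v\<in>states. \<Sum>i<e. \<Sum>i'<e. p (carry i v) * r (carry i' (lamps k l v)))"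
    by (intro sum.cong refl sum_rotate[symmetric])
  also have "\<dots> = lamp_form k (spread p) (spread r)"
    unfolding lamp_form_def spread_def carry_def sum_product by simp
  finally show ?thesis .
qed

lemma blowup: "clone_blowup states (move k) (e * e * 8) q"
  by unfold_locales (use bij_move prime_q large_q in auto)

abbreviation kernel :: "nat \<Rightarrow> ('a \<times> nat set) \<times> int \<times> int \<times> int \<Rightarrow> ('a \<times> nat set) \<times> int \<times> int \<times> int \<Rightarrow> bool" where
  "kernel k \<equiv> clone_blowup.link (move k) (e * e * 8) q"

abbreviation kernel_vertices :: "(('a \<times> nat set) \<times> int \<times> int \<times> int) set" where
  "kernel_vertices \<equiv> states \<times> clones q"

abbreviation kernel_form :: "nat \<Rightarrow> (('a \<times> nat set) \<times> int \<times> int \<times> int \<Rightarrow> real) \<Rightarrow>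
    (('a \<times> nat set) \<times> int \<times> int \<times> int \<Rightarrow> real) \<Rightarrow> real" where
  "kernel_form k f r \<equiv> \<Sum>u\<in>kernel_vertices. \<Sum>u'\<in>kernel_vertices. of_bool (kernel k u u') * f u * r u'"

abbreviation fibre_sum :: "(('a \<times> nat set) \<times> int \<times> int \<times> int \<Rightarrow> real) \<Rightarrow> 'a \<times> nat set \<Rightarrow> real" where
  "fibre_sum f v \<equiv> \<Sum>a\<in>clones q. f (v, a)"

lemma kernel_form_walsh:
  assumes "\<And>\<omega>. \<omega> \<in> Om \<Longrightarrow> (\<Sum>l<8. walsh m S (flips m k l (dig \<omega>))) = a"
  shows "kernel_form k (\<lambda>u. walsh m S (snd (fst u))) f
    = 2 * (of_int q)\<^sup>2 * (real e)\<^sup>2 * a * (\<Sum>u\<in>kernel_vertices. walsh m S (snd (fst u)) * f u)"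
proof -
  interpret B: clone_blowup states "move k" "e * e * 8" q by (rule blowup)
  let ?w = "\<lambda>v :: 'a \<times> nat set. walsh m S (snd v)"
  have L: "lamp_form k (spread H) (spread ?w) = (real e)\<^sup>2 * a * (\<Sum>v\<in>states. H v * ?w v)" for H
    by (rule lamp_form_spread_walsh[OF assms])
  have "kernel_form k (\<lambda>u. ?w (fst u)) f
     = (\<Sum>c<e * e * 8. B.move_form c (\<lambda>u. ?w (fst u)) f + B.move_form c f (\<lambda>u. ?w (fst u)))"
    using B.link_form_moves unfolding B.link_form_def .
  also have "\<dots> = (of_int q)\<^sup>2 * (\<Sum>c<e * e * 8. (\<Sum>v\<in>states. ?w v * B.clone_sum f (move k c v)) + (\<Sum>v\<in>states. B.clone_sum f v * ?w (move k c v)))"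
  proof -
    have l: "B.move_form c (\<lambda>u. ?w (fst u)) f = (of_int q)\<^sup>2 * (\<Sum>v\<in>states. ?w v * B.clone_sum f (move k c v))" for c
      by (rule B.move_form_const_left)
    have r: "B.move_form c f (\<lambda>u. ?w (fst u)) = (of_int q)\<^sup>2 * (\<Sum>v\<in>states. B.clone_sum f v * ?w (move k c v))" for c
      by (rule B.move_form_const_right)
    show ?thesis unfolding l r distrib_left[symmetric] by (rule sum_distrib_left[symmetric])
  qed
  also have "\<dots> = (of_int q)\<^sup>2 * (lamp_form k (spread ?w) (spread (B.clone_sum f)) + lamp_form k (spread (B.clone_sum f)) (spread ?w))"
    unfolding sum.distrib sum_all_moves[where p = ?w and r = "B.clone_sum f" and k = k, symmetric]
      sum_all_moves[where p = "B.clone_sum f" and r = ?w and k = k, symmetric] ..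
  also have "\<dots> = 2 * (of_int q)\<^sup>2 * (real e)\<^sup>2 * a * (\<Sum>v\<in>states. B.clone_sum f v * ?w v)"
    unfolding lamp_form_commute[of k "spread ?w"] L by simp
  also have "(\<Sum>v\<in>states. B.clone_sum f v * ?w v) = (\<Sum>u\<in>kernel_vertices. ?w (fst u) * f u)"
    unfolding B.sum_vertices B.clone_sum_def by (simp add: sum_distrib_left mult.commute)
  finally show ?thesis .
qed

text \<open>
  For \<open>\<eta> \<le> 1/200\<close> the factor \<open>1/2 + 24 * \<eta>\<close> of the lamp form is at most \<open>31/50\<close>. Moves and their transposes together contribute
  \<open>31/25\<close> times \<open>q\<^sup>2 e\<^sup>2\<close>, and the clone errors at most \<open>4/25\<close> times \<open>q\<^sup>2 e\<^sup>2\<close> because \<open>16 * q \<le> 4/25 * q\<^sup>2\<close> for \<open>q \<ge> 100\<close>. The total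
  \<open>7/5 * q\<^sup>2 e\<^sup>2\<close> is \<open>7/20\<close> of \<open>\<theta> = 4 q\<^sup>2 e\<^sup>2\<close>.
\<close>
lemma kernel_form_bound:
  assumes k: "k \<le> 8" and rho: "\<bar>1 - real k / 4\<bar> \<le> 1/4"
    and F0: "(\<Sum>u\<in>kernel_vertices. f u) = 0"
    and F1: "\<And>j. j < m \<Longrightarrow> (\<Sum>u\<in>kernel_vertices. f u * walsh m {j} (snd (fst u))) = 0"
  shows "\<bar>kernel_form k f r\<bar> \<le> 7/20 * (4 * (of_int q)\<^sup>2 * (real e)\<^sup>2) * (L2_set f kernel_vertices * L2_set r kernel_vertices)"
proof -
  interpret B: clone_blowup states "move k" "e * e * 8" q by (rule blowup)
  let ?N = "L2_set f kernel_vertices * L2_set r kernel_vertices"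
  let ?q = "real_of_int q" and ?e = "real e"
  let ?A = "\<lambda>c p s. \<Sum>v\<in>states. B.clone_sum p v * B.clone_sum s (move k c v)"
  have q0: "?q > 0" using B.q_pos by simp
  have N0: "?N \<ge> 0" by simp
  have z0: "(\<Sum>v\<in>states. B.clone_sum f v) = 0"
    using F0 unfolding B.sum_vertices B.clone_sum_def .
  have z1: "(\<Sum>v\<in>states. B.clone_sum f v * walsh m {j} (snd v)) = 0" if "j < m" for j
    using F1[OF that] unfolding B.sum_vertices B.clone_sum_def by (simp add: sum_distrib_right)
  have mix: "\<bar>lamp_form k (spread (B.clone_sum f)) (spread (B.clone_sum r))\<bar> \<le> ?e\<^sup>2 * (31/50) * (?q ^ 3 * ?N)"
  proof -
    have "\<bar>lamp_form k (spread (B.clone_sum f)) (spread (B.clone_sum r))\<bar>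
      \<le> ?e\<^sup>2 * (1/2 + 24 * \<eta>) * (L2_set (B.clone_sum f) states * L2_set (B.clone_sum r) states)"
      by (rule lamp_mixing[OF k rho _ z0 z1]) (use eta_small in auto)
    also have "\<dots> \<le> ?e\<^sup>2 * (1/2 + 24 * \<eta>) * (?q ^ 3 * ?N)"
      using eta by (intro mult_left_mono B.clone_sum_L2) auto
    also have "\<dots> \<le> ?e\<^sup>2 * (31/50) * (?q ^ 3 * ?N)"
      using eta_small q0 by (intro mult_right_mono mult_left_mono) auto
    finally show ?thesis .
  qed
  have approx: "\<bar>kernel_form k f r - (\<Sum>c<e * e * 8. ?A c f r / ?q + ?A c r f / ?q)\<bar> \<le> real (e * e * 8) * (2 * (?q * ?N))"
  proof -
    have eq: "kernel_form k f r - (\<Sum>c<e * e * 8. ?A c f r / ?q + ?A c r f / ?q)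
      = (\<Sum>c<e * e * 8. (B.move_form c f r - ?A c f r / ?q) + (B.move_form c r f - ?A c r f / ?q))"
    proof -
      have "kernel_form k f r = (\<Sum>c<e * e * 8. B.move_form c f r + B.move_form c r f)"
        using B.link_form_moves unfolding B.link_form_def .
      then show ?thesis by (simp only: sum_subtractf[symmetric]) (intro sum.cong refl, simp)
    qed
    have "\<bar>\<Sum>c<e * e * 8. (B.move_form c f r - ?A c f r / ?q) + (B.move_form c r f - ?A c r f / ?q)\<bar> \<le> (\<Sum>c<e * e * 8. 2 * (?q * ?N))"
    proof (rule order_trans[OF sum_abs sum_mono])
      fix c assume "c \<in> {..<e * e * 8}"
      then have c: "c < e * e * 8" by simp
      have 1: "\<bar>B.move_form c f r - ?A c f r / ?q\<bar> \<le> ?q * ?N" by (rule B.move_form_approx[OF c])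
      have 2: "\<bar>B.move_form c r f - ?A c r f / ?q\<bar> \<le> ?q * ?N"
        using B.move_form_approx[OF c, of r f] unfolding mult.commute[of "L2_set r kernel_vertices"] .
      show "\<bar>(B.move_form c f r - ?A c f r / ?q) + (B.move_form c r f - ?A c r f / ?q)\<bar> \<le> 2 * (?q * ?N)"
        using order_trans[OF abs_triangle_ineq add_mono[OF 1 2]] unfolding mult_2 .
    qed
    then show ?thesis unfolding eq sum_constant card_lessThan .
  qed
  have main: "(\<Sum>c<e * e * 8. ?A c f r / ?q + ?A c r f / ?q) = 2 * lamp_form k (spread (B.clone_sum f)) (spread (B.clone_sum r)) / ?q"
    unfolding sum.distrib sum_divide_distrib[symmetric] sum_all_moves lamp_form_commute[of k "spread (B.clone_sum r)"] by simp
  have "\<bar>2 * lamp_form k (spread (B.clone_sum f)) (spread (B.clone_sum r)) / ?q\<bar> \<le> 2 * (?e\<^sup>2 * (31/50) * (?q ^ 3 * ?N)) / ?q"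
  proof -
    have "\<bar>2 * x / ?q\<bar> \<le> 2 * b / ?q" if "\<bar>x\<bar> \<le> b" for x b :: real
    proof -
      have "\<bar>2 * x / ?q\<bar> = 2 * \<bar>x\<bar> / ?q" using q0 by (simp add: abs_mult)
      also have "\<dots> \<le> 2 * b / ?q" using q0 that by (intro divide_right_mono) auto
      finally show ?thesis .
    qed
    from this[OF mix] show ?thesis .
  qed
  also have "\<dots> = 31/25 * (?q\<^sup>2 * ?e\<^sup>2) * ?N"
    using q0 by (simp add: field_simps power2_eq_square power3_eq_cube)
  finally have m2: "\<bar>2 * lamp_form k (spread (B.clone_sum f)) (spread (B.clone_sum r)) / ?q\<bar> \<le> 31/25 * (?q\<^sup>2 * ?e\<^sup>2) * ?N" .
  have "real (e * e * 8) * (2 * (?q * ?N)) = 16 * ?q * (?e\<^sup>2 * ?N)" by (simp add: power2_eq_square)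
  also have "\<dots> \<le> (4/25 * ?q\<^sup>2) * (?e\<^sup>2 * ?N)"
  proof (rule mult_right_mono)
    have "100 \<le> ?q" using q100 by linarith
    then have "100 * ?q \<le> ?q * ?q" using q0 by (intro mult_right_mono) auto
    then show "16 * ?q \<le> 4/25 * ?q\<^sup>2" by (simp add: power2_eq_square)
  qed simp
  finally have e2: "real (e * e * 8) * (2 * (?q * ?N)) \<le> 4/25 * (?q\<^sup>2 * ?e\<^sup>2) * ?N" by (simp add: mult_ac)
  have "\<bar>kernel_form k f r\<bar> \<le> 31/25 * (?q\<^sup>2 * ?e\<^sup>2) * ?N + 4/25 * (?q\<^sup>2 * ?e\<^sup>2) * ?N"
  proof -
    have "\<bar>x\<bar> \<le> b + c" if "\<bar>x - y\<bar> \<le> a" "\<bar>y\<bar> \<le> b" "a \<le> c" for x y a b c :: real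
      using that by linarith
    from this[OF approx[unfolded main] m2 e2] show ?thesis .
  qed
  also have "\<dots> = 7/20 * (4 * ?q\<^sup>2 * ?e\<^sup>2) * ?N" by simp
  finally show ?thesis .
qed

text \<open>
  The sign \<open>s\<close> corresponds to \<open>k = 4 - s\<close> flipped residues out of eight: the eigenvalue of a single lamp sign is proportional to
  \<open>8 - 2 * k = 2 * s\<close>.
\<close>
theorem signed_kernels:
  "signed_kernels kernel_vertices (\<lambda>s. kernel (nat (4 - s))) (\<lambda>j u. walsh m {j} (snd (fst u))) m (4 * (of_int q)\<^sup>2 * (real e)\<^sup>2)"
proof
  have q0: "q > 0" using q100 by simp
  show "finite kernel_vertices" by simp
  have "(0, 0, 0) \<in> clones q" using q0 by (simp add: clones_def)
  moreover have "{} \<in> cube m" by (simp add: cube_def)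
  ultimately show "kernel_vertices \<noteq> {}" using nonempty by auto
  show "0 < 4 * (of_int q)\<^sup>2 * (real e)\<^sup>2" using q0 e_pos by simp
next
  fix s u assume "u \<in> kernel_vertices"
  then show "\<not> kernel (nat (4 - s)) u u" by (rule clone_blowup.link_irrefl[OF blowup])
next
  fix s u u' show "kernel (nat (4 - s)) u u' \<longleftrightarrow> kernel (nat (4 - s)) u' u"
    by (rule clone_blowup.link_sym[OF blowup])
next
  fix s :: int and f assume "s \<in> {-1, 0, 1}"
  have "kernel_form (nat (4 - s)) (\<lambda>u. walsh m {} (snd (fst u))) f
     = 2 * (of_int q)\<^sup>2 * (real e)\<^sup>2 * 8 * (\<Sum>u\<in>kernel_vertices. walsh m {} (snd (fst u)) * f u)"
    by (rule kernel_form_walsh) simp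
  then show "(\<Sum>u\<in>kernel_vertices. \<Sum>u'\<in>kernel_vertices. of_bool (kernel (nat (4 - s)) u u') * f u')
    = 4 * (4 * (of_int q)\<^sup>2 * (real e)\<^sup>2) * (\<Sum>u\<in>kernel_vertices. f u)"
    by (simp del: sum_mult_of_bool_eq sum_of_bool_mult_eq)
next
  fix s :: int and j :: nat and f assume s: "s \<in> {-1, 0, 1}" and j: "j < m"
  have "kernel_form (nat (4 - s)) (\<lambda>u. walsh m {j} (snd (fst u))) f
     = 2 * (of_int q)\<^sup>2 * (real e)\<^sup>2 * (8 - 2 * real (nat (4 - s))) * (\<Sum>u\<in>kernel_vertices. walsh m {j} (snd (fst u)) * f u)"
    by (rule kernel_form_walsh, rule singleton_flip_sum[OF j]) (use s in auto)
  moreover have "8 - 2 * real (nat (4 - s)) = 2 * of_int s" using s by auto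
  ultimately show "kernel_form (nat (4 - s)) (\<lambda>u. walsh m {j} (snd (fst u))) f
     = of_int s * (4 * (of_int q)\<^sup>2 * (real e)\<^sup>2) * (\<Sum>u\<in>kernel_vertices. walsh m {j} (snd (fst u)) * f u)"
    by simp
next
  fix s :: int and f r assume s: "s \<in> {-1, 0, 1}" and "(\<Sum>u\<in>kernel_vertices. f u) = 0"
    and "\<And>j. j < m \<Longrightarrow> (\<Sum>u\<in>kernel_vertices. f u * walsh m {j} (snd (fst u))) = 0"
  then show "\<bar>kernel_form (nat (4 - s)) f r\<bar> \<le> 7/20 * (4 * (of_int q)\<^sup>2 * (real e)\<^sup>2) * (L2_set f kernel_vertices * L2_set r kernel_vertices)"
    by (intro kernel_form_bound) auto
next
  have split: "(\<Sum>u\<in>kernel_vertices. w (snd (fst u))) = real (card Om) * real (card (clones q)) * (\<Sum>x\<in>cube m. w x)" for w :: "nat set \<Rightarrow> real"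
  proof -
    have "(\<Sum>u\<in>kernel_vertices. w (snd (fst u))) = (\<Sum>v\<in>states. real (card (clones q)) * w (snd v))"
      unfolding clone_blowup.sum_vertices[OF blowup[of 0]] by simp
    also have "\<dots> = real (card (clones q)) * (\<Sum>x\<in>cube m. real (card Om) * w x)"
    proof -
      have "(\<Sum>v\<in>states. real (card (clones q)) * w (snd v)) = (\<Sum>x\<in>cube m. real (card Om) * (real (card (clones q)) * w x))"
        unfolding sum_states by simp
      also have "\<dots> = (\<Sum>x\<in>cube m. real (card (clones q)) * (real (card Om) * w x))"
        by (intro sum.cong refl mult.left_commute)
      finally show ?thesis unfolding sum_distrib_left .
    qed
    also have "(\<Sum>x\<in>cube m. real (card Om) * w x) = real (card Om) * (\<Sum>x\<in>cube m. w x)"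
      by (rule sum_distrib_left[symmetric])
    finally show ?thesis by (simp only: mult_ac)
  qed
  { fix j assume "j < m"
    then have "{j} \<in> cube m" by (simp add: cube_def)
    then have z: "(\<Sum>x\<in>cube m. walsh m {j} x) = 0" by (simp add: sum_walsh)
    show "(\<Sum>u\<in>kernel_vertices. walsh m {j} (snd (fst u))) = 0"
      using split[of "walsh m {j}"] unfolding z mult_zero_right . }
  { fix i j assume "i < m" "j < m" "i \<noteq> j"
    then have "{i} \<in> cube m" "{j} \<in> cube m" by (auto simp: cube_def)
    then have z: "(\<Sum>x\<in>cube m. walsh m {i} x * walsh m {j} x) = 0" using \<open>i \<noteq> j\<close> by (simp add: walsh_orthogonal)
    show "(\<Sum>u\<in>kernel_vertices. walsh m {i} (snd (fst u)) * walsh m {j} (snd (fst u))) = 0"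
      using split[of "\<lambda>x. walsh m {i} x * walsh m {j} x"] unfolding z mult_zero_right . }
qed (rule walsh_square)

lemma card_kernel_vertices: "real (card kernel_vertices) = real (card Om) * 2 ^ m * (of_int q) ^ 3"
  using q100 by (simp add: card_cartesian_product card_cube card_clones)

end

text \<open>
  The digits are those of the first torus coordinate, which ranges over \<open>8 ^ m\<close> values; the second coordinate is free, so
  every digit string occurs \<open>8 ^ m\<close> times. Positions and lamps together number \<open>64 ^ m * 2 ^ m = 128 ^ m\<close>.
\<close>
theorem signed_kernels_exist:
  "\<exists>(t::nat) (B::nat). t > 0 \<and> (\<forall>m. \<exists>(U :: (((int \<times> int) \<times> nat set) \<times> int \<times> int \<times> int) set) W h.
     signed_kernels U W h m (real t) \<and> real (card U) \<le> real B * 128 ^ m)"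
proof -
  obtain e :: nat where e: "e > 0" and ex: "\<forall>N>0. \<exists>g. (\<forall>i<e. bij_betw (g i) (torus N) (torus N)) \<and>
    (\<forall>f::int \<times> int \<Rightarrow> real. (\<Sum>x\<in>torus N. f x) = 0 \<longrightarrow>
      (\<Sum>x\<in>torus N. (\<Sum>i<e. f (g i x))\<^sup>2) \<le> (1/200 * real e)\<^sup>2 * (\<Sum>x\<in>torus N. (f x)\<^sup>2))"
    using torus_expander_family[of "1/200"] by auto
  obtain p :: nat where p: "prime p" "p > 16 * (e * e) + 100" using bigger_prime by blast
  define q where "q = int p"
  have "16 * (e * e) < p" using p by simp
  then have "int (16 * (e * e)) < int p" by (simp only: of_nat_less_iff)
  then have q: "prime q" "16 * int (e * e) < q" "100 \<le> q" using p unfolding q_def by auto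
  have t0: "0 < 4 * p\<^sup>2 * e\<^sup>2" using e p by (simp add: prime_gt_0_nat)
  have "\<exists>(U :: (((int \<times> int) \<times> nat set) \<times> int \<times> int \<times> int) set) W h.
     signed_kernels U W h m (real (4 * p\<^sup>2 * e\<^sup>2)) \<and> real (card U) \<le> real (p ^ 3) * 128 ^ m" for m
  proof -
    define N where "N = int (8 ^ m)"
    have N: "N > 0" by (simp add: N_def)
    obtain g where g: "\<And>i. i < e \<Longrightarrow> bij_betw (g i) (torus N) (torus N)"
      and c: "\<And>f::int \<times> int \<Rightarrow> real. (\<Sum>x\<in>torus N. f x) = 0 \<Longrightarrow>
      (\<Sum>x\<in>torus N. (\<Sum>i<e. f (g i x))\<^sup>2) \<le> (1/200 * real e)\<^sup>2 * (\<Sum>x\<in>torus N. (f x)\<^sup>2)"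
      using ex N by blast
    have "card {0..<N} = card ({..<m} \<rightarrow>\<^sub>E {..<8::nat})" by (simp add: N_def card_PiE nat_power_eq)
    then obtain \<phi> where phi: "bij_betw \<phi> {0..<N} ({..<m} \<rightarrow>\<^sub>E {..<8::nat})"
      using finite_same_card_bij[of "{0..<N}" "{..<m} \<rightarrow>\<^sub>E {..<8::nat}"] by (auto simp: finite_PiE)
    interpret mixing_clones "torus N" m "\<lambda>x. \<phi> (fst x)" "real_of_int N" e g "1/200" q
    proof unfold_locales
      show "torus N \<noteq> {}" using N by (auto simp: torus_def)
      fix H :: "(nat \<Rightarrow> nat) \<Rightarrow> real"
      have "(\<Sum>x\<in>torus N. H (\<phi> (fst x))) = (\<Sum>x\<in>{0..<N}. \<Sum>y\<in>{0..<N}. H (\<phi> x))"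
        unfolding torus_def sum.cartesian_product by (simp add: case_prod_beta)
      also have "\<dots> = of_int N * (\<Sum>x\<in>{0..<N}. H (\<phi> x))" using N by (simp add: sum_distrib_left)
      also have "(\<Sum>x\<in>{0..<N}. H (\<phi> x)) = (\<Sum>d\<in>{..<m} \<rightarrow>\<^sub>E {..<8}. H d)"
        by (rule sum.reindex_bij_betw[OF phi])
      finally show "(\<Sum>x\<in>torus N. H (\<phi> (fst x))) = of_int N * (\<Sum>d\<in>{..<m} \<rightarrow>\<^sub>E {..<8}. H d)" .
    qed (use g c e q in auto)
    have "real (card (torus N)) = 64 ^ m"
      by (simp add: torus_def card_cartesian_product N_def nat_power_eq flip: power_mult_distrib)
    then have "real (card kernel_vertices) = real (p ^ 3) * 128 ^ m"
      unfolding card_kernel_vertices by (simp add: q_def flip: power_mult_distrib)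
    then have "real (card kernel_vertices) \<le> real (p ^ 3) * 128 ^ m" by simp
    moreover have "4 * (of_int q)\<^sup>2 * (real e)\<^sup>2 = real (4 * p\<^sup>2 * e\<^sup>2)" by (simp add: q_def)
    ultimately show ?thesis using signed_kernels by metis
  qed
  then show ?thesis using t0 by blast
qed

section \<open>From a symmetric relation to a graph on natural numbers\<close>

text \<open>
  If \<open>S\<close> is closed under adjacency, so is its complement, and the mean-zero function that is constant on each of the two satisfies
  \<open>form f = (\<Sum>v. degree v * (f v)\<^sup>2)\<close>. As all degrees exceed \<open>lam\<close>, this contradicts the bound on the form.
\<close>
lemma connected_by_form:
  fixes V :: "'v set" and R :: "'v \<Rightarrow> 'v \<Rightarrow> bool"
  assumes fin: "finite V" and sym: "\<And>v w. R v w \<longleftrightarrow> R w v"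
    and deg: "\<And>v. v \<in> V \<Longrightarrow> lam < real (card {w \<in> V. R v w})"
    and form: "\<And>f. (\<Sum>v\<in>V. f v) = 0 \<Longrightarrow> (\<Sum>v\<in>V. \<Sum>w\<in>V. of_bool (R v w) * f v * f w) \<le> lam * (\<Sum>v\<in>V. (f v)\<^sup>2)"
    and S: "S \<subseteq> V" "S \<noteq> {}" and closed: "\<And>v w. v \<in> S \<Longrightarrow> w \<in> V \<Longrightarrow> R v w \<Longrightarrow> w \<in> S"
  shows "S = V"
proof (rule ccontr)
  assume "S \<noteq> V"
  then have D: "V - S \<noteq> {}" using S by auto
  have finS: "finite S" "finite (V - S)" using S fin finite_subset by auto
  define f :: "'v \<Rightarrow> real" where "f v = (if v \<in> S then 1 / real (card S) else - 1 / real (card (V - S)))" for v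
  have pos: "card S > 0" "card (V - S) > 0" using finS S D by (auto simp: card_gt_0_iff)
  have V: "V = S \<union> (V - S)" using S by auto
  have "(\<Sum>v\<in>V. f v) = (\<Sum>v\<in>S. f v) + (\<Sum>v\<in>V - S. f v)"
    by (subst V) (rule sum.union_disjoint, use finS in auto)
  also have "(\<Sum>v\<in>S. f v) = 1" using pos by (simp add: f_def)
  also have "(\<Sum>v\<in>V - S. f v) = -1" using pos by (simp add: f_def)
  finally have zero: "(\<Sum>v\<in>V. f v) = 0" by simp
  have same: "of_bool (R v w) * f v * f w = of_bool (R v w) * (f v)\<^sup>2" if "v \<in> V" "w \<in> V" for v w
  proof (cases "R v w")
    case True
    then have "v \<in> S \<longleftrightarrow> w \<in> S" using closed sym that by metis
    then show ?thesis by (simp add: f_def power2_eq_square)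
  qed simp
  have "(\<Sum>v\<in>V. \<Sum>w\<in>V. of_bool (R v w) * f v * f w) = (\<Sum>v\<in>V. (f v)\<^sup>2 * real (card {w \<in> V. R v w}))"
  proof (rule sum.cong[OF refl])
    fix v assume v: "v \<in> V"
    have "(\<Sum>w\<in>V. of_bool (R v w) * f v * f w) = (\<Sum>w\<in>V. (f v)\<^sup>2 * of_bool (R v w))"
      by (rule sum.cong[OF refl]) (subst same[OF v], assumption, rule mult.commute)
    also have "\<dots> = (f v)\<^sup>2 * (\<Sum>w\<in>V. of_bool (R v w))" by (rule sum_distrib_left[symmetric])
    also have "(\<Sum>w\<in>V. of_bool (R v w) :: real) = real (card {w \<in> V. R v w})"
      using fin by (simp add: Int_def)
    finally show "(\<Sum>w\<in>V. of_bool (R v w) * f v * f w) = (f v)\<^sup>2 * real (card {w \<in> V. R v w})" .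
  qed
  moreover have "(\<Sum>v\<in>V. (f v)\<^sup>2 * real (card {w \<in> V. R v w})) > (\<Sum>v\<in>V. (f v)\<^sup>2 * lam)"
  proof (rule sum_strict_mono)
    show "finite V" "V \<noteq> {}" using fin S by auto
    fix v assume "v \<in> V"
    moreover have "f v \<noteq> 0" using pos by (simp add: f_def)
    ultimately show "(f v)\<^sup>2 * lam < (f v)\<^sup>2 * real (card {w \<in> V. R v w})"
      using deg by simp
  qed
  moreover have "(\<Sum>v\<in>V. (f v)\<^sup>2 * lam) = lam * (\<Sum>v\<in>V. (f v)\<^sup>2)"
    by (simp add: sum_distrib_left mult.commute)
  ultimately show False using form[OF zero] by simp
qed

text \<open>
  The relation is transported along an enumeration of \<open>V\<close>. Connectedness follows by applying \<open>connected_by_form\<close> to the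
  set of vertices that are reachable from a given one.
\<close>
lemma graph_realization:
  fixes V :: "'v set" and R :: "'v \<Rightarrow> 'v \<Rightarrow> bool" and x :: "nat \<Rightarrow> 'v \<Rightarrow> real"
  assumes fin: "finite V" and ne: "V \<noteq> {}"
    and sym: "\<And>v w. R v w \<longleftrightarrow> R w v" and irrefl: "\<And>v. v \<in> V \<Longrightarrow> \<not> R v v"
    and deg: "\<And>v. v \<in> V \<Longrightarrow> lam < real (card {w \<in> V. R v w})" "\<And>v. v \<in> V \<Longrightarrow> card {w \<in> V. R v w} \<le> \<Delta>"
    and form: "\<And>f. (\<Sum>v\<in>V. f v) = 0 \<Longrightarrow> (\<Sum>v\<in>V. \<Sum>w\<in>V. of_bool (R v w) * f v * f w) \<le> lam * (\<Sum>v\<in>V. (f v)\<^sup>2)"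
    and ev: "\<And>j v. j < m \<Longrightarrow> v \<in> V \<Longrightarrow> (\<Sum>w\<in>V. of_bool (R v w) * x j w) = lam * x j v"
    and orth: "\<And>i j. i < m \<Longrightarrow> j < m \<Longrightarrow> i \<noteq> j \<Longrightarrow> (\<Sum>v\<in>V. x i v * x j v) = 0"
    and nz: "\<And>j. j < m \<Longrightarrow> (\<Sum>v\<in>V. x j v * x j v) \<noteq> 0"
    and m: "m \<ge> 2"
  shows "\<exists>G. graph_on (card V) G \<and> Digraph_Component.connected (with_proj G) \<and> max_degree_le G \<Delta> \<and>
    second_eigenvalue (adj_matrix G) = lam \<and> m \<le> eigenvalue_multiplicity (adj_matrix G) lam"
proof -
  define n where "n = card V"
  obtain \<psi> where "bij_betw \<psi> {0..<n} V" using ex_bij_betw_nat_finite[OF fin] unfolding n_def by blast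
  then have psi: "bij_betw \<psi> {..<n} V" by (simp add: atLeast0LessThan)
  define G where "G = \<lparr>pverts = {0..<n}, parcs = {(i, j). i < n \<and> j < n \<and> R (\<psi> i) (\<psi> j)}\<rparr>"
  have pv: "pverts G = {0..<n}" and pa: "parcs G = {(i, j). i < n \<and> j < n \<and> R (\<psi> i) (\<psi> j)}"
    by (simp_all add: G_def)
  have psiV: "\<psi> i \<in> V" if "i < n" for i using psi that by (auto simp: bij_betw_def)
  have S: "(\<Sum>i<n. p (\<psi> i)) = (\<Sum>v\<in>V. p v)" for p :: "'v \<Rightarrow> real"
    by (rule sum.reindex_bij_betw[OF psi])
  interpret G: pair_graph G
  proof
    show "finite (parcs G)"
      by (rule finite_subset[of _ "{0..<n} \<times> {0..<n}"]) (auto simp: pa)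
    show "symmetric (with_proj G)"
      unfolding symmetric_def using sym by (auto simp: pa intro!: symI)
  qed (use irrefl psiV in \<open>auto simp: pv pa\<close>)
  have gon: "graph_on (card V) G" unfolding graph_on_def n_def[symmetric] using pv G.pair_graph_axioms by simp
  have nbrs: "bij_betw \<psi> {j. j < n \<and> R v (\<psi> j)} {w \<in> V. R v w}" for v
    using psi unfolding bij_betw_def inj_on_def by auto
  have md: "max_degree_le G \<Delta>"
    unfolding max_degree_le_def
  proof
    fix i assume "i \<in> pverts G"
    then have i: "i < n" by (simp add: pv)
    have "out_arcs (with_proj G) i = Pair i ` {j. j < n \<and> R (\<psi> i) (\<psi> j)}"
      using i by (auto simp: out_arcs_def pa)
    then have "out_degree (with_proj G) i = card {j. j < n \<and> R (\<psi> i) (\<psi> j)}"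
      unfolding out_degree_def by (simp add: card_image inj_on_def)
    also have "\<dots> = card {w \<in> V. R (\<psi> i) w}" by (rule bij_betw_same_card[OF nbrs])
    also have "\<dots> \<le> \<Delta>" by (rule deg(2)[OF psiV[OF i]])
    finally show "out_degree (with_proj G) i \<le> \<Delta>" .
  qed
  have conn: "Digraph_Component.connected (with_proj G)"
    unfolding connected_def
  proof (rule strongly_connectedI)
    show "verts (with_proj (mk_symmetric (with_proj G))) \<noteq> {}"
      using fin ne by (simp add: pv n_def card_gt_0_iff)
    fix i j assume "i \<in> verts (with_proj (mk_symmetric (with_proj G)))" "j \<in> verts (with_proj (mk_symmetric (with_proj G)))"
    then have ij: "i < n" "j < n" by (auto simp: pv)
    let ?S = "\<psi> ` {k. k < n \<and> i \<rightarrow>\<^sup>*\<^bsub>with_proj G\<^esub> k}"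
    have "?S = V"
    proof (rule connected_by_form[OF fin sym deg(1) form])
      show "?S \<subseteq> V" using psiV by auto
      have "i \<rightarrow>\<^sup>*\<^bsub>with_proj G\<^esub> i" using ij by (intro G.reachable_refl) (simp add: pv)
      then show "?S \<noteq> {}" using ij by auto
      fix v w assume v: "v \<in> ?S" and w: "w \<in> V" "R v w"
      from v obtain k where k: "k < n" "i \<rightarrow>\<^sup>*\<^bsub>with_proj G\<^esub> k" "v = \<psi> k" by auto
      obtain l where l: "l < n" "w = \<psi> l" using psi w by (auto simp: bij_betw_def)
      have "(k, l) \<in> parcs G" using k l w by (simp add: pa)
      then have "i \<rightarrow>\<^sup>*\<^bsub>with_proj G\<^esub> l" by (intro G.reachable_adj_trans[OF k(2)]) simp
      then show "w \<in> ?S" using l by auto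
    qed
    then have "\<psi> j \<in> ?S" using psiV ij by simp
    then have "i \<rightarrow>\<^sup>*\<^bsub>with_proj G\<^esub> j" using psi ij by (auto simp: bij_betw_def inj_on_def)
    then show "i \<rightarrow>\<^sup>*\<^bsub>with_proj (mk_symmetric (with_proj G))\<^esub> j"
      by (rule G.reachable_mk_symmetricI)
  qed
  let ?A = "adj_matrix G"
  have A: "?A \<in> carrier_mat n n" by (simp add: adj_matrix_def pv)
  have Aij: "?A $$ (i, j) = of_bool (R (\<psi> i) (\<psi> j))" if "i < n" "j < n" for i j
    using that by (simp add: adj_matrix_def pv pa)
  note crit = second_eigenvalue_by_form[OF A, where h = "\<lambda>j i. x j (\<psi> i)" and m = m and lam = lam]
  have 1: "?A $$ (i, j) = ?A $$ (j, i)" if "i < n" "j < n" for i j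
    using that sym by (simp add: Aij)
  have 2: "(\<Sum>i<n. \<Sum>j<n. ?A $$ (i, j) * f i * f j) \<le> lam * (\<Sum>i<n. (f i)\<^sup>2)" if z: "(\<Sum>i<n. f i) = 0" for f
  proof -
    define f' where "f' = f \<circ> inv_into {..<n} \<psi>"
    have f': "f' (\<psi> i) = f i" if "i < n" for i
      using psi that by (simp add: f'_def bij_betw_inv_into_left)
    have "(\<Sum>v\<in>V. f' v) = (\<Sum>i<n. f i)" unfolding S[symmetric] by (rule sum.cong) (auto simp: f')
    then have "(\<Sum>v\<in>V. \<Sum>w\<in>V. of_bool (R v w) * f' v * f' w) \<le> lam * (\<Sum>v\<in>V. (f' v)\<^sup>2)"
      using z by (intro form) simp
    moreover have "(\<Sum>v\<in>V. \<Sum>w\<in>V. of_bool (R v w) * f' v * f' w) = (\<Sum>i<n. \<Sum>j<n. ?A $$ (i, j) * f i * f j)"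
      unfolding S[symmetric] by (intro sum.cong refl) (simp add: Aij f')
    moreover have "(\<Sum>v\<in>V. (f' v)\<^sup>2) = (\<Sum>i<n. (f i)\<^sup>2)"
      unfolding S[symmetric] by (intro sum.cong refl) (simp add: f')
    ultimately show ?thesis by simp
  qed
  have 3: "(\<Sum>k<n. ?A $$ (i, k) * x j (\<psi> k)) = lam * x j (\<psi> i)" if "j < m" "i < n" for j i
  proof -
    have "(\<Sum>k<n. ?A $$ (i, k) * x j (\<psi> k)) = (\<Sum>k<n. of_bool (R (\<psi> i) (\<psi> k)) * x j (\<psi> k))"
      by (rule sum.cong[OF refl]) (use that in \<open>simp only: lessThan_iff Aij\<close>)
    also have "\<dots> = (\<Sum>w\<in>V. of_bool (R (\<psi> i) w) * x j w)" by (rule S)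
    finally show ?thesis using ev[OF that(1) psiV[OF that(2)]] by simp
  qed
  have 4: "(\<Sum>k<n. x i (\<psi> k) * x j (\<psi> k)) = (\<Sum>v\<in>V. x i v * x j v)" for i j
    by (rule S)
  have "second_eigenvalue ?A = lam"
    by (rule crit(1)) (use 1 2 3 orth nz m in \<open>simp_all only: 4 not_False_eq_True\<close>)
  moreover have "m \<le> eigenvalue_multiplicity ?A lam"
    by (rule crit(2)) (use 1 2 3 orth nz m in \<open>simp_all only: 4 not_False_eq_True\<close>)
  ultimately show ?thesis using gon conn md by blast
qed

section \<open>Splitting off constants and characters\<close>

context signed_kernels
begin

definition mean :: "('u \<Rightarrow> real) \<Rightarrow> real" where
  "mean f = (\<Sum>u\<in>U. f u) / real (card U)"

definition coef :: "nat \<Rightarrow> ('u \<Rightarrow> real) \<Rightarrow> real" where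
  "coef j f = (\<Sum>u\<in>U. h j u * f u) / real (card U)"

text \<open>
  The component orthogonal to the constants and to all \<open>h j\<close>; recall that every \<open>h j\<close> has squared norm \<open>card U\<close>.
\<close>
definition rest :: "('u \<Rightarrow> real) \<Rightarrow> 'u \<Rightarrow> real" where
  "rest f u = f u - mean f - (\<Sum>j<m. coef j f * h j u)"

definition bil :: "int \<Rightarrow> ('u \<Rightarrow> real) \<Rightarrow> ('u \<Rightarrow> real) \<Rightarrow> real" where
  "bil s f g = (\<Sum>u\<in>U. \<Sum>u'\<in>U. of_bool (W s u u') * f u * g u')"

lemma card_U_pos [simp]: "card U > 0"
  using U_nonempty by (simp add: card_gt_0_iff)

lemma mean_sum: "(\<Sum>u\<in>U. f u) = real (card U) * mean f"
  and coef_sum: "(\<Sum>u\<in>U. h j u * f u) = real (card U) * coef j f"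
  unfolding mean_def coef_def using card_U_pos by simp_all

lemma bil_commute: "bil s f g = bil s g f"
proof -
  have "bil s f g = (\<Sum>u'\<in>U. \<Sum>u\<in>U. of_bool (W s u u') * f u * g u')"
    unfolding bil_def by (rule sum.swap)
  also have "\<dots> = bil s g f"
    unfolding bil_def
    by (intro sum.cong[OF refl]) (subst W_sym, simp only: mult_ac)
  finally show ?thesis .
qed

lemma pairing_split:
  "(\<Sum>u\<in>U. f u * c u) = mean f * (\<Sum>u\<in>U. c u) + (\<Sum>j<m. coef j f * (\<Sum>u\<in>U. h j u * c u)) + (\<Sum>u\<in>U. rest f u * c u)"
proof -
  have "(\<Sum>u\<in>U. f u * c u) = (\<Sum>u\<in>U. mean f * c u + (\<Sum>j<m. coef j f * (h j u * c u)) + rest f u * c u)"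
  proof (rule sum.cong[OF refl])
    fix u
    have "(\<Sum>j<m. coef j f * (h j u * c u)) = (\<Sum>j<m. coef j f * h j u) * c u"
      unfolding sum_distrib_right by (simp only: mult.assoc)
    then show "f u * c u = mean f * c u + (\<Sum>j<m. coef j f * (h j u * c u)) + rest f u * c u"
      unfolding rest_def by (simp only: ring_distribs)
  qed
  also have "\<dots> = mean f * (\<Sum>u\<in>U. c u) + (\<Sum>u\<in>U. \<Sum>j<m. coef j f * (h j u * c u)) + (\<Sum>u\<in>U. rest f u * c u)"
    by (simp only: sum.distrib sum_distrib_left)
  also have "(\<Sum>u\<in>U. \<Sum>j<m. coef j f * (h j u * c u)) = (\<Sum>j<m. coef j f * (\<Sum>u\<in>U. h j u * c u))"
    unfolding sum_distrib_left by (rule sum.swap)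
  finally show ?thesis .
qed

lemma bil_row: "bil s f g = (\<Sum>u\<in>U. f u * (\<Sum>u'\<in>U. of_bool (W s u u') * g u'))"
  unfolding bil_def sum_distrib_left by (intro sum.cong[OF refl]) (simp only: mult_ac)

lemma bil_split_left:
  assumes s: "s \<in> {-1, 0, 1}"
  shows "bil s f g = mean f * (4 * \<theta> * (\<Sum>u\<in>U. g u)) + (\<Sum>j<m. coef j f * (of_int s * \<theta> * (\<Sum>u\<in>U. h j u * g u))) + bil s (rest f) g"
proof -
  have e: "(\<Sum>u\<in>U. h j u * (\<Sum>u'\<in>U. of_bool (W s u u') * g u')) = of_int s * \<theta> * (\<Sum>u\<in>U. h j u * g u)" if "j < m" for j
    using W_eigen[OF s that, of g] unfolding bil_row[of s "h j" g, symmetric] bil_def .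
  have "(\<Sum>j<m. coef j f * (\<Sum>u\<in>U. h j u * (\<Sum>u'\<in>U. of_bool (W s u u') * g u')))
    = (\<Sum>j<m. coef j f * (of_int s * \<theta> * (\<Sum>u\<in>U. h j u * g u)))"
    by (rule sum.cong[OF refl]) (simp only: lessThan_iff e)
  then show ?thesis
    unfolding bil_row by (subst pairing_split) (simp only: W_const[OF s])
qed

lemma sum_rest: "(\<Sum>u\<in>U. rest f u) = 0"
proof -
  have "(\<Sum>u\<in>U. f u) = mean f * real (card U) + (\<Sum>j<m. coef j f * (\<Sum>u\<in>U. h j u)) + (\<Sum>u\<in>U. rest f u)"
    using pairing_split[of f "\<lambda>_. 1"] by simp
  also have "(\<Sum>j<m. coef j f * (\<Sum>u\<in>U. h j u)) = 0" by (rule sum.neutral) (simp add: h_sum)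
  finally show ?thesis unfolding mean_sum[of f] by simp
qed

lemma rest_orthogonal:
  assumes j: "j < m"
  shows "(\<Sum>u\<in>U. h j u * rest f u) = 0"
proof -
  have "(\<Sum>i<m. coef i f * (\<Sum>u\<in>U. h i u * h j u)) = (\<Sum>i<m. if i = j then coef j f * real (card U) else 0)"
    by (rule sum.cong[OF refl]) (use h_orth[OF _ j] in \<open>auto simp: h_square\<close>)
  also have "\<dots> = (\<Sum>u\<in>U. h j u * f u)" unfolding coef_sum using j by simp
  also have "\<dots> = (\<Sum>u\<in>U. f u * h j u)" by (simp only: mult.commute)
  finally have "(\<Sum>u\<in>U. rest f u * h j u) = 0"
    using pairing_split[of f "h j"] h_sum[OF j] by simp
  then show ?thesis by (simp only: mult.commute)
qed

lemma inner_split: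
  "(\<Sum>u\<in>U. f u * g u) = real (card U) * (mean f * mean g) + real (card U) * (\<Sum>j<m. coef j f * coef j g) + (\<Sum>u\<in>U. rest f u * rest g u)"
proof -
  have z: "(\<Sum>j<m. coef j g * (\<Sum>u\<in>U. h j u * rest f u)) = 0"
    by (rule sum.neutral) (simp add: rest_orthogonal)
  have "(\<Sum>u\<in>U. rest f u * g u) = (\<Sum>u\<in>U. g u * rest f u)" by (simp only: mult.commute)
  also have "\<dots> = (\<Sum>u\<in>U. rest g u * rest f u)" by (subst pairing_split) (simp only: z sum_rest mult_zero_right add_0_left)
  finally have "(\<Sum>u\<in>U. rest f u * g u) = (\<Sum>u\<in>U. rest f u * rest g u)" by (simp only: mult.commute)
  then show ?thesis
    by (subst pairing_split, simp only: mean_sum[of g] coef_sum[of _ g])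
      (simp only: sum_distrib_left mult_ac)
qed

text \<open>
  The three components of a function are mutually orthogonal and invariant under each \<open>W s\<close>, so the form is diagonal in them.
\<close>
lemma bil_split:
  assumes s: "s \<in> {-1, 0, 1}"
  shows "bil s f g = real (card U) * (4 * \<theta> * (mean f * mean g))
    + real (card U) * (\<Sum>j<m. of_int s * \<theta> * (coef j f * coef j g)) + bil s (rest f) (rest g)"
proof -
  have z: "(\<Sum>j<m. coef j g * (of_int s * \<theta> * (\<Sum>u\<in>U. h j u * rest f u))) = 0"
    by (rule sum.neutral) (simp add: rest_orthogonal)
  have "bil s (rest f) g = bil s g (rest f)" by (rule bil_commute)
  also have "\<dots> = bil s (rest g) (rest f)" by (subst bil_split_left[OF s]) (simp only: z sum_rest mult_zero_right add_0_left)
  also have "\<dots> = bil s (rest f) (rest g)" by (rule bil_commute)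
  finally have r: "bil s (rest f) g = bil s (rest f) (rest g)" .
  show ?thesis
    unfolding bil_split_left[OF s, of f g] r mean_sum[of g] coef_sum[of _ g]
    by (simp only: sum_distrib_left mult_ac)
qed

lemma bil_rest_bound:
  assumes s: "s \<in> {-1, 0, 1}"
  shows "\<bar>bil s (rest f) (rest g)\<bar> \<le> 7/20 * \<theta> * (L2_set (rest f) U * L2_set (rest g) U)"
  unfolding bil_def
  by (rule W_bound[OF s sum_rest]) (use rest_orthogonal in \<open>simp add: mult.commute\<close>)

text \<open>
  The eigenvector equation is recovered from the bilinear identity by testing it with a point mass.
\<close>
lemma W_row_eigen:
  assumes s: "s \<in> {-1, 0, 1}" and j: "j < m" and u: "u \<in> U"
  shows "(\<Sum>u'\<in>U. of_bool (W s u u') * h j u') = of_int s * \<theta> * h j u"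
proof -
  let ?d = "\<lambda>u'. if u' = u then 1 else 0 :: real"
  have "bil s ?d (h j) = of_int s * \<theta> * (\<Sum>u'\<in>U. h j u' * ?d u')"
    unfolding bil_commute[of s ?d] using W_eigen[OF s j, of ?d] unfolding bil_def .
  moreover have "(\<Sum>u'\<in>U. h j u' * ?d u') = h j u" using u by (simp add: if_distrib cong: if_cong)
  moreover have "bil s ?d (h j) = (\<Sum>u'\<in>U. of_bool (W s u u') * h j u')"
  proof -
    have "bil s ?d (h j) = (\<Sum>v\<in>U. if v = u then \<Sum>u'\<in>U. of_bool (W s v u') * h j u' else 0)"
      unfolding bil_row by (rule sum.cong[OF refl]) (simp only: if_split, simp)
    then show ?thesis using u by simp
  qed
  ultimately show ?thesis by simp
qed

lemma W_row_sum:
  assumes s: "s \<in> {-1, 0, 1}" and u: "u \<in> U"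
  shows "(\<Sum>u'\<in>U. of_bool (W s u u')) = 4 * \<theta>"
proof -
  let ?d = "\<lambda>u'. if u' = u then 1 else 0 :: real"
  have "bil s ?d (\<lambda>_. 1) = 4 * \<theta> * (\<Sum>u'\<in>U. ?d u')"
    unfolding bil_commute[of s ?d] using W_const[OF s, of ?d] unfolding bil_def mult_1_right .
  moreover have "(\<Sum>u'\<in>U. ?d u') = 1" using u by simp
  moreover have "bil s ?d (\<lambda>_. 1) = (\<Sum>u'\<in>U. of_bool (W s u u'))"
  proof -
    have "bil s ?d (\<lambda>_. 1) = (\<Sum>v\<in>U. if v = u then \<Sum>u'\<in>U. of_bool (W s v u') * 1 else 0)"
      unfolding bil_row by (rule sum.cong[OF refl]) (simp only: if_split, simp)
    then show ?thesis using u by (simp del: sum_of_bool_eq)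
  qed
  ultimately show ?thesis by simp
qed

lemma card_U_ge_2:
  assumes "m > 0"
  shows "card U \<ge> 2"
proof (rule ccontr)
  assume "\<not> card U \<ge> 2"
  then have "card U = 1" using card_U_pos by linarith
  then obtain u where "U = {u}" by (rule card_1_singletonE)
  then have "h 0 u = 0" using h_sum[OF assms] by simp
  then show False using h_square[of 0 u] by simp
qed

end

section \<open>Gluing copies of the kernels along a pattern\<close>

text \<open>
  \<open>H_form\<close> bounds the constant and the remaining components, \<open>HN_form\<close> the components along the \<open>h j\<close>, and
  \<open>y\<close> is an eigenvector showing that the latter bound is attained. The conditions \<open>gap\<close> and \<open>top\<close> place \<open>lam\<close> between the
  bound for the remaining component and the degrees.
\<close>
locale pattern =
  fixes I :: "'a set" and H :: "'a \<Rightarrow> 'a \<Rightarrow> bool" and N :: "'a \<Rightarrow> 'a \<Rightarrow> int"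
    and y :: "'a \<Rightarrow> real" and \<theta> \<mu> lam :: real
  assumes finI [simp]: "finite I" and I_nonempty: "I \<noteq> {}"
    and H_sym: "\<And>a b. H a b \<longleftrightarrow> H b a" and H_irrefl: "\<And>a. \<not> H a a"
    and N_sym: "\<And>a b. N a b = N b a" and N_sign: "\<And>a b. N a b \<in> {-1, 0, 1}"
    and H_form: "\<And>x. (\<Sum>a\<in>I. \<Sum>b\<in>I. of_bool (H a b) * (x a * x b)) \<le> \<mu> * (\<Sum>a\<in>I. (x a)\<^sup>2)"
    and HN_form: "\<And>x. (\<Sum>a\<in>I. \<Sum>b\<in>I. (of_bool (H a b) + \<theta> * of_int (N a b)) * (x a * x b)) \<le> lam * (\<Sum>a\<in>I. (x a)\<^sup>2)"
    and HN_eigen: "\<And>a. a \<in> I \<Longrightarrow> (\<Sum>b\<in>I. (of_bool (H a b) + \<theta> * of_int (N a b)) * y b) = lam * y a"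
    and y_nonzero: "(\<Sum>a\<in>I. (y a)\<^sup>2) \<noteq> 0"
    and gap: "\<mu> + 7/20 * \<theta> * real (card I) \<le> lam" and top: "lam < 4 * \<theta> * real (card I)"

locale patterned_kernels = pattern I H N y \<theta> \<mu> lam + signed_kernels U W h m \<theta>
  for I :: "'a set" and H N y \<theta> \<mu> lam and U :: "'u set" and W h m
begin

definition joined :: "'u \<times> 'a \<Rightarrow> 'u \<times> 'a \<Rightarrow> bool" where
  "joined v w \<longleftrightarrow> fst v = fst w \<and> H (snd v) (snd w) \<or> W (N (snd v) (snd w)) (fst v) (fst w)"

lemma of_bool_joined:
  assumes "u \<in> U"
  shows "(of_bool (joined (u, a) (u', b)) :: real) = of_bool (u' = u) * of_bool (H a b) + of_bool (W (N a b) u u')"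
  using W_irrefl[OF assms, of "N a b"] by (cases "u' = u"; cases "W (N a b) u u'") (auto simp: joined_def)

lemma joined_sum:
  fixes f :: "'u \<times> 'a \<Rightarrow> real"
  assumes "u \<in> U"
  shows "(\<Sum>w\<in>U \<times> I. of_bool (joined (u, a) w) * f w)
    = (\<Sum>b\<in>I. of_bool (H a b) * f (u, b)) + (\<Sum>b\<in>I. \<Sum>u'\<in>U. of_bool (W (N a b) u u') * f (u', b))"
proof -
  have "(\<Sum>w\<in>U \<times> I. of_bool (joined (u, a) w) * f w) = (\<Sum>u'\<in>U. \<Sum>b\<in>I. of_bool (joined (u, a) (u', b)) * f (u', b))"
    unfolding sum.cartesian_product by (rule sum.cong) auto
  also have "\<dots> = (\<Sum>b\<in>I. \<Sum>u'\<in>U. of_bool (joined (u, a) (u', b)) * f (u', b))" by (rule sum.swap)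
  also have "\<dots> = (\<Sum>b\<in>I. of_bool (H a b) * f (u, b) + (\<Sum>u'\<in>U. of_bool (W (N a b) u u') * f (u', b)))"
  proof (rule sum.cong[OF refl])
    fix b
    have "(\<Sum>u'\<in>U. of_bool (joined (u, a) (u', b)) * f (u', b))
      = (\<Sum>u'\<in>U. (if u' = u then of_bool (H a b) * f (u, b) else 0) + of_bool (W (N a b) u u') * f (u', b))"
      unfolding of_bool_joined[OF assms] distrib_right
      by (rule sum.cong[OF refl], rename_tac u', case_tac "u' = u") simp_all
    also have "\<dots> = of_bool (H a b) * f (u, b) + (\<Sum>u'\<in>U. of_bool (W (N a b) u u') * f (u', b))"
      unfolding sum.distrib using assms by (simp del: sum_mult_of_bool_eq sum_of_bool_mult_eq)
    finally show "(\<Sum>u'\<in>U. of_bool (joined (u, a) (u', b)) * f (u', b))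
      = of_bool (H a b) * f (u, b) + (\<Sum>u'\<in>U. of_bool (W (N a b) u u') * f (u', b))" .
  qed
  finally show ?thesis by (simp only: sum.distrib)
qed

lemma joined_degree:
  assumes "v \<in> U \<times> I"
  shows "lam < real (card {w \<in> U \<times> I. joined v w})" "real (card {w \<in> U \<times> I. joined v w}) \<le> (4 * \<theta> + 1) * real (card I)"
proof -
  obtain u a where v: "v = (u, a)" "u \<in> U" "a \<in> I" using assms by auto
  have "real (card {w \<in> U \<times> I. joined v w}) = (\<Sum>w\<in>U \<times> I. of_bool (joined v w) * 1)"
    by (simp add: Int_def)
  also have "\<dots> = (\<Sum>b\<in>I. of_bool (H a b) * 1) + (\<Sum>b\<in>I. \<Sum>u'\<in>U. of_bool (W (N a b) u u') * 1)"
    unfolding v(1) by (rule joined_sum[OF v(2)])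
  also have "(\<Sum>b\<in>I. \<Sum>u'\<in>U. of_bool (W (N a b) u u') * 1) = (\<Sum>b\<in>I. 4 * \<theta>)"
    unfolding mult_1_right by (rule sum.cong[OF refl]) (rule W_row_sum[OF N_sign v(2)])
  finally have d: "real (card {w \<in> U \<times> I. joined v w}) = (\<Sum>b\<in>I. of_bool (H a b) * 1) + 4 * \<theta> * real (card I)"
    by simp
  have "0 \<le> (\<Sum>b\<in>I. of_bool (H a b) * 1 :: real)" by (rule sum_nonneg) simp
  then show "lam < real (card {w \<in> U \<times> I. joined v w})" using d top by linarith
  have "(\<Sum>b\<in>I. of_bool (H a b) * 1 :: real) \<le> (\<Sum>b\<in>I. 1)" by (rule sum_mono) simp
  then show "real (card {w \<in> U \<times> I. joined v w}) \<le> (4 * \<theta> + 1) * real (card I)"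
    unfolding d by (simp add: distrib_right)
qed

lemma joined_eigenvector:
  assumes j: "j < m" and v: "v \<in> U \<times> I"
  shows "(\<Sum>w\<in>U \<times> I. of_bool (joined v w) * (h j (fst w) * y (snd w))) = lam * (h j (fst v) * y (snd v))"
proof -
  obtain u a where ua: "v = (u, a)" "u \<in> U" "a \<in> I" using v by auto
  have "(\<Sum>w\<in>U \<times> I. of_bool (joined v w) * (h j (fst w) * y (snd w)))
    = (\<Sum>b\<in>I. of_bool (H a b) * (h j u * y b)) + (\<Sum>b\<in>I. \<Sum>u'\<in>U. of_bool (W (N a b) u u') * (h j u' * y b))"
    unfolding ua(1) by (subst joined_sum[OF ua(2)]) (simp only: fst_conv snd_conv)
  also have "(\<Sum>b\<in>I. \<Sum>u'\<in>U. of_bool (W (N a b) u u') * (h j u' * y b)) = (\<Sum>b\<in>I. of_int (N a b) * \<theta> * h j u * y b)"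
    by (rule sum.cong[OF refl]) (simp only: mult.assoc[symmetric] sum_distrib_right[symmetric] W_row_eigen[OF N_sign j ua(2)])
  also have "(\<Sum>b\<in>I. of_bool (H a b) * (h j u * y b)) + \<dots> = h j u * (\<Sum>b\<in>I. (of_bool (H a b) + \<theta> * of_int (N a b)) * y b)"
    unfolding sum_distrib_left sum.distrib[symmetric]
    by (rule sum.cong[OF refl]) (simp only: ring_distribs mult_ac)
  also have "\<dots> = lam * (h j (fst v) * y (snd v))"
    unfolding HN_eigen[OF ua(3)] ua(1) by simp
  finally show ?thesis .
qed

text \<open>
  On the slices \<open>F (\<cdot>, a)\<close> the form splits into contributions of means, coefficients and remainders. The means add up to zero
  over \<open>a\<close>, which kills the large term \<open>4 * \<theta> * J\<close>; this is the only use of the mean-zero hypothesis.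
\<close>
lemma joined_form:
  assumes zero: "(\<Sum>v\<in>U \<times> I. F v) = 0"
  shows "(\<Sum>v\<in>U \<times> I. \<Sum>w\<in>U \<times> I. of_bool (joined v w) * F v * F w) \<le> lam * (\<Sum>v\<in>U \<times> I. (F v)\<^sup>2)"
proof -
  define G where "G a u = F (u, a)" for a u
  define K where "K = real (card U)"
  define \<alpha> where "\<alpha> a = mean (G a)" for a
  define \<beta> where "\<beta> j a = coef j (G a)" for j a
  define r where "r a = rest (G a)" for a
  let ?q = "\<lambda>a. (L2_set (r a) U)\<^sup>2"
  have K0: "K > 0" unfolding K_def using card_U_pos by simp
  have split: "(\<Sum>v\<in>U \<times> I. p v) = (\<Sum>a\<in>I. \<Sum>u\<in>U. p (u, a))" for p :: "'u \<times> 'a \<Rightarrow> real"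
    by (subst sum.swap) (simp add: sum.cartesian_product case_prod_beta)
  have mu_le: "\<mu> \<le> lam"
  proof -
    have "0 \<le> 7/20 * \<theta> * real (card I)" using theta_pos by simp
    then show ?thesis using gap by linarith
  qed
  have "K * (\<Sum>a\<in>I. \<alpha> a) = (\<Sum>a\<in>I. \<Sum>u\<in>U. G a u)"
    unfolding sum_distrib_left \<alpha>_def K_def by (rule sum.cong[OF refl]) (rule mean_sum[symmetric])
  also have "\<dots> = 0" using zero unfolding split G_def .
  \<comment> \<open>The mean of \<open>F\<close> is the sum of the slice means.\<close>
  finally have a0: "(\<Sum>a\<in>I. \<alpha> a) = 0" using K0 by simp
  have pair: "(\<Sum>u\<in>U. G a u * G b u) = K * (\<alpha> a * \<alpha> b) + K * (\<Sum>j<m. \<beta> j a * \<beta> j b) + (\<Sum>u\<in>U. r a u * r b u)" for a b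
    unfolding K_def \<alpha>_def \<beta>_def r_def by (rule inner_split)
  have norm: "(\<Sum>v\<in>U \<times> I. (F v)\<^sup>2) = K * (\<Sum>a\<in>I. (\<alpha> a)\<^sup>2) + K * (\<Sum>j<m. \<Sum>a\<in>I. (\<beta> j a)\<^sup>2) + (\<Sum>a\<in>I. ?q a)"
  proof -
    have "(\<Sum>v\<in>U \<times> I. (F v)\<^sup>2) = (\<Sum>a\<in>I. \<Sum>u\<in>U. G a u * G a u)"
      unfolding split G_def power2_eq_square ..
    also have "\<dots> = (\<Sum>a\<in>I. K * (\<alpha> a)\<^sup>2 + K * (\<Sum>j<m. (\<beta> j a)\<^sup>2) + ?q a)"
      unfolding pair by (rule sum.cong[OF refl]) (simp add: L2_set_def sum_nonneg power2_eq_square)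
    also have "\<dots> = K * (\<Sum>a\<in>I. (\<alpha> a)\<^sup>2) + K * (\<Sum>a\<in>I. \<Sum>j<m. (\<beta> j a)\<^sup>2) + (\<Sum>a\<in>I. ?q a)"
      by (simp only: sum.distrib sum_distrib_left)
    finally show ?thesis by (subst sum.swap)
  qed
  have "(\<Sum>v\<in>U \<times> I. \<Sum>w\<in>U \<times> I. of_bool (joined v w) * F v * F w)
    = (\<Sum>a\<in>I. \<Sum>u\<in>U. F (u, a) * (\<Sum>w\<in>U \<times> I. of_bool (joined (u, a) w) * F w))"
    unfolding split[of "\<lambda>v. \<Sum>w\<in>U \<times> I. of_bool (joined v w) * F v * F w"] sum_distrib_left
    by (intro sum.cong[OF refl]) (simp only: mult_ac)
  also have "\<dots> = (\<Sum>a\<in>I. \<Sum>b\<in>I. of_bool (H a b) * (\<Sum>u\<in>U. G a u * G b u) + bil (N a b) (G a) (G b))"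
  proof (rule sum.cong[OF refl])
    fix a
    have "(\<Sum>u\<in>U. F (u, a) * (\<Sum>w\<in>U \<times> I. of_bool (joined (u, a) w) * F w))
      = (\<Sum>u\<in>U. \<Sum>b\<in>I. of_bool (H a b) * (G a u * G b u) + G a u * (\<Sum>u'\<in>U. of_bool (W (N a b) u u') * G b u'))"
    proof (rule sum.cong[OF refl])
      fix u assume u: "u \<in> U"
      show "F (u, a) * (\<Sum>w\<in>U \<times> I. of_bool (joined (u, a) w) * F w)
        = (\<Sum>b\<in>I. of_bool (H a b) * (G a u * G b u) + G a u * (\<Sum>u'\<in>U. of_bool (W (N a b) u u') * G b u'))"
        unfolding joined_sum[OF u] sum.distrib distrib_left sum_distrib_left G_def
        by (simp only: mult.left_commute)
    qed
    also have "\<dots> = (\<Sum>b\<in>I. \<Sum>u\<in>U. of_bool (H a b) * (G a u * G b u) + G a u * (\<Sum>u'\<in>U. of_bool (W (N a b) u u') * G b u'))"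
      by (rule sum.swap)
    also have "\<dots> = (\<Sum>b\<in>I. of_bool (H a b) * (\<Sum>u\<in>U. G a u * G b u) + bil (N a b) (G a) (G b))"
      unfolding sum.distrib bil_row sum_distrib_left ..
    finally show "(\<Sum>u\<in>U. F (u, a) * (\<Sum>w\<in>U \<times> I. of_bool (joined (u, a) w) * F w))
      = (\<Sum>b\<in>I. of_bool (H a b) * (\<Sum>u\<in>U. G a u * G b u) + bil (N a b) (G a) (G b))" .
  qed
  also have "\<dots> = (\<Sum>a\<in>I. \<Sum>b\<in>I. K * (of_bool (H a b) * (\<alpha> a * \<alpha> b)) + K * (4 * \<theta>) * (\<alpha> a * \<alpha> b)
      + (\<Sum>j<m. K * ((of_bool (H a b) + \<theta> * of_int (N a b)) * (\<beta> j a * \<beta> j b)))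
      + (\<Sum>u\<in>U. of_bool (H a b) * (r a u * r b u)) + bil (N a b) (r a) (r b))"
  proof (rule sum.cong[OF refl], rule sum.cong[OF refl])
    fix a b
    have b: "bil (N a b) (G a) (G b) = K * (4 * \<theta> * (\<alpha> a * \<alpha> b))
      + K * (\<Sum>j<m. of_int (N a b) * \<theta> * (\<beta> j a * \<beta> j b)) + bil (N a b) (r a) (r b)"
      unfolding K_def \<alpha>_def \<beta>_def r_def by (rule bil_split[OF N_sign])
    have "(\<Sum>j<m. K * ((of_bool (H a b) + \<theta> * of_int (N a b)) * (\<beta> j a * \<beta> j b)))
      = of_bool (H a b) * (K * (\<Sum>j<m. \<beta> j a * \<beta> j b)) + K * (\<Sum>j<m. of_int (N a b) * \<theta> * (\<beta> j a * \<beta> j b))"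
      unfolding sum_distrib_left sum.distrib[symmetric]
      by (rule sum.cong[OF refl]) (simp only: ring_distribs mult_ac)
    moreover have "X = c * (K * S) + K * T \<Longrightarrow>
      c * (K * p + K * S + R) + (K * (4 * \<theta> * p) + K * T + z) = K * (c * p) + K * (4 * \<theta>) * p + X + c * R + z"
      for X c S T p R z :: real
      by (simp add: algebra_simps)
    ultimately show "of_bool (H a b) * (\<Sum>u\<in>U. G a u * G b u) + bil (N a b) (G a) (G b)
      = K * (of_bool (H a b) * (\<alpha> a * \<alpha> b)) + K * (4 * \<theta>) * (\<alpha> a * \<alpha> b)
      + (\<Sum>j<m. K * ((of_bool (H a b) + \<theta> * of_int (N a b)) * (\<beta> j a * \<beta> j b)))
      + (\<Sum>u\<in>U. of_bool (H a b) * (r a u * r b u)) + bil (N a b) (r a) (r b)"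
      unfolding b pair sum_distrib_left[symmetric, of "of_bool (H a b)"] by blast
  qed
  also have "\<dots> = K * (\<Sum>a\<in>I. \<Sum>b\<in>I. of_bool (H a b) * (\<alpha> a * \<alpha> b)) + K * (4 * \<theta>) * (\<Sum>a\<in>I. \<Sum>b\<in>I. \<alpha> a * \<alpha> b)
      + (\<Sum>j<m. K * (\<Sum>a\<in>I. \<Sum>b\<in>I. (of_bool (H a b) + \<theta> * of_int (N a b)) * (\<beta> j a * \<beta> j b)))
      + (\<Sum>u\<in>U. \<Sum>a\<in>I. \<Sum>b\<in>I. of_bool (H a b) * (r a u * r b u)) + (\<Sum>a\<in>I. \<Sum>b\<in>I. bil (N a b) (r a) (r b))"
  proof -
    have "(\<Sum>a\<in>I. \<Sum>b\<in>I. \<Sum>j<m. p a b j) = (\<Sum>j<m. \<Sum>a\<in>I. \<Sum>b\<in>I. p a b j)" for p :: "'a \<Rightarrow> 'a \<Rightarrow> nat \<Rightarrow> real"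
      by (rule sum_rotate[symmetric])
    moreover have "(\<Sum>a\<in>I. \<Sum>b\<in>I. \<Sum>u\<in>U. p a b u) = (\<Sum>u\<in>U. \<Sum>a\<in>I. \<Sum>b\<in>I. p a b u)" for p :: "'a \<Rightarrow> 'a \<Rightarrow> 'u \<Rightarrow> real"
      by (rule sum_rotate[symmetric])
    ultimately show ?thesis by (simp only: sum.distrib sum_distrib_left)
  qed
  also have "\<dots> \<le> K * (\<mu> * (\<Sum>a\<in>I. (\<alpha> a)\<^sup>2)) + 0 + (\<Sum>j<m. K * (lam * (\<Sum>a\<in>I. (\<beta> j a)\<^sup>2)))
      + \<mu> * (\<Sum>a\<in>I. ?q a) + 7/20 * \<theta> * real (card I) * (\<Sum>a\<in>I. ?q a)"
  proof (intro add_mono)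
    show "K * (\<Sum>a\<in>I. \<Sum>b\<in>I. of_bool (H a b) * (\<alpha> a * \<alpha> b)) \<le> K * (\<mu> * (\<Sum>a\<in>I. (\<alpha> a)\<^sup>2))"
      using K0 by (intro mult_left_mono H_form) auto
    show "K * (4 * \<theta>) * (\<Sum>a\<in>I. \<Sum>b\<in>I. \<alpha> a * \<alpha> b) \<le> 0"
      unfolding sum_product[symmetric] a0 by simp
    show "(\<Sum>j<m. K * (\<Sum>a\<in>I. \<Sum>b\<in>I. (of_bool (H a b) + \<theta> * of_int (N a b)) * (\<beta> j a * \<beta> j b)))
      \<le> (\<Sum>j<m. K * (lam * (\<Sum>a\<in>I. (\<beta> j a)\<^sup>2)))"
      using K0 by (intro sum_mono mult_left_mono HN_form) auto
    have "(\<Sum>u\<in>U. \<Sum>a\<in>I. \<Sum>b\<in>I. of_bool (H a b) * (r a u * r b u)) \<le> (\<Sum>u\<in>U. \<mu> * (\<Sum>a\<in>I. (r a u)\<^sup>2))"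
      by (intro sum_mono H_form)
    also have "\<dots> = \<mu> * (\<Sum>a\<in>I. \<Sum>u\<in>U. (r a u)\<^sup>2)"
      unfolding sum_distrib_left[symmetric] by (subst sum.swap) (rule refl)
    also have "(\<Sum>a\<in>I. \<Sum>u\<in>U. (r a u)\<^sup>2) = (\<Sum>a\<in>I. ?q a)"
      by (simp add: L2_set_def sum_nonneg)
    finally show "(\<Sum>u\<in>U. \<Sum>a\<in>I. \<Sum>b\<in>I. of_bool (H a b) * (r a u * r b u)) \<le> \<mu> * (\<Sum>a\<in>I. ?q a)" .
    have "(\<Sum>a\<in>I. \<Sum>b\<in>I. bil (N a b) (r a) (r b)) \<le> (\<Sum>a\<in>I. \<Sum>b\<in>I. 7/20 * \<theta> * (L2_set (r a) U * L2_set (r b) U))"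
      unfolding r_def by (intro sum_mono order_trans[OF abs_ge_self bil_rest_bound[OF N_sign]])
    also have "\<dots> = 7/20 * \<theta> * (\<Sum>a\<in>I. L2_set (r a) U)\<^sup>2"
      by (simp only: power2_eq_square sum_product) (simp only: sum_distrib_left)
    also have "\<dots> \<le> 7/20 * \<theta> * (real (card I) * (\<Sum>a\<in>I. ?q a))"
    proof (rule mult_left_mono)
      have "(\<Sum>a\<in>I. L2_set (r a) U) \<le> L2_set (\<lambda>a. L2_set (r a) U) I * L2_set (\<lambda>_. 1) I"
        using L2_set_mult_ineq[of "\<lambda>a. L2_set (r a) U" "\<lambda>_. 1" I] by simp
      then have "(\<Sum>a\<in>I. L2_set (r a) U)\<^sup>2 \<le> (L2_set (\<lambda>a. L2_set (r a) U) I * L2_set (\<lambda>_. 1) I)\<^sup>2"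
        by (intro power_mono sum_nonneg) auto
      also have "\<dots> = (\<Sum>a\<in>I. ?q a) * real (card I)"
        unfolding power_mult_distrib L2_set_def[of _ I] by (simp add: sum_nonneg)
      finally show "(\<Sum>a\<in>I. L2_set (r a) U)\<^sup>2 \<le> real (card I) * (\<Sum>a\<in>I. ?q a)" by (simp only: mult.commute)
    qed (use theta_pos in simp)
    finally show "(\<Sum>a\<in>I. \<Sum>b\<in>I. bil (N a b) (r a) (r b)) \<le> 7/20 * \<theta> * real (card I) * (\<Sum>a\<in>I. ?q a)"
      by (simp only: mult.assoc)
  qed
  also have "\<dots> = K * (\<mu> * (\<Sum>a\<in>I. (\<alpha> a)\<^sup>2)) + lam * (K * (\<Sum>j<m. \<Sum>a\<in>I. (\<beta> j a)\<^sup>2))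
      + (\<mu> + 7/20 * \<theta> * real (card I)) * (\<Sum>a\<in>I. ?q a)"
    unfolding sum_distrib_left[symmetric] distrib_right by simp
  also have "\<dots> \<le> K * (lam * (\<Sum>a\<in>I. (\<alpha> a)\<^sup>2)) + lam * (K * (\<Sum>j<m. \<Sum>a\<in>I. (\<beta> j a)\<^sup>2))
      + lam * (\<Sum>a\<in>I. ?q a)"
    using K0 mu_le gap by (intro add_mono mult_left_mono mult_right_mono order_refl sum_nonneg) auto
  also have "\<dots> = lam * (\<Sum>v\<in>U \<times> I. (F v)\<^sup>2)" unfolding norm by (simp only: distrib_left mult.left_commute)
  finally show ?thesis .
qed

lemma patterned_graph:
  assumes m: "m \<ge> 2"
  shows "\<exists>G. graph_on (card (U \<times> I)) G \<and> Digraph_Component.connected (with_proj G) \<and>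
    max_degree_le G (nat \<lfloor>(4 * \<theta> + 1) * real (card I)\<rfloor>) \<and>
    second_eigenvalue (adj_matrix G) = lam \<and> m \<le> eigenvalue_multiplicity (adj_matrix G) lam"
proof (rule graph_realization[where R = joined and x = "\<lambda>j v. h j (fst v) * y (snd v)"])
  show "finite (U \<times> I)" "U \<times> I \<noteq> {}" using U_nonempty I_nonempty by auto
  show "joined v w \<longleftrightarrow> joined w v" for v w
    unfolding joined_def using H_sym N_sym W_sym by metis
  show "\<not> joined v v" if "v \<in> U \<times> I" for v
    using that H_irrefl W_irrefl unfolding joined_def by auto
  show "lam < real (card {w \<in> U \<times> I. joined v w})" if "v \<in> U \<times> I" for v
    by (rule joined_degree(1)[OF that])
  show "card {w \<in> U \<times> I. joined v w} \<le> nat \<lfloor>(4 * \<theta> + 1) * real (card I)\<rfloor>" if "v \<in> U \<times> I" for v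
    using joined_degree(2)[OF that] by (simp add: le_nat_floor)
  have split: "(\<Sum>v\<in>U \<times> I. h i (fst v) * y (snd v) * (h j (fst v) * y (snd v))) = (\<Sum>u\<in>U. h i u * h j u) * (\<Sum>a\<in>I. (y a)\<^sup>2)" for i j
    unfolding sum_product sum.cartesian_product by (rule sum.cong) (auto simp: power2_eq_square)
  show "(\<Sum>v\<in>U \<times> I. h i (fst v) * y (snd v) * (h j (fst v) * y (snd v))) = 0" if "i < m" "j < m" "i \<noteq> j" for i j
    unfolding split h_orth[OF that] by simp
  show "(\<Sum>v\<in>U \<times> I. h j (fst v) * y (snd v) * (h j (fst v) * y (snd v))) \<noteq> 0" for j
    unfolding split h_square using y_nonzero U_nonempty by simp
qed (use joined_form joined_eigenvector m in blast)+

end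

text \<open>
  The number of vertices is at most \<open>card I * B * 128 ^ m\<close>, so \<open>ln n \<le> C * m\<close> with the constant \<open>C\<close> below. Infinitely many graphs arise
  because the multiplicities are unbounded.
\<close>
theorem (in pattern) many_graphs:
  assumes kernels: "\<And>m. \<exists>(U :: 'u set) W h. signed_kernels U W h m \<theta> \<and> real (card U) \<le> real B * 128 ^ m"
  shows "many_bounded_degree_graphs lam"
proof -
  define C where "C = ln (real B * real (card I)) + ln 128"
  define \<Delta> where "\<Delta> = nat \<lfloor>(4 * \<theta> + 1) * real (card I)\<rfloor>"
  have cardI: "card I > 0" using I_nonempty by (simp add: card_gt_0_iff)
  have B: "B > 0"
  proof (rule ccontr)
    assume "\<not> B > 0"
    obtain U :: "'u set" and W h where K: "signed_kernels U W h 0 \<theta>" "real (card U) \<le> real B * 128 ^ 0"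
      using kernels[of 0] by blast
    interpret signed_kernels U W h 0 \<theta> by (rule K(1))
    show False using K(2) \<open>\<not> B > 0\<close> card_U_pos by simp
  qed
  have BI: "1 \<le> real B * real (card I)"
  proof -
    have "1 \<le> B * card I" using B cardI by simp
    then show ?thesis unfolding of_nat_mult[symmetric] by linarith
  qed
  have C: "C > 0" unfolding C_def using BI by (intro add_nonneg_pos) auto
  define \<G> where "\<G> = {G :: nat pair_pre_digraph. \<exists>n \<ge> 2.
          graph_on n G \<and> Digraph_Component.connected (with_proj G) \<and> max_degree_le G \<Delta> \<and>
          second_eigenvalue (adj_matrix G) = lam \<and>
          real (eigenvalue_multiplicity (adj_matrix G) lam) \<ge> 1 / C * ln (ln (real n))}"
  have ex: "\<exists>G\<in>\<G>. m \<le> eigenvalue_multiplicity (adj_matrix G) lam" if m: "m \<ge> 2" for m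
  proof -
    obtain U :: "'u set" and W h where K: "signed_kernels U W h m \<theta>" "real (card U) \<le> real B * 128 ^ m"
      using kernels by blast
    interpret patterned_kernels I H N y \<theta> \<mu> lam U W h m
      using K(1) pattern_axioms by (simp add: patterned_kernels_def)
    obtain G where G: "graph_on (card (U \<times> I)) G" "Digraph_Component.connected (with_proj G)"
      "max_degree_le G \<Delta>" "second_eigenvalue (adj_matrix G) = lam"
      "m \<le> eigenvalue_multiplicity (adj_matrix G) lam"
      using patterned_graph[OF m] unfolding \<Delta>_def by blast
    define n where "n = card (U \<times> I)"
    have n2: "n \<ge> 2"
    proof -
      have "2 * 1 \<le> card U * card I" using card_U_ge_2 m cardI by (intro mult_le_mono) auto
      then show ?thesis by (simp add: n_def card_cartesian_product)
    qed
    have "real n \<le> real B * real (card I) * 128 ^ m"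
    proof -
      have "real (card U) * real (card I) \<le> real B * 128 ^ m * real (card I)"
        using K(2) by (intro mult_right_mono) auto
      then show ?thesis by (simp add: n_def card_cartesian_product mult_ac)
    qed
    then have "ln (real n) \<le> ln (real B * real (card I) * 128 ^ m)" using n2 by (intro ln_mono) auto
    also have "\<dots> = ln (real B * real (card I)) + real m * ln 128"
      using BI by (subst ln_mult) (auto simp: ln_realpow)
    also have "\<dots> \<le> real m * ln (real B * real (card I)) + real m * ln 128"
    proof -
      have "1 * ln (real B * real (card I)) \<le> real m * ln (real B * real (card I))"
        using BI m by (intro mult_right_mono) auto
      then show ?thesis by simp
    qed
    also have "\<dots> = C * real m" by (simp add: C_def algebra_simps)
    finally have l: "ln (real n) \<le> C * real m" .
    have "ln (real n) > 0" using n2 by simp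
    then have "ln (ln (real n)) \<le> ln (real n) - 1" by (rule ln_le_minus_one)
    then have "ln (ln (real n)) \<le> C * real m" using l by linarith
    then have "1 / C * ln (ln (real n)) \<le> real m" using C by (simp add: field_simps)
    also have "\<dots> \<le> real (eigenvalue_multiplicity (adj_matrix G) lam)" using G(5) by simp
    finally have "G \<in> \<G>" unfolding \<G>_def using n2 G unfolding n_def[symmetric] by blast
    then show ?thesis using G(5) by blast
  qed
  have "infinite \<G>"
  proof
    assume fin: "finite \<G>"
    let ?M = "Max ((\<lambda>G. eigenvalue_multiplicity (adj_matrix G) lam) ` \<G>)"
    obtain G where G: "G \<in> \<G>" "?M + 2 \<le> eigenvalue_multiplicity (adj_matrix G) lam"
      using ex[of "?M + 2"] by auto
    have "eigenvalue_multiplicity (adj_matrix G) lam \<le> ?M" using fin G(1) by simp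
    then show False using G(2) by simp
  qed
  then show ?thesis
    unfolding many_bounded_degree_graphs_def \<G>_def using C by (intro exI[of _ \<Delta>] exI[of _ "1 / C"]) auto
qed

section \<open>Patterns with integer and with quadratic top eigenvalue\<close>

lemma form_le_row_sums:
  fixes A :: "'a \<Rightarrow> 'a \<Rightarrow> real"
  assumes "\<And>a. a \<in> S \<Longrightarrow> (\<Sum>b\<in>S. \<bar>A a b\<bar>) \<le> c" "\<And>b. b \<in> S \<Longrightarrow> (\<Sum>a\<in>S. \<bar>A a b\<bar>) \<le> c"
  shows "2 * (\<Sum>a\<in>S. \<Sum>b\<in>S. A a b * (x a * y b)) \<le> c * ((\<Sum>a\<in>S. (x a)\<^sup>2) + (\<Sum>b\<in>S. (y b)\<^sup>2))"
proof -
  have "2 * (A a b * (x a * y b)) \<le> \<bar>A a b\<bar> * (x a)\<^sup>2 + \<bar>A a b\<bar> * (y b)\<^sup>2" for a b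
  proof -
    have "2 * (x a * y b) \<le> (x a)\<^sup>2 + (y b)\<^sup>2" "- (2 * (x a * y b)) \<le> (x a)\<^sup>2 + (y b)\<^sup>2"
      using zero_le_power2[of "x a - y b"] zero_le_power2[of "x a + y b"]
      by (simp_all add: power2_diff power2_sum)
    then have "\<bar>2 * (x a * y b)\<bar> \<le> (x a)\<^sup>2 + (y b)\<^sup>2" by (rule abs_leI)
    then have "\<bar>A a b\<bar> * \<bar>2 * (x a * y b)\<bar> \<le> \<bar>A a b\<bar> * ((x a)\<^sup>2 + (y b)\<^sup>2)"
      by (rule mult_left_mono) simp
    moreover have "2 * (A a b * (x a * y b)) \<le> \<bar>A a b\<bar> * \<bar>2 * (x a * y b)\<bar>"
      unfolding abs_mult[symmetric] using abs_ge_self[of "A a b * (2 * (x a * y b))"] by (simp only: mult.left_commute)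
    ultimately show ?thesis by (simp only: distrib_left)
  qed
  then have "2 * (\<Sum>a\<in>S. \<Sum>b\<in>S. A a b * (x a * y b)) \<le> (\<Sum>a\<in>S. \<Sum>b\<in>S. \<bar>A a b\<bar> * (x a)\<^sup>2 + \<bar>A a b\<bar> * (y b)\<^sup>2)"
    unfolding sum_distrib_left by (intro sum_mono)
  also have "\<dots> = (\<Sum>a\<in>S. (\<Sum>b\<in>S. \<bar>A a b\<bar>) * (x a)\<^sup>2) + (\<Sum>b\<in>S. (\<Sum>a\<in>S. \<bar>A a b\<bar>) * (y b)\<^sup>2)"
    unfolding sum.distrib sum_distrib_right by (rule arg_cong[OF sum.swap])
  also have "\<dots> \<le> (\<Sum>a\<in>S. c * (x a)\<^sup>2) + (\<Sum>b\<in>S. c * (y b)\<^sup>2)"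
    using assms by (intro add_mono sum_mono mult_right_mono) auto
  also have "\<dots> = c * ((\<Sum>a\<in>S. (x a)\<^sup>2) + (\<Sum>b\<in>S. (y b)\<^sup>2))"
    by (simp only: sum_distrib_left distrib_left)
  finally show ?thesis .
qed

lemma form_le_row_sum:
  fixes A :: "'a \<Rightarrow> 'a \<Rightarrow> real"
  assumes "\<And>a b. A a b = A b a" "\<And>a. a \<in> S \<Longrightarrow> (\<Sum>b\<in>S. \<bar>A a b\<bar>) \<le> c"
  shows "(\<Sum>a\<in>S. \<Sum>b\<in>S. A a b * (x a * x b)) \<le> c * (\<Sum>a\<in>S. (x a)\<^sup>2)"
proof -
  have "(\<Sum>a\<in>S. \<bar>A a b\<bar>) \<le> c" if "b \<in> S" for b
    using assms(2)[OF that] by (subst assms(1))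
  then have "2 * (\<Sum>a\<in>S. \<Sum>b\<in>S. A a b * (x a * x b)) \<le> c * ((\<Sum>a\<in>S. (x a)\<^sup>2) + (\<Sum>b\<in>S. (x b)\<^sup>2))"
    using assms(2) by (rule form_le_row_sums[rotated])
  then show ?thesis by (simp add: distrib_left)
qed

text \<open>
  If all row and column sums equal \<open>\<rho>\<close>, constants and mean-zero vectors do not interact.
\<close>
lemma regular_form_split:
  fixes A :: "'a \<Rightarrow> 'a \<Rightarrow> real" and x y :: "'a \<Rightarrow> real"
  assumes fin: "finite S" "S \<noteq> {}"
    and row: "\<And>a. a \<in> S \<Longrightarrow> (\<Sum>b\<in>S. A a b) = \<rho>" and col: "\<And>b. b \<in> S \<Longrightarrow> (\<Sum>a\<in>S. A a b) = \<rho>"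
  defines "mx \<equiv> (\<Sum>a\<in>S. x a) / real (card S)" and "my \<equiv> (\<Sum>a\<in>S. y a) / real (card S)"
  shows "(\<Sum>a\<in>S. \<Sum>b\<in>S. A a b * (x a * y b))
    = \<rho> * real (card S) * (mx * my) + (\<Sum>a\<in>S. \<Sum>b\<in>S. A a b * ((x a - mx) * (y b - my)))"
proof -
  have n: "real (card S) \<noteq> 0" using fin by simp
  have X: "(\<Sum>a\<in>S. x a) = real (card S) * mx" and Y: "(\<Sum>a\<in>S. y a) = real (card S) * my"
    unfolding mx_def my_def using n by simp_all
  have r: "(\<Sum>a\<in>S. \<Sum>b\<in>S. A a b * x a) = \<rho> * (\<Sum>a\<in>S. x a)"
    unfolding sum_distrib_right[symmetric] sum_distrib_left by (rule sum.cong[OF refl]) (simp only: row)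
  have "(\<Sum>a\<in>S. \<Sum>b\<in>S. A a b * y b) = (\<Sum>b\<in>S. \<Sum>a\<in>S. A a b * y b)" by (rule sum.swap)
  also have "\<dots> = \<rho> * (\<Sum>b\<in>S. y b)"
    unfolding sum_distrib_right[symmetric] sum_distrib_left by (rule sum.cong[OF refl]) (simp only: col)
  finally have c: "(\<Sum>a\<in>S. \<Sum>b\<in>S. A a b * y b) = \<rho> * (\<Sum>b\<in>S. y b)" .
  have t: "(\<Sum>a\<in>S. \<Sum>b\<in>S. A a b) = \<rho> * real (card S)" by (simp add: row)
  have "(\<Sum>a\<in>S. \<Sum>b\<in>S. A a b * ((x a - mx) * (y b - my)))
    = (\<Sum>a\<in>S. \<Sum>b\<in>S. A a b * (x a * y b) - my * (A a b * x a) - mx * (A a b * y b) + mx * my * A a b)"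
    by (intro sum.cong[OF refl]) (simp add: algebra_simps)
  also have "\<dots> = (\<Sum>a\<in>S. \<Sum>b\<in>S. A a b * (x a * y b)) - my * (\<rho> * (real (card S) * mx))
     - mx * (\<rho> * (real (card S) * my)) + mx * my * (\<rho> * real (card S))"
    by (simp only: sum.distrib sum_subtractf sum_distrib_left[symmetric] r c t X Y)
  finally show ?thesis by (simp add: algebra_simps)
qed

text \<open>
  The preceding lemma for the identity matrix.
\<close>
lemma sum_squares_split:
  fixes x :: "'a \<Rightarrow> real"
  assumes fin: "finite S" "S \<noteq> {}"
  shows "(\<Sum>a\<in>S. (x a)\<^sup>2) = real (card S) * ((\<Sum>a\<in>S. x a) / real (card S))\<^sup>2 + (\<Sum>a\<in>S. (x a - (\<Sum>a\<in>S. x a) / real (card S))\<^sup>2)"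
proof -
  have diag: "(\<Sum>a\<in>S. \<Sum>b\<in>S. of_bool (a = b) * (y a * y b)) = (\<Sum>a\<in>S. (y a)\<^sup>2)" for y :: "'a \<Rightarrow> real"
  proof (rule sum.cong[OF refl])
    fix a assume "a \<in> S"
    have "(\<Sum>b\<in>S. of_bool (a = b) * (y a * y b)) = (\<Sum>b\<in>S. if a = b then (y b)\<^sup>2 else 0)"
      by (rule sum.cong[OF refl]) (simp add: power2_eq_square)
    then show "(\<Sum>b\<in>S. of_bool (a = b) * (y a * y b)) = (y a)\<^sup>2" using \<open>a \<in> S\<close> fin by simp
  qed
  have one: "(\<Sum>b\<in>S. of_bool (a = b) :: real) = 1" "(\<Sum>b\<in>S. of_bool (b = a) :: real) = 1" if "a \<in> S" for a
    using that fin by (simp_all add: of_bool_def del: sum_of_bool_eq)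
  show ?thesis
    using regular_form_split[OF fin, of "\<lambda>a b. of_bool (a = b)" 1 x x] one
    unfolding diag by (simp add: power2_eq_square)
qed

text \<open>
  Two copies of \<open>Z_T\<close>, with a \<open>p\<close>-regular bipartite circulant graph \<open>band T p\<close> between them: the cell \<open>i\<close> of the first copy is
  joined to the cells \<open>i, ..., i + p - 1\<close> of the second. Any degree \<open>p \<le> T\<close> is possible, without parity conditions.
\<close>
definition cells :: "int \<Rightarrow> (bool \<times> int) set" where
  "cells T = UNIV \<times> {0..<T}"

definition band :: "int \<Rightarrow> nat \<Rightarrow> bool \<times> int \<Rightarrow> bool \<times> int \<Rightarrow> bool" where
  "band T p a b \<longleftrightarrow> fst a \<noteq> fst b \<and> (if fst a then snd a - snd b else snd b - snd a) mod T < int p"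

lemma finite_cells [simp]: "finite (cells T)" by (simp add: cells_def)

lemma card_cells: "card (cells (int T)) = 2 * T"
  by (simp add: cells_def card_cartesian_product card_UNIV_bool)

lemma band_sym: "band T p a b \<longleftrightarrow> band T p b a"
  by (cases a; cases b; cases "fst a"; cases "fst b") (auto simp: band_def)

lemma band_irrefl: "\<not> band T p a a" by (simp add: band_def)

lemma band_row_sum:
  assumes "p \<le> T" "a \<in> cells (int T)"
  shows "(\<Sum>b\<in>cells (int T). of_bool (band (int T) p a b)) = real p"
proof -
  obtain s i where a: "a = (s, i)" "0 \<le> i" "i < int T" using assms(2) by (auto simp: cells_def)
  have T: "int T > 0" using a by simp
  let ?N = "{b \<in> cells (int T). band (int T) p a b}"
  \<comment> \<open>The neighbours of \<open>(s, i)\<close>, listed by their offset \<open>r < p\<close>.\<close>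
  define \<phi> where "\<phi> r = (\<not> s, (if s then i - r else i + r) mod int T)" for r
  have "bij_betw \<phi> {0..<int p} ?N"
  proof (rule bij_betw_byWitness[where f' = "\<lambda>b. (if s then i - snd b else snd b - i) mod int T"])
    show "\<forall>r\<in>{0..<int p}. (if s then i - snd (\<phi> r) else snd (\<phi> r) - i) mod int T = r"
      using assms(1) by (auto simp: \<phi>_def mod_diff_right_eq mod_diff_left_eq)
    show "\<forall>b\<in>?N. \<phi> ((if s then i - snd b else snd b - i) mod int T) = b"
      by (auto simp: \<phi>_def a band_def cells_def mod_diff_right_eq mod_add_right_eq)
    show "\<phi> ` {0..<int p} \<subseteq> ?N"
      using assms(1) T by (auto simp: \<phi>_def a band_def cells_def mod_diff_right_eq mod_diff_left_eq)
    show "(\<lambda>b. (if s then i - snd b else snd b - i) mod int T) ` ?N \<subseteq> {0..<int p}"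
      using T by (auto simp: a band_def cells_def)
  qed
  then have "card ?N = p" using bij_betw_same_card by fastforce
  then show ?thesis by (simp add: Int_def)
qed

text \<open>
  Division of \<open>k\<close> by \<open>2 * t\<close> writes \<open>k = t * card (cells T) + p\<close>. Hence \<open>H + \<theta> N\<close>, with \<open>N = 1\<close>
  and \<open>H\<close> regular of degree \<open>p\<close>, has all row sums equal to \<open>k\<close>.
\<close>
lemma integer_pattern:
  assumes t: "t > 0" and k: "k \<ge> 4 * t\<^sup>2"
  defines "T \<equiv> k div (2 * t)" and "p \<equiv> k mod (2 * t)"
  shows "pattern (cells (int T)) (band (int T) p) (\<lambda>_ _. 1) (\<lambda>_. 1) (real t) (real p) (real k)"
proof -
  let ?I = "cells (int T)"
  have k_eq: "k = 2 * t * T + p" unfolding T_def p_def by simp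
  have p: "p < 2 * t" unfolding p_def using t by simp
  have "2 * t \<le> T"
    unfolding T_def using k t by (simp add: less_eq_div_iff_mult_less_eq power2_eq_square)
  then have pT: "p \<le> T" and T: "T \<ge> 1" using p t by linarith+
  have kr: "real k = real p + real t * real (card ?I)" unfolding card_cells by (simp add: k_eq)
  have row: "(\<Sum>b\<in>?I. of_bool (band (int T) p a b) + real t * of_int 1) = real k" if "a \<in> ?I" for a
    unfolding sum.distrib band_row_sum[OF pT that] kr by simp
  show ?thesis
  proof
    show "?I \<noteq> {}" using T by (auto simp: cells_def)
    show "(\<Sum>a\<in>?I. \<Sum>b\<in>?I. of_bool (band (int T) p a b) * (x a * x b)) \<le> real p * (\<Sum>a\<in>?I. (x a)\<^sup>2)" for x
      by (rule form_le_row_sum) (use band_sym band_row_sum[OF pT] in \<open>simp_all del: sum_of_bool_eq\<close>)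
    show "(\<Sum>a\<in>?I. \<Sum>b\<in>?I. (of_bool (band (int T) p a b) + real t * of_int 1) * (x a * x b)) \<le> real k * (\<Sum>a\<in>?I. (x a)\<^sup>2)" for x
      by (rule form_le_row_sum) (use band_sym row in \<open>simp_all del: sum_of_bool_eq\<close>)
    show "(\<Sum>b\<in>?I. (of_bool (band (int T) p a b) + real t * of_int 1) * 1) = real k * 1" if "a \<in> ?I" for a
      unfolding mult_1_right by (rule row[OF that])
    show "(\<Sum>a\<in>?I. 1\<^sup>2) \<noteq> (0::real)" using T by (simp add: card_cells)
    show "real p + 7 / 20 * real t * real (card ?I) \<le> real k" unfolding kr by simp
    have "real p < 2 * real t" using p by linarith
    also have "\<dots> \<le> 2 * (real t * real T)" using t T by simp
    finally have "real p < 2 * (real t * real T)" .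
    moreover have "0 < real t * real T" using t T by simp
    moreover have "real t * real (card ?I) = 2 * (real t * real T)" by (simp add: card_cells)
    ultimately show "real k < 4 * real t * real (card ?I)" unfolding kr mult.assoc by linarith
  qed (auto simp: band_sym band_irrefl)
qed

text \<open>
  The first component of a vertex is its class. Inside the classes the graph is a band of degree \<open>p\<^sub>0\<close> or \<open>p\<^sub>1\<close>; between the classes,
  cells are joined if they have the same index in \<open>Z_T\<close>, whichever copy they belong to, so the degree is 2. The sign is \<open>1\<close> in class 0,
  lowered to \<open>0\<close> along a band of degree 4, \<open>-1\<close> in class 1, and \<open>0\<close> between them.
\<close>
definition class_link :: "int \<Rightarrow> nat \<Rightarrow> nat \<Rightarrow> bool \<times> bool \<times> int \<Rightarrow> bool \<times> bool \<times> int \<Rightarrow> bool" where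
  "class_link T p\<^sub>0 p\<^sub>1 a b \<longleftrightarrow>
     (if fst a = fst b then band T (if fst a then p\<^sub>1 else p\<^sub>0) (snd a) (snd b) else snd (snd a) = snd (snd b))"

definition class_sign :: "int \<Rightarrow> bool \<times> bool \<times> int \<Rightarrow> bool \<times> bool \<times> int \<Rightarrow> int" where
  "class_sign T a b =
     (if fst a \<noteq> fst b then 0 else if fst a then - 1 else 1 - of_bool (band T 4 (snd a) (snd b)))"

lemma sum_two_classes:
  fixes f :: "bool \<times> 'b \<Rightarrow> real"
  shows "(\<Sum>a\<in>UNIV \<times> S. f a) = (\<Sum>c\<in>S. f (False, c)) + (\<Sum>c\<in>S. f (True, c))"
proof -
  have "(\<Sum>a\<in>UNIV \<times> S. f a) = (\<Sum>s\<in>UNIV. \<Sum>c\<in>S. f (s, c))"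
    unfolding sum.cartesian_product by (rule sum.cong) auto
  then show ?thesis by (simp add: UNIV_bool add.commute)
qed

lemma same_index_sum:
  assumes "a \<in> cells T"
  shows "(\<Sum>b\<in>cells T. of_bool (snd a = snd b) :: real) = 2"
proof -
  have "(\<Sum>b\<in>cells T. of_bool (snd a = snd b) :: real)
    = (\<Sum>i\<in>{0..<T}. of_bool (snd a = i)) + (\<Sum>i\<in>{0..<T}. of_bool (snd a = i))"
    unfolding cells_def by (subst sum_two_classes) (simp only: snd_conv)
  moreover have "(\<Sum>i\<in>{0..<T}. of_bool (snd a = i) :: real) = 1"
    using assms by (simp add: of_bool_def cells_def mem_Times_iff del: sum_of_bool_eq)
  ultimately show ?thesis by simp
qed

text \<open>
  \<open>lam\<close> is the larger eigenvalue of the symmetric matrix with rows \<open>(2u-1, 2)\<close> and \<open>(2, -2u-1)\<close>: the determinant of \<open>lam\<close> minus this matrix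
  vanishes, and its diagonal is positive.
\<close>
lemma two_by_two_form:
  fixes u lam m\<^sub>0 m\<^sub>1 :: real
  assumes lam: "lam = 2 * sqrt (u\<^sup>2 + 1) - 1" and u: "u \<ge> 0"
  shows "(lam + 1 - 2 * u) * (lam + 1 + 2 * u) = 4" and "lam + 1 - 2 * u > 0"
    and "(2 * u - 1) * m\<^sub>0\<^sup>2 - (2 * u + 1) * m\<^sub>1\<^sup>2 + 4 * (m\<^sub>0 * m\<^sub>1) \<le> lam * (m\<^sub>0\<^sup>2 + m\<^sub>1\<^sup>2)"
proof -
  define d where "d = lam + 1 - 2 * u"
  have "(sqrt (u\<^sup>2 + 1))\<^sup>2 = u\<^sup>2 + 1" by simp
  then show p: "(lam + 1 - 2 * u) * (lam + 1 + 2 * u) = 4"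
    unfolding lam by (simp add: power2_eq_square algebra_simps)
  have "sqrt (u\<^sup>2) < sqrt (u\<^sup>2 + 1)" by (rule real_sqrt_less_mono) simp
  then show pos: "lam + 1 - 2 * u > 0" unfolding lam using u by simp
  have p': "d * (d + 4 * u) = 4" using p unfolding d_def by (simp add: algebra_simps)
  have "d * (d * m\<^sub>0\<^sup>2 - 4 * (m\<^sub>0 * m\<^sub>1) + (d + 4 * u) * m\<^sub>1\<^sup>2) = (d * m\<^sub>0)\<^sup>2 - 4 * d * (m\<^sub>0 * m\<^sub>1) + (d * (d + 4 * u)) * m\<^sub>1\<^sup>2"
    by (simp add: power2_eq_square algebra_simps)
  also have "\<dots> = (d * m\<^sub>0 - 2 * m\<^sub>1)\<^sup>2" unfolding p' by (simp add: power2_eq_square algebra_simps)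
  finally have "0 \<le> d * (d * m\<^sub>0\<^sup>2 - 4 * (m\<^sub>0 * m\<^sub>1) + (d + 4 * u) * m\<^sub>1\<^sup>2)" by simp
  then have "0 \<le> d * m\<^sub>0\<^sup>2 - 4 * (m\<^sub>0 * m\<^sub>1) + (d + 4 * u) * m\<^sub>1\<^sup>2"
    using pos unfolding d_def[symmetric] by (simp add: zero_le_mult_iff)
  then show "(2 * u - 1) * m\<^sub>0\<^sup>2 - (2 * u + 1) * m\<^sub>1\<^sup>2 + 4 * (m\<^sub>0 * m\<^sub>1) \<le> lam * (m\<^sub>0\<^sup>2 + m\<^sub>1\<^sup>2)"
    unfolding d_def by (simp add: algebra_simps)
qed

text \<open>
  The degrees are chosen such that the row sums are \<open>p\<^sub>0 + t * (2 * T - 4) = 2 * u - 1\<close> in class 0, \<open>p\<^sub>1 - 2 * t * T = - (2 * u + 1)\<close> in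
  class 1 and \<open>2\<close> between the classes. On class-constant vectors the pattern is then the matrix of \<open>two_by_two_form\<close>. On
  vectors with mean zero in both classes the constant parts \<open>t\<close> and \<open>-t\<close> of the matrix disappear, and what remains has row sums bounded in
  terms of \<open>t\<close> alone, far below \<open>lam\<close> if \<open>u\<close> is large. The reduction of the sign along a band of degree 4 leaves
  room for a non-negative \<open>p\<^sub>0\<close>.
\<close>
lemma two_class_pattern:
  assumes t: "t > 0" and u: "u \<ge> 12 * t\<^sup>2"
    and T: "2 * t * T = 2 * u + 1 + p\<^sub>1" and p1: "p\<^sub>1 < 2 * t" and p0: "p\<^sub>0 = 4 * t - 2 - p\<^sub>1"
  defines "lam \<equiv> 2 * sqrt ((real u)\<^sup>2 + 1) - 1"
  shows "pattern (UNIV \<times> cells (int T)) (class_link (int T) p\<^sub>0 p\<^sub>1) (class_sign (int T))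
    (\<lambda>a. if fst a then lam + 1 - 2 * real u else 2) (real t) (4 * real t) lam"
proof -
  let ?S = "cells (int T)" and ?t = "real t" and ?u = "real u"
  define A\<^sub>0 where "A\<^sub>0 a b = of_bool (band (int T) p\<^sub>0 a b) + ?t * (1 - of_bool (band (int T) 4 a b))" for a b
  define A\<^sub>1 where "A\<^sub>1 a b = of_bool (band (int T) p\<^sub>1 a b) - ?t" for a b
  define C where "C a b = (of_bool (snd a = snd b) :: real)" for a b :: "bool \<times> int"
  have t1: "?t \<ge> 1" using t by simp
  have tt: "t \<le> t * t" using t by simp
  have big: "12 * t \<le> u" "12 * (t * t) \<le> u" using u tt unfolding power2_eq_square by linarith+
  have T8: "4 * t \<le> T"
  proof -
    have "2 * t * (4 * t) \<le> 2 * t * T" unfolding T using big by simp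
    then show ?thesis using t by simp
  qed
  have pT: "p\<^sub>0 \<le> T" "p\<^sub>1 \<le> T" "4 \<le> T" using T8 p0 p1 t by linarith+
  have S: "finite ?S" "?S \<noteq> {}" using pT by (auto simp: cells_def)
  have Tr: "?t * real (card ?S) = 2 * ?u + 1 + real p\<^sub>1"
  proof -
    have "real (2 * t * T) = real (2 * u + 1 + p\<^sub>1)" by (simp only: T)
    then show ?thesis by (simp add: card_cells mult_ac)
  qed
  have p0r: "real p\<^sub>0 + real p\<^sub>1 = 4 * ?t - 2" using p0 p1 by linarith
  have p1r: "real p\<^sub>1 \<le> 2 * ?t" using p1 by linarith
  have bigr: "12 * ?t \<le> ?u" using big(1) by linarith
  have lam_bounds: "2 * ?u - 1 \<le> lam" "lam \<le> 2 * ?u + 1"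
  proof -
    have "sqrt (?u\<^sup>2) \<le> sqrt (?u\<^sup>2 + 1)" by (rule real_sqrt_le_mono) simp
    then show "2 * ?u - 1 \<le> lam" unfolding lam_def by simp
    have "sqrt (?u\<^sup>2 + 1) \<le> sqrt ((?u + 1)\<^sup>2)" by (rule real_sqrt_le_mono) (simp add: power2_sum)
    then show "lam \<le> 2 * ?u + 1" unfolding lam_def by simp
  qed
  note two = two_by_two_form(3)[OF meta_eq_to_obj_eq[OF lam_def] of_nat_0_le_iff]
  have sym: "A\<^sub>0 a b = A\<^sub>0 b a" "A\<^sub>1 a b = A\<^sub>1 b a" "C a b = C b a" for a b
    unfolding A\<^sub>0_def A\<^sub>1_def C_def using band_sym by (auto simp: eq_commute)
  have row0: "(\<Sum>b\<in>?S. A\<^sub>0 a b) = 2 * ?u - 1" if "a \<in> ?S" for a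
  proof -
    have "(\<Sum>b\<in>?S. A\<^sub>0 a b) = real p\<^sub>0 + ?t * (real (card ?S) - real 4)"
      unfolding A\<^sub>0_def sum.distrib sum_distrib_left[symmetric] sum_subtractf band_row_sum[OF pT(1) that] band_row_sum[OF pT(3) that]
      by simp
    also have "\<dots> = 2 * ?u - 1" unfolding right_diff_distrib Tr using p0r by simp
    finally show ?thesis .
  qed
  have row1: "(\<Sum>b\<in>?S. A\<^sub>1 a b) = - (2 * ?u + 1)" if "a \<in> ?S" for a
  proof -
    have "(\<Sum>b\<in>?S. A\<^sub>1 a b) = real p\<^sub>1 - ?t * real (card ?S)"
      unfolding A\<^sub>1_def sum_subtractf band_row_sum[OF pT(2) that] by simp
    then show ?thesis unfolding Tr by simp
  qed
  have rowC: "(\<Sum>b\<in>?S. C a b) = 2" if "a \<in> ?S" for a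
    unfolding C_def by (rule same_index_sum[OF that])
  have colC: "(\<Sum>a\<in>?S. C a b) = 2" if "b \<in> ?S" for b
    using rowC[OF that] sym(3) by simp
  let ?M = "\<lambda>a b. of_bool (class_link (int T) p\<^sub>0 p\<^sub>1 a b) + ?t * of_int (class_sign (int T) a b)"
  have M: "?M (False, a) (False, b) = A\<^sub>0 a b" "?M (True, a) (True, b) = A\<^sub>1 a b"
    "?M (False, a) (True, b) = C a b" "?M (True, a) (False, b) = C a b" for a b
    unfolding class_link_def class_sign_def A\<^sub>0_def A\<^sub>1_def C_def by simp_all
  have form: "(\<Sum>a\<in>UNIV \<times> ?S. \<Sum>b\<in>UNIV \<times> ?S. ?M a b * (x a * x b)) \<le> lam * (\<Sum>a\<in>UNIV \<times> ?S. (x a)\<^sup>2)" for x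
  proof -
    define x\<^sub>0 where "x\<^sub>0 a = x (False, a)" for a
    define x\<^sub>1 where "x\<^sub>1 a = x (True, a)" for a
    define n where "n = real (card ?S)"
    define m\<^sub>0 where "m\<^sub>0 = (\<Sum>a\<in>?S. x\<^sub>0 a) / n"
    define m\<^sub>1 where "m\<^sub>1 = (\<Sum>a\<in>?S. x\<^sub>1 a) / n"
    define z\<^sub>0 where "z\<^sub>0 a = x\<^sub>0 a - m\<^sub>0" for a
    define z\<^sub>1 where "z\<^sub>1 a = x\<^sub>1 a - m\<^sub>1" for a
    have n: "n > 0" unfolding n_def using S by (simp add: card_gt_0_iff)
    have z0: "(\<Sum>a\<in>?S. z\<^sub>0 a) = 0" "(\<Sum>a\<in>?S. z\<^sub>1 a) = 0"
      unfolding z\<^sub>0_def z\<^sub>1_def m\<^sub>0_def m\<^sub>1_def sum_subtractf using n by (simp_all add: n_def[symmetric])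
    define q\<^sub>0 where "q\<^sub>0 = (\<Sum>a\<in>?S. (z\<^sub>0 a)\<^sup>2)"
    define q\<^sub>1 where "q\<^sub>1 = (\<Sum>a\<in>?S. (z\<^sub>1 a)\<^sup>2)"
    have q: "q\<^sub>0 \<ge> 0" "q\<^sub>1 \<ge> 0" unfolding q\<^sub>0_def q\<^sub>1_def by (simp_all add: sum_nonneg)
    have norm: "(\<Sum>a\<in>UNIV \<times> ?S. (x a)\<^sup>2) = n * (m\<^sub>0\<^sup>2 + m\<^sub>1\<^sup>2) + (q\<^sub>0 + q\<^sub>1)"
    proof -
      have "(\<Sum>a\<in>?S. (x\<^sub>0 a)\<^sup>2) = n * m\<^sub>0\<^sup>2 + q\<^sub>0" "(\<Sum>a\<in>?S. (x\<^sub>1 a)\<^sup>2) = n * m\<^sub>1\<^sup>2 + q\<^sub>1"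
        unfolding q\<^sub>0_def q\<^sub>1_def z\<^sub>0_def z\<^sub>1_def m\<^sub>0_def m\<^sub>1_def n_def by (rule sum_squares_split[OF S])+
      then show ?thesis unfolding sum_two_classes x\<^sub>0_def x\<^sub>1_def by (simp add: algebra_simps)
    qed
    have f0: "(\<Sum>a\<in>?S. \<Sum>b\<in>?S. A\<^sub>0 a b * (x\<^sub>0 a * x\<^sub>0 b)) = (2 * ?u - 1) * n * (m\<^sub>0 * m\<^sub>0) + (\<Sum>a\<in>?S. \<Sum>b\<in>?S. A\<^sub>0 a b * (z\<^sub>0 a * z\<^sub>0 b))"
      unfolding z\<^sub>0_def m\<^sub>0_def n_def by (rule regular_form_split[OF S]) (use row0 sym in auto)
    have f1: "(\<Sum>a\<in>?S. \<Sum>b\<in>?S. A\<^sub>1 a b * (x\<^sub>1 a * x\<^sub>1 b)) = - (2 * ?u + 1) * n * (m\<^sub>1 * m\<^sub>1) + (\<Sum>a\<in>?S. \<Sum>b\<in>?S. A\<^sub>1 a b * (z\<^sub>1 a * z\<^sub>1 b))"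
      unfolding z\<^sub>1_def m\<^sub>1_def n_def by (rule regular_form_split[OF S]) (use row1 sym in auto)
    have fC: "(\<Sum>a\<in>?S. \<Sum>b\<in>?S. C a b * (x\<^sub>0 a * x\<^sub>1 b)) = 2 * n * (m\<^sub>0 * m\<^sub>1) + (\<Sum>a\<in>?S. \<Sum>b\<in>?S. C a b * (z\<^sub>0 a * z\<^sub>1 b))"
      unfolding z\<^sub>0_def m\<^sub>0_def z\<^sub>1_def m\<^sub>1_def n_def by (rule regular_form_split[OF S rowC colC])
    have b0: "(\<Sum>a\<in>?S. \<Sum>b\<in>?S. A\<^sub>0 a b * (z\<^sub>0 a * z\<^sub>0 b)) \<le> (real p\<^sub>0 + 4 * ?t) * q\<^sub>0"
    proof -
      let ?B = "\<lambda>a b. of_bool (band (int T) p\<^sub>0 a b) - ?t * of_bool (band (int T) 4 a b)"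
      have "(\<Sum>a\<in>?S. \<Sum>b\<in>?S. A\<^sub>0 a b * (z\<^sub>0 a * z\<^sub>0 b)) = (\<Sum>a\<in>?S. \<Sum>b\<in>?S. ?B a b * (z\<^sub>0 a * z\<^sub>0 b) + ?t * (z\<^sub>0 a * z\<^sub>0 b))"
      proof (intro sum.cong[OF refl])
        fix a b
        have "(p + ?t * (1 - q)) * w = (p - ?t * q) * w + ?t * w" for p q w :: real
          by (simp add: algebra_simps)
        then show "A\<^sub>0 a b * (z\<^sub>0 a * z\<^sub>0 b) = ?B a b * (z\<^sub>0 a * z\<^sub>0 b) + ?t * (z\<^sub>0 a * z\<^sub>0 b)"
          unfolding A\<^sub>0_def .
      qed
      also have "\<dots> = (\<Sum>a\<in>?S. \<Sum>b\<in>?S. ?B a b * (z\<^sub>0 a * z\<^sub>0 b)) + ?t * ((\<Sum>a\<in>?S. z\<^sub>0 a) * (\<Sum>a\<in>?S. z\<^sub>0 a))"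
        unfolding sum_product by (simp only: sum.distrib sum_distrib_left)
      also have "\<dots> = (\<Sum>a\<in>?S. \<Sum>b\<in>?S. ?B a b * (z\<^sub>0 a * z\<^sub>0 b))" unfolding z0 by simp
      also have "\<dots> \<le> (real p\<^sub>0 + 4 * ?t) * q\<^sub>0"
        unfolding q\<^sub>0_def
      proof (rule form_le_row_sum)
        fix a b show "?B a b = ?B b a" by (simp only: band_sym[of _ _ a b])
      next
        fix a assume a: "a \<in> ?S"
        have "(\<Sum>b\<in>?S. \<bar>?B a b\<bar>) \<le> (\<Sum>b\<in>?S. of_bool (band (int T) p\<^sub>0 a b) + ?t * of_bool (band (int T) 4 a b))"
          by (intro sum_mono) (rule order_trans[OF abs_triangle_ineq4], simp)
        also have "\<dots> = real p\<^sub>0 + 4 * ?t"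
          unfolding sum.distrib sum_distrib_left[symmetric] band_row_sum[OF pT(1) a] band_row_sum[OF pT(3) a] by simp
        finally show "(\<Sum>b\<in>?S. \<bar>?B a b\<bar>) \<le> real p\<^sub>0 + 4 * ?t" .
      qed
      finally show ?thesis .
    qed
    have b1: "(\<Sum>a\<in>?S. \<Sum>b\<in>?S. A\<^sub>1 a b * (z\<^sub>1 a * z\<^sub>1 b)) \<le> real p\<^sub>1 * q\<^sub>1"
    proof -
      have "(\<Sum>a\<in>?S. \<Sum>b\<in>?S. A\<^sub>1 a b * (z\<^sub>1 a * z\<^sub>1 b))
        = (\<Sum>a\<in>?S. \<Sum>b\<in>?S. of_bool (band (int T) p\<^sub>1 a b) * (z\<^sub>1 a * z\<^sub>1 b)) - ?t * ((\<Sum>a\<in>?S. z\<^sub>1 a) * (\<Sum>a\<in>?S. z\<^sub>1 a))"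
        unfolding sum_product A\<^sub>1_def left_diff_distrib by (simp only: sum_subtractf sum_distrib_left)
      also have "\<dots> = (\<Sum>a\<in>?S. \<Sum>b\<in>?S. of_bool (band (int T) p\<^sub>1 a b) * (z\<^sub>1 a * z\<^sub>1 b))" unfolding z0 by simp
      also have "\<dots> \<le> real p\<^sub>1 * q\<^sub>1"
        unfolding q\<^sub>1_def by (rule form_le_row_sum) (use band_sym band_row_sum[OF pT(2)] in \<open>simp_all del: sum_of_bool_eq\<close>)
      finally show ?thesis .
    qed
    have bC: "2 * (\<Sum>a\<in>?S. \<Sum>b\<in>?S. C a b * (z\<^sub>0 a * z\<^sub>1 b)) \<le> 2 * (q\<^sub>0 + q\<^sub>1)"
      unfolding q\<^sub>0_def q\<^sub>1_def
    proof (rule form_le_row_sums)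
      have "\<bar>C a b\<bar> = C a b" for a b by (simp add: C_def)
      then show "(\<Sum>b\<in>?S. \<bar>C a b\<bar>) \<le> 2" "(\<Sum>b\<in>?S. \<bar>C b a\<bar>) \<le> 2" if "a \<in> ?S" for a
        using rowC[OF that] colC[OF that] by simp_all
    qed
    have swap: "(\<Sum>a\<in>?S. \<Sum>b\<in>?S. C a b * (x\<^sub>1 a * x\<^sub>0 b)) = (\<Sum>a\<in>?S. \<Sum>b\<in>?S. C a b * (x\<^sub>0 a * x\<^sub>1 b))"
      by (subst sum.swap) (intro sum.cong[OF refl], subst sym(3), simp only: mult_ac)
    have "(\<Sum>a\<in>UNIV \<times> ?S. \<Sum>b\<in>UNIV \<times> ?S. ?M a b * (x a * x b))
      = (\<Sum>a\<in>?S. \<Sum>b\<in>?S. A\<^sub>0 a b * (x\<^sub>0 a * x\<^sub>0 b)) + (\<Sum>a\<in>?S. \<Sum>b\<in>?S. C a b * (x\<^sub>0 a * x\<^sub>1 b))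
        + ((\<Sum>a\<in>?S. \<Sum>b\<in>?S. C a b * (x\<^sub>1 a * x\<^sub>0 b)) + (\<Sum>a\<in>?S. \<Sum>b\<in>?S. A\<^sub>1 a b * (x\<^sub>1 a * x\<^sub>1 b)))"
      unfolding sum_two_classes M sum.distrib x\<^sub>0_def x\<^sub>1_def by (simp only: add_ac)
    also have "\<dots> = n * ((2 * ?u - 1) * m\<^sub>0\<^sup>2 - (2 * ?u + 1) * m\<^sub>1\<^sup>2 + 4 * (m\<^sub>0 * m\<^sub>1))
      + ((\<Sum>a\<in>?S. \<Sum>b\<in>?S. A\<^sub>0 a b * (z\<^sub>0 a * z\<^sub>0 b)) + (\<Sum>a\<in>?S. \<Sum>b\<in>?S. A\<^sub>1 a b * (z\<^sub>1 a * z\<^sub>1 b))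
      + 2 * (\<Sum>a\<in>?S. \<Sum>b\<in>?S. C a b * (z\<^sub>0 a * z\<^sub>1 b)))"
      unfolding swap f0 f1 fC by (simp add: power2_eq_square algebra_simps)
    also have "\<dots> \<le> n * (lam * (m\<^sub>0\<^sup>2 + m\<^sub>1\<^sup>2)) + ((real p\<^sub>0 + 4 * ?t) * q\<^sub>0 + real p\<^sub>1 * q\<^sub>1 + 2 * (q\<^sub>0 + q\<^sub>1))"
      using n by (intro add_mono b0 b1 bC mult_left_mono two) auto
    also have "(real p\<^sub>0 + 4 * ?t) * q\<^sub>0 + real p\<^sub>1 * q\<^sub>1 + 2 * (q\<^sub>0 + q\<^sub>1) = (real p\<^sub>0 + 4 * ?t + 2) * q\<^sub>0 + (real p\<^sub>1 + 2) * q\<^sub>1"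
      by (simp only: ring_distribs)
    also have "\<dots> \<le> lam * q\<^sub>0 + lam * q\<^sub>1"
      using q p0r p1r bigr t1 lam_bounds(1) by (intro add_mono mult_right_mono) linarith+
    also have "n * (lam * (m\<^sub>0\<^sup>2 + m\<^sub>1\<^sup>2)) + (lam * q\<^sub>0 + lam * q\<^sub>1) = lam * (\<Sum>a\<in>UNIV \<times> ?S. (x a)\<^sup>2)"
      unfolding norm by (simp only: distrib_left mult.left_commute)
    finally show ?thesis by simp
  qed
  have linked: "(\<Sum>b\<in>UNIV \<times> ?S. of_bool (class_link (int T) p\<^sub>0 p\<^sub>1 a b)) \<le> 4 * ?t" if "a \<in> UNIV \<times> ?S" for a
  proof -
    obtain s c where a: "a = (s, c)" "c \<in> ?S" using \<open>a \<in> UNIV \<times> ?S\<close> by (cases a) auto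
    have "(\<Sum>b\<in>UNIV \<times> ?S. of_bool (class_link (int T) p\<^sub>0 p\<^sub>1 a b))
      = 2 + (\<Sum>b\<in>?S. of_bool (band (int T) (if s then p\<^sub>1 else p\<^sub>0) c b) :: real)"
      using same_index_sum[OF a(2)]
      unfolding sum_two_classes class_link_def a(1) by (cases s) (simp_all del: sum_of_bool_eq)
    also have "\<dots> = 2 + real (if s then p\<^sub>1 else p\<^sub>0)"
      using pT by (subst band_row_sum[OF _ a(2)]) auto
    also have "\<dots> \<le> 4 * ?t" using p0r p1r t1 by (cases s) simp_all
    finally show ?thesis .
  qed
  have lsym: "class_link (int T) p\<^sub>0 p\<^sub>1 a b \<longleftrightarrow> class_link (int T) p\<^sub>0 p\<^sub>1 b a" for a b
    unfolding class_link_def using band_sym by auto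
  have det: "(lam + 1 - 2 * ?u) * (lam + 1 + 2 * ?u) = 4" by (rule two_by_two_form(1)) (simp_all add: lam_def)
  show ?thesis
  proof
    show "finite ((UNIV :: bool set) \<times> ?S)" "(UNIV :: bool set) \<times> ?S \<noteq> {}" using S by auto
    show "(\<Sum>a\<in>UNIV \<times> ?S. \<Sum>b\<in>UNIV \<times> ?S. of_bool (class_link (int T) p\<^sub>0 p\<^sub>1 a b) * (x a * x b)) \<le> 4 * ?t * (\<Sum>a\<in>UNIV \<times> ?S. (x a)\<^sup>2)" for x
    proof (rule form_le_row_sum)
      fix a b show "(of_bool (class_link (int T) p\<^sub>0 p\<^sub>1 a b) :: real) = of_bool (class_link (int T) p\<^sub>0 p\<^sub>1 b a)"
        by (simp only: lsym[of a b])
    qed (use linked in \<open>simp del: sum_of_bool_eq\<close>)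
    show "(\<Sum>b\<in>UNIV \<times> ?S. ?M a b * (if fst b then lam + 1 - 2 * ?u else 2)) = lam * (if fst a then lam + 1 - 2 * ?u else 2)"
      if "a \<in> UNIV \<times> ?S" for a
    proof -
      obtain s c where a: "a = (s, c)" "c \<in> ?S" using \<open>a \<in> UNIV \<times> ?S\<close> by (cases a) auto
      have "(\<Sum>b\<in>UNIV \<times> ?S. ?M a b * (if fst b then lam + 1 - 2 * ?u else 2))
        = (\<Sum>b\<in>?S. ?M a (False, b)) * 2 + (\<Sum>b\<in>?S. ?M a (True, b)) * (lam + 1 - 2 * ?u)"
        unfolding sum_two_classes by (simp only: sum_distrib_right fst_conv if_True if_False)
      also have "\<dots> = lam * (if fst a then lam + 1 - 2 * ?u else 2)"
      proof (cases s)
        case True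
        then have s: "s = True" by simp
        have "2 * 2 + - (2 * ?u + 1) * (lam + 1 - 2 * ?u) = lam * (lam + 1 - 2 * ?u)"
          using det by (simp add: algebra_simps)
        then show ?thesis unfolding a(1) s M row1[OF a(2)] rowC[OF a(2)] by simp
      next
        case False
        then have s: "s = False" by simp
        have "(2 * ?u - 1) * 2 + 2 * (lam + 1 - 2 * ?u) = lam * 2" by (simp add: algebra_simps)
        then show ?thesis unfolding a(1) s M row0[OF a(2)] rowC[OF a(2)] by simp
      qed
      finally show ?thesis .
    qed
    have "(\<Sum>a\<in>UNIV \<times> ?S. (if fst a then lam + 1 - 2 * ?u else 2)\<^sup>2) = real (card ?S) * 4 + real (card ?S) * (lam + 1 - 2 * ?u)\<^sup>2"
      unfolding sum_two_classes by simp
    also have "\<dots> > 0" using S by (intro add_pos_nonneg) (auto simp: card_gt_0_iff)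
    finally show "(\<Sum>a\<in>UNIV \<times> ?S. (if fst a then lam + 1 - 2 * ?u else 2)\<^sup>2) \<noteq> 0" by simp
    have card: "real (card (UNIV \<times> ?S :: (bool \<times> bool \<times> int) set)) = 2 * real (card ?S)"
      by (simp add: card_cartesian_product card_UNIV_bool)
    have e: "7/20 * ?t * (2 * real (card ?S)) = 7/10 * (?t * real (card ?S))" by simp
    show "4 * ?t + 7/20 * ?t * real (card (UNIV \<times> ?S :: (bool \<times> bool \<times> int) set)) \<le> lam"
      unfolding card e Tr
    proof -
      have "4 * ?t + 7/10 * (2 * ?u + 1 + real p\<^sub>1) \<le> 4 * ?t + 7/10 * (2 * ?u + 1 + 2 * ?t)"
        using p1r by simp
      also have "\<dots> \<le> 2 * ?u - 1" using bigr t1 by (simp add: algebra_simps)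
      finally show "4 * ?t + 7/10 * (2 * ?u + 1 + real p\<^sub>1) \<le> lam" using lam_bounds(1) by (rule order_trans)
    qed
    have e: "4 * ?t * (2 * real (card ?S)) = 8 * (?t * real (card ?S))" by simp
    show "lam < 4 * ?t * real (card (UNIV \<times> ?S :: (bool \<times> bool \<times> int) set))"
      unfolding card e Tr
    proof -
      have "0 \<le> ?u" "0 \<le> real p\<^sub>1" by simp_all
      then have "2 * ?u + 1 < 8 * (2 * ?u + 1 + real p\<^sub>1)" by (simp add: algebra_simps)
      then show "lam < 8 * (2 * ?u + 1 + real p\<^sub>1)" using lam_bounds(2) by (rule le_less_trans[rotated])
    qed
  qed (use form lsym band_irrefl band_sym in \<open>auto simp: class_link_def class_sign_def\<close>)
qed

text \<open>
  \<open>T = u div t + 1\<close> is the least choice with \<open>2 * t * T \<ge> 2 * u + 1\<close>, and it keeps \<open>p\<^sub>1\<close> below \<open>2 * t\<close>.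
\<close>
lemma algebraic_pattern:
  assumes t: "t > 0" and u: "u \<ge> 12 * t\<^sup>2"
  shows "\<exists>(I :: (bool \<times> bool \<times> int) set) H N y \<mu>. pattern I H N y (real t) \<mu> (2 * sqrt ((real u)\<^sup>2 + 1) - 1)"
proof -
  define r where "r = u mod t"
  have r: "r < t" unfolding r_def using t by simp
  have "2 * t * (u div t + 1) = 2 * (t * (u div t)) + 2 * t" by (simp add: algebra_simps)
  also have "t * (u div t) = u - r" unfolding r_def by (simp add: minus_mod_eq_mult_div)
  finally have "2 * t * (u div t + 1) = 2 * u + 1 + (2 * t - 2 * r - 1)"
    using r mod_less_eq_dividend[of u t] unfolding r_def[symmetric] by linarith
  moreover have "2 * t - 2 * r - 1 < 2 * t" using t by simp
  ultimately show ?thesis using two_class_pattern[OF t u _ _ refl] by blast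
qed

theorem theorem1p5:
  shows "infinite {lam :: real. lam > 0 \<and> many_bounded_degree_graphs lam}
    \<and> (\<exists>k\<^sub>0 :: nat. \<forall>k \<ge> k\<^sub>0. many_bounded_degree_graphs (real k))
    \<and> (\<exists>u\<^sub>0 :: nat. \<forall>u \<ge> u\<^sub>0. many_bounded_degree_graphs (2 * sqrt ((real u)\<^sup>2 + 1) - 1))"
proof -
  obtain t B :: nat where t: "t > 0" and kernels: "\<And>m. \<exists>(U :: (((int \<times> int) \<times> nat set) \<times> int \<times> int \<times> int) set) W h.
     signed_kernels U W h m (real t) \<and> real (card U) \<le> real B * 128 ^ m"
    using signed_kernels_exist by blast
  have a: "many_bounded_degree_graphs (real k)" if "k \<ge> 4 * t\<^sup>2" for k
    by (rule pattern.many_graphs[OF integer_pattern[OF t that] kernels])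
  have b: "many_bounded_degree_graphs (2 * sqrt ((real u)\<^sup>2 + 1) - 1)" if u: "u \<ge> 12 * t\<^sup>2" for u
    using algebraic_pattern[OF t u] pattern.many_graphs[OF _ kernels] by blast
  have "infinite (real ` {4 * t\<^sup>2 + 1..})"
    using infinite_Ici by (subst finite_image_iff) (auto intro: inj_onI)
  moreover have "real ` {4 * t\<^sup>2 + 1..} \<subseteq> {lam. lam > 0 \<and> many_bounded_degree_graphs lam}"
    using a by auto
  ultimately have "infinite {lam :: real. lam > 0 \<and> many_bounded_degree_graphs lam}"
    using infinite_super by blast
  then show ?thesis using a b by blast
qed


end
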